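(* Let $\mathbf{T}:\mathbb{Z}^d\curvearrowright(X,\mu)$ be a Følner rank one action, with stacking towers $\{\mathcal{T}_n\}$ of shapes $\{F_n\}$ ($\{F_n\}$ a Følner sequence) fixed and descendant sets $I_{m,n}$ defined from these towers. The following are equivalent: (1) $(X,\mu,\mathbf{T})$ is conjugate to an infinite $\mathbb{Z}^d$-odometer. (2) For all $l\in\mathbb{N}$ and all $\epsilon>0$, there is a finite-index subgroup $G$ of $\mathbb{Z}^d$ such that (a) there exists $N_a\in\mathbb{N}$ so that for all $m\ge N_a$ there exists $D\subseteq\mathbb{Z}^d/G$ for which $$\frac{\#\left(I_{l,m}\,\triangle\,\{\mathbf{i}\in F_m:\mathbf{i}+G\in D\}\right)}{\#(I_{l,m})}<\epsilon;\text{ and}$$ (b) for every $\eta>0$ there is $N_b\in\mathbb{N}$ so that for all $n>m\ge N_b$ there exists $\mathbf{g}+G\in\mathbb{Z}^d/G$ where $$\frac{\#(\{\mathbf{i}\in I_{m,n}:\mathbf{i}\not\equiv\mathbf{g}\bmod G\})}{\#(I_{m,n})}<\eta.$$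
   Context: Measure-preserving $\mathbb{Z}^d$-action $\mathbf{T}:\mathbb{Z}^d\curvearrowright(X,\mu)$: $(X,\mathcal{X},\mu)$ is a (non-atomic) Lebesgue probability space, or a finite set with normalized counting measure; for each $\mathbf{v}\in\mathbb{Z}^d$, $\mathbf{T}^{\mathbf{v}}:X\to X$ is an invertible measurable measure-preserving map, with $\mathbf{T}^{\mathbf{v}+\mathbf{w}}=\mathbf{T}^{\mathbf{v}}\circ\mathbf{T}^{\mathbf{w}}$ and $\mathbf{T}^{\mathbf{0}}=\mathrm{id}$. A factor map from $(X,\mu,\mathbf{T})$ to $(Y,\nu,\mathbf{S})$ is a measurable $\phi:X\to Y$ whose push-forward of $\mu$ is $\nu$ and with $\phi(\mathbf{T}^{\mathbf{v}}(x))=\mathbf{S}^{\mathbf{v}}(\phi(x))$ for a.e. $x$ and every $\mathbf{v}$. Two actions are conjugate if there is a factor map from one to the other that is almost surely one-to-one. Odometers: for a decreasing sequence $\mathfrak{G}=\{G_j\}_{j\ge1}$ of finite-index subgroups of $\mathbb{Z}^d$, with quotient maps $q_j:\mathbb{Z}^d/G_{j+1}\to\mathbb{Z}^d/G_j$, $X_{\mathfrak{G}}=\{(\mathbf{x}_1,\mathbf{x}_2,\ldots):\mathbf{x}_j\in\mathbb{Z}^d/G_j,\ q_j(\mathbf{x}_{j+1})=\mathbf{x}_j\text{ for all }j\}$, $\sigma_{\mathfrak{G}}^{\mathbf{v}}(\mathbf{x}_1,\mathbf{x}_2,\ldots)=(\mathbf{x}_1+\mathbf{v}+G_1,\mathbf{x}_2+\mathbf{v}+G_2,\ldots)$,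 with Haar probability measure $\mu_{\mathfrak{G}}$. A $\mathbb{Z}^d$-odometer is any $\mathbb{Z}^d$-action conjugate to some $(X_{\mathfrak{G}},\mu_{\mathfrak{G}},\sigma_{\mathfrak{G}})$; it is infinite if $X_{\mathfrak{G}}$ is infinite (equivalently, $\mathfrak{G}$ is not eventually constant). A shape is a nonempty finite subset of $\mathbb{Z}^d$. A sequence of shapes $\{F_n\}$ is a Følner sequence if $\#(F_n\triangle(F_n+\mathbf{v}))/\#(F_n)\to0$ for every $\mathbf{v}\in\mathbb{Z}^d$. A $\mathbf{T}$-tower of shape $R$ with base $B$ (measurable, $\mu(B)>0$) consists of the pairwise disjoint sets $\mathbf{T}^{\mathbf{v}}(B)$, $\mathbf{v}\in R$ (the levels), together with the error set $E=X\setminus\bigcup_{\mathbf{v}\in R}\mathbf{T}^{\mathbf{v}}(B)$. $\mathbf{T}$ is rank one for $\{F_n\}$ if there are $\mathbf{T}$-towers $\mathcal{T}_n$ of shape $F_n$ such that for every measurable $A$ there are sets $L_n$, each a union of levels of $\mathcal{T}_n$, with $\mu(L_n\triangle A)\to0$. $\mathbf{T}$ is Følner rank one if it is rank one for some Følner sequence $\{F_n\}$. The towers are stacking if for every $n$ each level of $\mathcal{T}_n$ is a union of levels of $\mathcal{T}_{n+1}$ and the error sets satisfy $E_{n+1}\subseteq E_n$. It is known that for a Følner rank one action (with $\mathbf{0}\in F_n$ for all $n$) the towers, of shapes $F_n$, can be chosen to be stacking and still such that for every measurable $A$ there are sets $L_n$, each a union of levels of $\mathcal{T}_n$, with $\mu(L_n\triangle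 A)\to0$; throughout, such towers $\mathcal{T}_n$, with bases $B_n$ and shapes $F_n\ni\mathbf{0}$, are fixed. For $n\ge m$, the descendant set is $I_{m,n}=\{\mathbf{i}\in F_n:\mathbf{T}^{\mathbf{i}}(B_n)\subseteq B_m\}$; it is defined only for $n\ge m$, so in (a) one considers $m\ge l$ only. *)

theory Defs
  imports "HOL-Analysis.Analysis" "HOL-Algebra.Coset"
begin

subsection \<open>The group of integer vectors\<close>

text \<open>The dimension \<open>d\<close> is \<open>CARD('d)\<close>.\<close>

definition Zd :: "(int ^ 'd) monoid" where
  "Zd = \<lparr>carrier = UNIV, monoid.mult = (+), one = 0\<rparr>"

lemma comm_group_Zd: "comm_group (Zd :: (int ^ 'd) monoid)"
  by (rule comm_groupI) (auto simp: Zd_def intro: exI[of _ "- _"])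

definition finite_index_subgroup :: "(int ^ 'd) set \<Rightarrow> bool" where
  "finite_index_subgroup G \<longleftrightarrow> subgroup G Zd \<and> finite (rcosets\<^bsub>Zd\<^esub> G)"


subsection \<open>Measure-preserving actions\<close>

definition iso_mod_0 :: "'a measure \<Rightarrow> 'b measure \<Rightarrow> bool" where
  "iso_mod_0 M N \<longleftrightarrow>
     (\<exists>Z \<in> null_sets M. \<exists>Z' \<in> null_sets N. \<exists>h k.
        let M' = restrict_space M (space M - Z); N' = restrict_space N (space N - Z') in
        h \<in> M' \<rightarrow>\<^sub>M N' \<and> k \<in> N' \<rightarrow>\<^sub>M M' \<and>
        (\<forall>x\<in>space M'. k (h x) = x) \<and> (\<forall>y\<in>space N'. h (k y) = y) \<and>
        distr M' N' h = N')"

text \<open>Passing to the completion admits both complete spaces (for which it changes nothing)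
  and standard Borel spaces with their Borel sigma-algebra.\<close>

definition lebesgue_probability_space :: "'a measure \<Rightarrow> bool" where
  "lebesgue_probability_space M \<longleftrightarrow> iso_mod_0 (completion M) (lebesgue_on {0..1::real})"

definition finite_uniform_space :: "'a measure \<Rightarrow> bool" where
  "finite_uniform_space M \<longleftrightarrow>
     finite (space M) \<and> space M \<noteq> {} \<and> M = uniform_count_measure (space M)"

text \<open>Measurability of the inverse of \<open>T v\<close> is not listed: by the last three clauses the
  inverse is \<open>T (- v)\<close>, and \<open>T v\<close> is a bijection of the space.\<close>

definition zd_action :: "'a measure \<Rightarrow> (int ^ 'd \<Rightarrow> 'a \<Rightarrow> 'a) \<Rightarrow> bool" where
  "zd_action M T \<longleftrightarrow>
     (lebesgue_probability_space M \<or> finite_uniform_space M) \<and>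
     (\<forall>v. T v \<in> M \<rightarrow>\<^sub>M M \<and> distr M M (T v) = M) \<and>
     (\<forall>v w. \<forall>x\<in>space M. T (v + w) x = T v (T w x)) \<and>
     (\<forall>x\<in>space M. T 0 x = x)"

definition factor_map ::
  "'a measure \<Rightarrow> (int ^ 'd \<Rightarrow> 'a \<Rightarrow> 'a) \<Rightarrow> 'b measure \<Rightarrow> (int ^ 'd \<Rightarrow> 'b \<Rightarrow> 'b) \<Rightarrow> ('a \<Rightarrow> 'b) \<Rightarrow> bool"
where
  "factor_map M T N S \<phi> \<longleftrightarrow>
     \<phi> \<in> M \<rightarrow>\<^sub>M N \<and> distr M N \<phi> = N \<and> (\<forall>v. AE x in M. \<phi> (T v x) = S v (\<phi> x))"

definition ae_injective :: "'a measure \<Rightarrow> ('a \<Rightarrow> 'b) \<Rightarrow> bool" where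
  "ae_injective M \<phi> \<longleftrightarrow> (\<exists>Z\<in>null_sets M. inj_on \<phi> (space M - Z))"

definition conjugate ::
  "'a measure \<Rightarrow> (int ^ 'd \<Rightarrow> 'a \<Rightarrow> 'a) \<Rightarrow> 'b measure \<Rightarrow> (int ^ 'd \<Rightarrow> 'b \<Rightarrow> 'b) \<Rightarrow> bool"
where
  "conjugate M T N S \<longleftrightarrow>
     (\<exists>\<phi>. factor_map M T N S \<phi> \<and> ae_injective M \<phi>) \<or>
     (\<exists>\<psi>. factor_map N S M T \<psi> \<and> ae_injective N \<psi>)"


subsection \<open>Odometers\<close>

text \<open>The sequence of subgroups is indexed from \<open>0\<close>.\<close>

definition odometer_data :: "(nat \<Rightarrow> (int ^ 'd) set) \<Rightarrow> bool" where
  "odometer_data G \<longleftrightarrow> (\<forall>j. finite_index_subgroup (G j)) \<and> decseq G"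

text \<open>For \<open>K \<subseteq> H\<close> and a coset \<open>C = v + K\<close>, the set sum \<open>H + C\<close> is the coset \<open>v + H\<close>, so this is
  the quotient map from the cosets of \<open>K\<close> to those of \<open>H\<close>.\<close>

definition quotient_map :: "(int ^ 'd) set \<Rightarrow> (int ^ 'd) set \<Rightarrow> (int ^ 'd) set" where
  "quotient_map H C = H <#>\<^bsub>Zd\<^esub> C"

definition odometer_space :: "(nat \<Rightarrow> (int ^ 'd) set) \<Rightarrow> (nat \<Rightarrow> (int ^ 'd) set) set" where
  "odometer_space G =
     {x. \<forall>j. x j \<in> rcosets\<^bsub>Zd\<^esub> (G j) \<and> quotient_map (G j) (x (Suc j)) = x j}"

definition odometer_shift ::
  "int ^ 'd \<Rightarrow> (nat \<Rightarrow> (int ^ 'd) set) \<Rightarrow> (nat \<Rightarrow> (int ^ 'd) set)" where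
  "odometer_shift v x = (\<lambda>j. x j #>\<^bsub>Zd\<^esub> v)"

text \<open>The group operation of the odometer: addition of cosets in each coordinate.\<close>

definition odometer_add ::
  "(nat \<Rightarrow> (int ^ 'd) set) \<Rightarrow> (nat \<Rightarrow> (int ^ 'd) set) \<Rightarrow> (nat \<Rightarrow> (int ^ 'd) set)" where
  "odometer_add g x = (\<lambda>j. g j <#>\<^bsub>Zd\<^esub> x j)"

text \<open>The odometer is a compact subgroup of a countable product of finite discrete groups, so its
  Borel sigma-algebra is the trace of the product sigma-algebra. Haar probability measure is the
  (unique) translation invariant probability measure on it.\<close>

definition odometer_haar ::
  "(nat \<Rightarrow> (int ^ 'd) set) \<Rightarrow> (nat \<Rightarrow> (int ^ 'd) set) measure \<Rightarrow> bool" where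
  "odometer_haar G \<nu> \<longleftrightarrow>
     sets \<nu> = sets (restrict_space (\<Pi>\<^sub>M j\<in>UNIV. count_space (rcosets\<^bsub>Zd\<^esub> (G j))) (odometer_space G)) \<and>
     emeasure \<nu> (space \<nu>) = 1 \<and>
     (\<forall>g\<in>odometer_space G. \<forall>A\<in>sets \<nu>. emeasure \<nu> (odometer_add g ` A) = emeasure \<nu> A)"

definition conjugate_to_infinite_odometer :: "'a measure \<Rightarrow> (int ^ 'd \<Rightarrow> 'a \<Rightarrow> 'a) \<Rightarrow> bool" where
  "conjugate_to_infinite_odometer M T \<longleftrightarrow>
     (\<exists>G \<nu>. odometer_data G \<and> infinite (odometer_space G) \<and> odometer_haar G \<nu> \<and>
            conjugate M T \<nu> odometer_shift)"


subsection \<open>Towers and rank one\<close>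

definition folner_sequence :: "(nat \<Rightarrow> (int ^ 'd) set) \<Rightarrow> bool" where
  "folner_sequence F \<longleftrightarrow>
     (\<forall>n. finite (F n) \<and> F n \<noteq> {}) \<and>
     (\<forall>v. (\<lambda>n. real (card (sym_diff (F n) ((\<lambda>i. i + v) ` F n))) / real (card (F n))) \<longlonglongrightarrow> 0)"

definition tower :: "'a measure \<Rightarrow> (int ^ 'd \<Rightarrow> 'a \<Rightarrow> 'a) \<Rightarrow> (int ^ 'd) set \<Rightarrow> 'a set \<Rightarrow> bool" where
  "tower M T R B \<longleftrightarrow>
     finite R \<and> R \<noteq> {} \<and> B \<in> sets M \<and> measure M B > 0 \<and> disjoint_family_on (\<lambda>v. T v ` B) R"

definition tower_error :: "'a measure \<Rightarrow> (int ^ 'd \<Rightarrow> 'a \<Rightarrow> 'a) \<Rightarrow> (int ^ 'd) set \<Rightarrow> 'a set \<Rightarrow> 'a set" where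
  "tower_error M T R B = space M - (\<Union>v\<in>R. T v ` B)"

definition union_of_levels :: "(int ^ 'd \<Rightarrow> 'a \<Rightarrow> 'a) \<Rightarrow> (int ^ 'd) set \<Rightarrow> 'a set \<Rightarrow> 'a set \<Rightarrow> bool" where
  "union_of_levels T R B L \<longleftrightarrow> (\<exists>D\<subseteq>R. L = (\<Union>v\<in>D. T v ` B))"

definition rank_one_towers ::
  "'a measure \<Rightarrow> (int ^ 'd \<Rightarrow> 'a \<Rightarrow> 'a) \<Rightarrow> (nat \<Rightarrow> (int ^ 'd) set) \<Rightarrow> (nat \<Rightarrow> 'a set) \<Rightarrow> bool"
where
  "rank_one_towers M T F B \<longleftrightarrow>
     (\<forall>n. tower M T (F n) (B n)) \<and>
     (\<forall>A\<in>sets M. \<exists>L. (\<forall>n. union_of_levels T (F n) (B n) (L n)) \<and>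
                     (\<lambda>n. measure M (sym_diff (L n) A)) \<longlonglongrightarrow> 0)"

definition folner_rank_one :: "'a measure \<Rightarrow> (int ^ 'd \<Rightarrow> 'a \<Rightarrow> 'a) \<Rightarrow> bool" where
  "folner_rank_one M T \<longleftrightarrow> (\<exists>F B. folner_sequence F \<and> rank_one_towers M T F B)"

definition stacking ::
  "'a measure \<Rightarrow> (int ^ 'd \<Rightarrow> 'a \<Rightarrow> 'a) \<Rightarrow> (nat \<Rightarrow> (int ^ 'd) set) \<Rightarrow> (nat \<Rightarrow> 'a set) \<Rightarrow> bool"
where
  "stacking M T F B \<longleftrightarrow>
     (\<forall>n. (\<forall>v\<in>F n. union_of_levels T (F (Suc n)) (B (Suc n)) (T v ` B n)) \<and>
          tower_error M T (F (Suc n)) (B (Suc n)) \<subseteq> tower_error M T (F n) (B n))"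

text \<open>Meaningful only for \<open>m \<le> n\<close>.\<close>

definition descendants ::
  "(int ^ 'd \<Rightarrow> 'a \<Rightarrow> 'a) \<Rightarrow> (nat \<Rightarrow> (int ^ 'd) set) \<Rightarrow> (nat \<Rightarrow> 'a set) \<Rightarrow> nat \<Rightarrow> nat \<Rightarrow> (int ^ 'd) set"
where
  "descendants T F B m n = {i \<in> F n. T i ` B n \<subseteq> B m}"

end

theory Submission
  imports Defs
begin

text \<open>The two conditions are linked by \<^emph>\<open>labellings\<close>: measurable maps \<open>f\<close> from the space to the cosets of a
finite-index subgroup \<open>G\<close> with \<open>f (T v x) = f x + v\<close> almost everywhere (\<open>coset_label\<close>). Each of the
two conditions comes down to the existence of labellings whose classes approximate the bases \<open>B l\<close>.

\<^emph>\<open>From an odometer to the counting conditions.\<close> The coordinates of the odometer are labellings, and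
cylinder sets approximate all measurable sets. To have this on the given space, whichever way the
almost injective factor map points, one needs that an almost injective measurable map between standard
spaces generates the whole sigma-algebra modulo null sets. A compactness argument gives it
(\<open>injective_continuous_image_separates_sets\<close>): up to small measure, a set and its
complement can be replaced by compact sets, and an injective continuous map sends these to disjoint
compact sets.
Given a labelling, a class of positive measure is approximated by unions of levels, so it almost
contains some level of every late tower; as all levels are translates of the base, the base itself
lies almost entirely in one class (\<open>base_mostly_in_one_class\<close>), and the level \<open>T i ` B m\<close> almost
entirely in the class translated by \<open>i\<close>. So the class of a level is decided by its index modulo \<open>G\<close>.
A level of tower \<open>n\<close> inside \<open>B m\<close> whose index is in the wrong coset lies almost entirely in the small
part of \<open>B m\<close> outside the main class, so there are few such levels: this is (b). Similarly, an index
that spoils (a) costs about one whole level of the small difference between \<open>B l\<close> and a union of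
classes.

\<^emph>\<open>From the counting conditions to an odometer.\<close> Countably many subgroups suffice for (a), and
(b) passes to finite intersections, so there is a decreasing sequence \<open>G j\<close> of subgroups that all
satisfy (b) and among which each instance of (a) is satisfied by some \<open>G j\<close>. By (b), passing from
tower \<open>m k\<close> to tower \<open>m (Suc k)\<close> changes the index of the level that contains a point by almost always the same vector
modulo \<open>G k\<close>. After subtracting the accumulated vectors \<open>h k\<close>, the index of the level of a
point is eventually constant modulo every \<open>G j\<close>, if the towers \<open>m k\<close> are chosen so sparse that the
Borel--Cantelli lemma applies. The limits form a point of the odometer, which defines the map
\<open>phi\<close>. The Folner property makes it equivariant, the push-forward of the measure is then invariant under
a dense subgroup, hence equal to Haar measure, and (a) says that every base, hence every measurable set, is
a preimage under \<open>phi\<close> modulo a null set. Therefore \<open>phi\<close> is almost injective.\<close>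

section \<open>Cosets of integer vectors\<close>

lemma Zd_r_coset: "C #>\<^bsub>Zd\<^esub> v = (\<lambda>g. g + v) ` C"
  by (auto simp: r_coset_def Zd_def)

lemma mem_Zd_coset_iff: "w \<in> G #>\<^bsub>Zd\<^esub> v \<longleftrightarrow> w - v \<in> G"
  by (auto simp: Zd_r_coset image_iff intro: bexI[of _ "w - v"])

lemma Zd_coset_coset: "(C #>\<^bsub>Zd\<^esub> v) #>\<^bsub>Zd\<^esub> w = C #>\<^bsub>Zd\<^esub> (v + w)"
  by (auto simp: set_eq_iff mem_Zd_coset_iff algebra_simps)

lemma Zd_coset_0: "C #>\<^bsub>Zd\<^esub> 0 = C"
  by (auto simp: set_eq_iff mem_Zd_coset_iff)

lemma Zd_rcosets: "rcosets\<^bsub>Zd\<^esub> G = range (\<lambda>v. G #>\<^bsub>Zd\<^esub> v)"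
  by (auto simp: RCOSETS_def Zd_def)

lemma Zd_subgroup_iff:
  fixes G :: "(int ^ 'd) set"
  shows "subgroup G Zd \<longleftrightarrow> 0 \<in> G \<and> (\<forall>x\<in>G. \<forall>y\<in>G. x + y \<in> G) \<and> (\<forall>x\<in>G. - x \<in> G)"
proof -
  interpret comm_group "Zd :: (int ^ 'd) monoid" by (rule comm_group_Zd)
  have inv: "inv\<^bsub>Zd\<^esub> x = - x" for x :: "int ^ 'd"
    by (rule inv_equality) (auto simp: Zd_def)
  show ?thesis
    unfolding subgroup_def inv by (auto simp: Zd_def)
qed

lemma Zd_subgroup_diff: "subgroup G Zd \<Longrightarrow> x \<in> G \<Longrightarrow> y \<in> G \<Longrightarrow> x - y \<in> G"
  unfolding Zd_subgroup_iff by (metis uminus_add_conv_diff add.commute)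

lemma Zd_coset_eq_iff:
  assumes "subgroup G Zd"
  shows "G #>\<^bsub>Zd\<^esub> v = G #>\<^bsub>Zd\<^esub> w \<longleftrightarrow> v - w \<in> G"
proof
  assume "G #>\<^bsub>Zd\<^esub> v = G #>\<^bsub>Zd\<^esub> w"
  moreover have "v \<in> G #>\<^bsub>Zd\<^esub> v"
    using assms by (simp add: mem_Zd_coset_iff Zd_subgroup_iff)
  ultimately show "v - w \<in> G" by (simp add: mem_Zd_coset_iff)
next
  assume vw: "v - w \<in> G"
  have "x - v \<in> G \<longleftrightarrow> x - w \<in> G" for x
    using assms vw Zd_subgroup_diff[OF assms, of "x - w" "v - w"]
    unfolding Zd_subgroup_iff by (metis (no_types, lifting) diff_add_cancel diff_diff_eq2 add_diff_eq)
  then show "G #>\<^bsub>Zd\<^esub> v = G #>\<^bsub>Zd\<^esub> w"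
    by (auto simp: set_eq_iff mem_Zd_coset_iff)
qed

lemma Zd_coset_rep:
  assumes "subgroup G Zd" "c \<in> rcosets\<^bsub>Zd\<^esub> G" "v \<in> c"
  shows "c = G #>\<^bsub>Zd\<^esub> v"
proof -
  obtain w where w: "c = G #>\<^bsub>Zd\<^esub> w" using assms(2) by (auto simp: Zd_rcosets)
  then show ?thesis using assms(1,3) Zd_coset_eq_iff[OF assms(1), of v w]
    by (simp add: mem_Zd_coset_iff)
qed

lemma Zd_coset_shift_in_rcosets:
  "c \<in> rcosets\<^bsub>Zd\<^esub> G \<Longrightarrow> c #>\<^bsub>Zd\<^esub> v \<in> rcosets\<^bsub>Zd\<^esub> G"
  by (auto simp: Zd_rcosets Zd_coset_coset)

lemma Zd_coset_in_rcosets: "G #>\<^bsub>Zd\<^esub> v \<in> rcosets\<^bsub>Zd\<^esub> G"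
  by (auto simp: Zd_rcosets)

lemma Zd_rcosets_nonempty: "subgroup G Zd \<Longrightarrow> c \<in> rcosets\<^bsub>Zd\<^esub> G \<Longrightarrow> c \<noteq> {}"
  by (auto simp: Zd_rcosets Zd_r_coset Zd_subgroup_iff)

lemma Zd_rcosets_eq_iff:
  assumes "subgroup G Zd" "c \<in> rcosets\<^bsub>Zd\<^esub> G"
  shows "c = G #>\<^bsub>Zd\<^esub> v \<longleftrightarrow> v \<in> c"
  using Zd_coset_rep[OF assms] assms(1) by (auto simp: mem_Zd_coset_iff Zd_subgroup_iff)

lemma Zd_set_mult_coset:
  assumes "subgroup H Zd" "K \<subseteq> H" "0 \<in> K"
  shows "(H #>\<^bsub>Zd\<^esub> v) <#>\<^bsub>Zd\<^esub> (K #>\<^bsub>Zd\<^esub> w) = H #>\<^bsub>Zd\<^esub> (v + w)"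
proof -
  have *: "x \<in> (H #>\<^bsub>Zd\<^esub> v) <#>\<^bsub>Zd\<^esub> (K #>\<^bsub>Zd\<^esub> w) \<longleftrightarrow> (\<exists>h\<in>H. \<exists>k\<in>K. x = (h + v) + (k + w))" for x
    unfolding set_mult_def Zd_r_coset by (force simp: Zd_def)
  show ?thesis
  proof (intro equalityI subsetI)
    fix x assume "x \<in> (H #>\<^bsub>Zd\<^esub> v) <#>\<^bsub>Zd\<^esub> (K #>\<^bsub>Zd\<^esub> w)"
    then obtain h k where "h \<in> H" "k \<in> K" "x = (h + v) + (k + w)" using * by blast
    moreover have "h + k \<in> H" using assms \<open>h \<in> H\<close> \<open>k \<in> K\<close> by (auto simp: Zd_subgroup_iff)
    ultimately show "x \<in> H #>\<^bsub>Zd\<^esub> (v + w)"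
      by (simp add: mem_Zd_coset_iff algebra_simps)
  next
    fix x assume "x \<in> H #>\<^bsub>Zd\<^esub> (v + w)"
    then have "x - (v + w) \<in> H" by (simp add: mem_Zd_coset_iff)
    moreover have "x = ((x - (v + w)) + v) + (0 + w)" by simp
    ultimately show "x \<in> (H #>\<^bsub>Zd\<^esub> v) <#>\<^bsub>Zd\<^esub> (K #>\<^bsub>Zd\<^esub> w)"
      using assms(3) * by blast
  qed
qed

lemma quotient_map_coset:
  assumes "subgroup H Zd" "subgroup K Zd" "K \<subseteq> H"
  shows "quotient_map H (K #>\<^bsub>Zd\<^esub> v) = H #>\<^bsub>Zd\<^esub> v"
  using Zd_set_mult_coset[OF assms(1,3), of 0 v] assms(2)
  by (simp add: quotient_map_def Zd_coset_0 Zd_subgroup_iff)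

lemma Zd_coset_add:
  assumes "subgroup G Zd"
  shows "(G #>\<^bsub>Zd\<^esub> v) <#>\<^bsub>Zd\<^esub> (G #>\<^bsub>Zd\<^esub> w) = G #>\<^bsub>Zd\<^esub> (v + w)"
  using Zd_set_mult_coset[OF assms, of G v w] assms by (simp add: Zd_subgroup_iff)

lemma finite_index_subgroup_Int:
  assumes "finite_index_subgroup G" "finite_index_subgroup H"
  shows "finite_index_subgroup (G \<inter> H)"
proof -
  have sub: "subgroup (G \<inter> H) Zd"
    using assms by (auto simp: finite_index_subgroup_def Zd_subgroup_iff)
  have "C \<in> (\<lambda>(a, b). a \<inter> b) ` ((rcosets\<^bsub>Zd\<^esub> G) \<times> (rcosets\<^bsub>Zd\<^esub> H))"
    if C: "C \<in> rcosets\<^bsub>Zd\<^esub> (G \<inter> H)" for C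
  proof -
    obtain v where "C = (G \<inter> H) #>\<^bsub>Zd\<^esub> v" using C unfolding Zd_rcosets by blast
    then have "C = (G #>\<^bsub>Zd\<^esub> v) \<inter> (H #>\<^bsub>Zd\<^esub> v)"
      by (simp add: set_eq_iff mem_Zd_coset_iff)
    then show ?thesis using Zd_coset_in_rcosets[of G v] Zd_coset_in_rcosets[of H v] by auto
  qed
  then have "rcosets\<^bsub>Zd\<^esub> (G \<inter> H) \<subseteq> (\<lambda>(a, b). a \<inter> b) ` ((rcosets\<^bsub>Zd\<^esub> G) \<times> (rcosets\<^bsub>Zd\<^esub> H))"
    by blast
  then have "finite (rcosets\<^bsub>Zd\<^esub> (G \<inter> H))"
    by (rule finite_subset) (use assms in \<open>auto simp: finite_index_subgroup_def\<close>)
  then show ?thesis using sub by (simp add: finite_index_subgroup_def)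
qed

lemma finite_index_subgroup_INT_atMost:
  assumes "\<And>k::nat. finite_index_subgroup (H k)"
  shows "finite_index_subgroup (\<Inter>k\<le>j. H k)"
proof (induction j)
  case 0
  then show ?case using assms by simp
next
  case (Suc j)
  then show ?case
    using finite_index_subgroup_Int[OF assms[of "Suc j"] Suc] by (simp add: atMost_Suc)
qed

section \<open>Approximation in finite measure spaces\<close>

lemma (in finite_measure) measure_sym_diff_triangle:
  assumes [measurable]: "A \<in> sets M" "B \<in> sets M" "C \<in> sets M"
  shows "measure M (sym_diff A C) \<le> measure M (sym_diff A B) + measure M (sym_diff B C)"
proof -
  have "measure M (sym_diff A C) \<le> measure M (sym_diff A B \<union> sym_diff B C)"
    by (intro finite_measure_mono) auto
  also have "\<dots> \<le> measure M (sym_diff A B) + measure M (sym_diff B C)"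
    by (intro measure_Un_le) auto
  finally show ?thesis .
qed

lemma (in finite_measure) approximable_by_algebra:
  assumes alg: "algebra (space M) \<A>" and gen: "sets M = sigma_sets (space M) \<A>"
    and A: "A \<in> sets M" and "e > 0"
  shows "\<exists>C\<in>\<A>. measure M (sym_diff A C) < e"
proof -
  interpret algebra "space M" \<A> by fact
  have sub: "C \<in> sets M" if "C \<in> \<A>" for C using that gen by auto
  have "A \<in> sigma_sets (space M) \<A>" using A gen by simp
  then have "\<forall>e>0. \<exists>C\<in>\<A>. measure M (sym_diff A C) < e"
  proof induction
    case (Basic a)
    then show ?case by (auto intro: bexI[of _ a])
  next
    case Empty
    then show ?case by (auto intro: bexI[of _ "{}"])
  next
    case (Compl a)
    show ?case
    proof (intro allI impI)
      fix e :: real assume "e > 0"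
      then obtain C where C: "C \<in> \<A>" "measure M (sym_diff a C) < e" using Compl by blast
      have "a \<in> sets M" using Compl gen by simp
      then have "a \<subseteq> space M" by (rule sets.sets_into_space)
      moreover have "C \<subseteq> space M" using C space_closed by auto
      ultimately have "sym_diff (space M - a) (space M - C) = sym_diff a C" by auto
      then show "\<exists>C\<in>\<A>. measure M (sym_diff (space M - a) C) < e"
        using C by (intro bexI[of _ "space M - C"]) auto
    qed
  next
    case (Union a)
    show ?case
    proof (intro allI impI)
      fix e :: real assume e: "e > 0"
      have [measurable]: "a i \<in> sets M" for i using Union gen by auto
      have "(\<lambda>n. measure M (\<Union>i\<le>n. a i)) \<longlonglongrightarrow> measure M (\<Union>n. \<Union>i\<le>n. a i)"
        by (intro finite_Lim_measure_incseq) (force simp: incseq_def)+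
      also have "(\<Union>n. \<Union>i\<le>n. a i) = (\<Union>i. a i)" by auto
      finally have "\<forall>\<^sub>F n in sequentially. measure M (\<Union>i. a i) - e/2 < measure M (\<Union>i\<le>n. a i)"
        by (rule order_tendstoD) (use e in simp)
      then obtain n where n: "measure M (\<Union>i. a i) - e/2 < measure M (\<Union>i\<le>n. a i)"
        by (auto simp: eventually_sequentially)
      define d where "d = e / (2 * (real n + 1))"
      have d: "d > 0" using e by (simp add: d_def)
      then have "\<forall>i. \<exists>C\<in>\<A>. measure M (sym_diff (a i) C) < d" using Union by blast
      then obtain C where C: "\<And>i. C i \<in> \<A>" "\<And>i. measure M (sym_diff (a i) (C i)) < d" by metis
      note [measurable] = sub[OF C(1)]
      have "sym_diff (\<Union>i. a i) (\<Union>i\<le>n. C i) \<subseteq>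
          ((\<Union>i. a i) - (\<Union>i\<le>n. a i)) \<union> (\<Union>i\<le>n. sym_diff (a i) (C i))" by auto
      then have "measure M (sym_diff (\<Union>i. a i) (\<Union>i\<le>n. C i)) \<le>
          measure M (((\<Union>i. a i) - (\<Union>i\<le>n. a i)) \<union> (\<Union>i\<le>n. sym_diff (a i) (C i)))"
        by (intro finite_measure_mono) auto
      also have "\<dots> \<le> measure M ((\<Union>i. a i) - (\<Union>i\<le>n. a i)) + measure M (\<Union>i\<le>n. sym_diff (a i) (C i))"
        by (intro measure_Un_le) auto
      also have "measure M ((\<Union>i. a i) - (\<Union>i\<le>n. a i)) < e/2"
        using n by (subst finite_measure_Diff) auto
      also have "measure M (\<Union>i\<le>n. sym_diff (a i) (C i)) \<le> (\<Sum>i\<le>n. measure M (sym_diff (a i) (C i)))"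
        by (intro finite_measure_subadditive_finite) auto
      also have "\<dots> \<le> (\<Sum>i\<le>n. d)" by (intro sum_mono less_imp_le C)
      also have "\<dots> = e/2" using e by (simp add: d_def field_simps)
      finally have "measure M (sym_diff (\<Union>i. a i) (\<Union>i\<le>n. C i)) < e" by simp
      then show "\<exists>C\<in>\<A>. measure M (sym_diff (\<Union>i. a i) C) < e"
        using C by (intro bexI[of _ "\<Union>i\<le>n. C i"] finite_UN) auto
    qed
  qed
  then show ?thesis using \<open>e > 0\<close> by blast
qed

text \<open>With errors that are summable, Borel--Cantelli turns approximation into equality: almost every point
is treated correctly by all late approximants, hence by their lower limit.\<close>

lemma (in finite_measure) measurable_modulo_null_if_approximable:
  assumes A: "A \<in> sets M" and f [measurable]: "f \<in> M \<rightarrow>\<^sub>M N"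
    and approx: "\<And>e. e > 0 \<Longrightarrow> \<exists>C\<in>sets N. measure M (sym_diff A (f -` C \<inter> space M)) < e"
  shows "\<exists>C\<in>sets N. AE x in M. x \<in> A \<longleftrightarrow> f x \<in> C"
proof -
  have "\<forall>n. \<exists>C\<in>sets N. measure M (sym_diff A (f -` C \<inter> space M)) < (1/2)^n"
    by (intro allI approx) simp
  then obtain C where [measurable]: "\<And>n. C n \<in> sets N"
    and C: "\<And>n. measure M (sym_diff A (f -` C n \<inter> space M)) < (1/2)^n" by metis
  note [measurable] = A
  have "AE x in M. \<forall>\<^sub>F n in sequentially. x \<in> space M - sym_diff A (f -` C n \<inter> space M)"
  proof (rule borel_cantelli_AE1)
    show "summable (\<lambda>n. measure M (sym_diff A (f -` C n \<inter> space M)))"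
      by (rule summable_comparison_test'[of "\<lambda>n. (1/2)^n :: real" 0])
        (auto intro: less_imp_le[OF C])
  qed (auto simp: less_top[symmetric])
  then have "AE x in M. x \<in> A \<longleftrightarrow> f x \<in> liminf C"
  proof (rule AE_mp, intro AE_I2 impI)
    fix x assume x: "x \<in> space M"
      and ev: "\<forall>\<^sub>F n in sequentially. x \<in> space M - sym_diff A (f -` C n \<inter> space M)"
    have ev': "\<forall>\<^sub>F n in sequentially. x \<in> A \<longleftrightarrow> f x \<in> C n"
      using ev by eventually_elim (use x in auto)
    then obtain n0 where n0: "\<And>n. n \<ge> n0 \<Longrightarrow> x \<in> A \<longleftrightarrow> f x \<in> C n"
      by (auto simp: eventually_sequentially)
    have "f x \<in> liminf C \<longleftrightarrow> (\<exists>n. \<forall>m\<ge>n. f x \<in> C m)"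
      by (auto simp: liminf_SUP_INF)
    also have "\<dots> \<longleftrightarrow> x \<in> A"
    proof
      assume "\<exists>n. \<forall>m\<ge>n. f x \<in> C m"
      then obtain n where "\<And>m. m \<ge> n \<Longrightarrow> f x \<in> C m" by blast
      then show "x \<in> A" using n0[of "max n n0"] by simp
    next
      assume "x \<in> A"
      then show "\<exists>n. \<forall>m\<ge>n. f x \<in> C m" using n0 by blast
    qed
    finally show "x \<in> A \<longleftrightarrow> f x \<in> liminf C" by simp
  qed
  moreover have "liminf C \<in> sets N" by measurable
  ultimately show ?thesis by blast
qed

lemma inner_regular_approx:
  fixes \<rho> :: "'w::{second_countable_topology, complete_space} measure"
  assumes sb: "sets \<rho> = sets borel" and fin: "finite_measure \<rho>" and A: "A \<in> sets borel" and e: "e > 0"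
  shows "\<exists>K. compact K \<and> K \<subseteq> A \<and> measure \<rho> (A - K) < e"
proof -
  interpret finite_measure \<rho> by fact
  have A': "A \<in> sets \<rho>" using A sb by simp
  have eq: "emeasure \<rho> A = (SUP K \<in> {K. K \<subseteq> A \<and> compact K}. emeasure \<rho> K)"
    using A fin by (intro inner_regular[OF sb]) (auto simp: finite_measure.finite_emeasure_space)
  show ?thesis
  proof (cases "emeasure \<rho> A = 0")
    case True
    then show ?thesis using e by (intro exI[of _ "{}"]) (auto simp: measure_def)
  next
    case False
    have "measure \<rho> A > 0" using False by (simp add: emeasure_eq_measure zero_less_measure_iff)
    then have "ennreal (measure \<rho> A - e) < ennreal (measure \<rho> A)"
      using e by (intro ennreal_lessI) auto
    then have "emeasure \<rho> A - ennreal e < emeasure \<rho> A"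
      using e by (simp add: emeasure_eq_measure ennreal_minus)
    then obtain K where K: "K \<subseteq> A" "compact K" "emeasure \<rho> A - ennreal e < emeasure \<rho> K"
      unfolding eq less_SUP_iff by blast
    have [measurable]: "K \<in> sets \<rho>" using sb K(2) by (simp add: compact_imp_closed)
    have "measure \<rho> A - e < measure \<rho> K"
    proof -
      have "ennreal (measure \<rho> A - e) < ennreal (measure \<rho> K)"
        using K(3) e by (simp add: emeasure_eq_measure ennreal_minus)
      then show ?thesis by (metis ennreal_leI leD not_le)
    qed
    then show ?thesis using K A' by (intro exI[of _ K]) (auto simp: finite_measure_Diff)
  qed
qed

text \<open>A measure-theoretic substitute for the Lusin--Souslin theorem. Up to measure \<open>e\<close>, the sets
\<open>S \<inter> A\<close> and \<open>S - A\<close> may be replaced by compact sets. Their images are compact, hence Borel, and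
they are disjoint by injectivity; so the image of the first one separates the two.\<close>

lemma injective_continuous_image_separates_sets:
  fixes \<rho> :: "'w::{second_countable_topology, complete_space} measure" and p :: "'w \<Rightarrow> 'v::t2_space"
  assumes sb: "sets \<rho> = sets borel" and fin: "finite_measure \<rho>"
    and p: "continuous_on UNIV p"
    and S: "S \<in> sets borel" "AE z in \<rho>. z \<in> S" "inj_on p S"
    and A: "A \<in> sets borel" and e: "e > 0"
  shows "\<exists>E\<in>sets borel. measure \<rho> (sym_diff A (p -` E)) < e"
proof -
  interpret finite_measure \<rho> by fact
  have sp: "space \<rho> = UNIV" using sets_eq_imp_space_eq[OF sb] by simp
  obtain K1 where K1: "compact K1" "K1 \<subseteq> S \<inter> A" "measure \<rho> ((S \<inter> A) - K1) < e/2"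
    using inner_regular_approx[OF sb fin, of "S \<inter> A" "e/2"] S A e by auto
  obtain K2 where K2: "compact K2" "K2 \<subseteq> S - A" "measure \<rho> ((S - A) - K2) < e/2"
    using inner_regular_approx[OF sb fin, of "S - A" "e/2"] S A e by auto
  have [measurable]: "K1 \<in> sets \<rho>" "K2 \<in> sets \<rho>" "S \<in> sets \<rho>" "A \<in> sets \<rho>"
    using sb K1 K2 S A by (auto simp: compact_imp_closed)
  define E where "E = p ` K1"
  have E: "E \<in> sets borel"
    unfolding E_def using K1(1) p
    by (intro borel_closed compact_imp_closed compact_continuous_image) (auto intro: continuous_on_subset)
  have pE: "p -` E \<in> sets \<rho>"
    using measurable_sets[OF borel_measurable_continuous_onI[OF p] E] sb by simp
  have nS: "- S \<in> sets \<rho>" using sb S(1) by simp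
  have null: "measure \<rho> (- S) = 0"
  proof -
    have "measure \<rho> (- S) = measure \<rho> {}"
      by (rule measure_eq_AE) (use S(2) sb S(1) in \<open>auto\<close>)
    then show ?thesis by simp
  qed
  have "sym_diff A (p -` E) \<subseteq> - S \<union> ((S \<inter> A) - K1) \<union> ((S - A) - K2)"
  proof
    fix z assume z: "z \<in> sym_diff A (p -` E)"
    show "z \<in> - S \<union> ((S \<inter> A) - K1) \<union> ((S - A) - K2)"
    proof (rule ccontr)
      assume "z \<notin> - S \<union> ((S \<inter> A) - K1) \<union> ((S - A) - K2)"
      then have "z \<in> S" and zz: "z \<in> K1 \<and> z \<in> A \<or> z \<in> K2 \<and> z \<notin> A" by auto
      from zz show False
      proof
        assume "z \<in> K1 \<and> z \<in> A"
        then show False using z by (auto simp: E_def)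
      next
        assume z2: "z \<in> K2 \<and> z \<notin> A"
        then obtain z' where "z' \<in> K1" "p z' = p z" using z by (auto simp: E_def)
        then show False using inj_onD[OF S(3), of z' z] \<open>z \<in> S\<close> K1(2) z2 by auto
      qed
    qed
  qed
  then have "measure \<rho> (sym_diff A (p -` E)) \<le> measure \<rho> (- S \<union> ((S \<inter> A) - K1) \<union> ((S - A) - K2))"
    using nS by (intro finite_measure_mono) auto
  also have "\<dots> \<le> measure \<rho> (- S \<union> ((S \<inter> A) - K1)) + measure \<rho> ((S - A) - K2)"
    using nS by (intro measure_Un_le) auto
  also have "measure \<rho> (- S \<union> ((S \<inter> A) - K1)) \<le> measure \<rho> (- S) + measure \<rho> ((S \<inter> A) - K1)"
    using nS by (intro measure_Un_le) auto
  finally have "measure \<rho> (sym_diff A (p -` E)) < e" using null K1 K2 by simp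
  then show ?thesis using E by blast
qed

section \<open>The Borel structure of an odometer\<close>

definition odometer_borel :: "(nat \<Rightarrow> (int ^ 'd) set) \<Rightarrow> (nat \<Rightarrow> (int ^ 'd) set) measure" where
  "odometer_borel G =
     restrict_space (\<Pi>\<^sub>M j\<in>UNIV. count_space (rcosets\<^bsub>Zd\<^esub> (G j))) (odometer_space G)"

lemma odometer_spaceD:
  assumes "y \<in> odometer_space G"
  shows "y j \<in> rcosets\<^bsub>Zd\<^esub> (G j)" "quotient_map (G j) (y (Suc j)) = y j"
  using assms by (auto simp: odometer_space_def)

lemma odometer_data_subgroup:
  assumes "odometer_data G" shows "subgroup (G j) Zd" "finite (rcosets\<^bsub>Zd\<^esub> (G j))"
  using assms by (auto simp: odometer_data_def finite_index_subgroup_def)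

lemma space_odometer_borel [simp]: "space (odometer_borel G) = odometer_space G"
  by (auto simp: odometer_borel_def space_restrict_space space_PiM odometer_space_def PiE_def Pi_def)

lemma measurable_odometer_coordinate:
  "(\<lambda>y. y j) \<in> odometer_borel G \<rightarrow>\<^sub>M count_space (rcosets\<^bsub>Zd\<^esub> (G j))"
  unfolding odometer_borel_def by (intro measurable_restrict_space1 measurable_component_singleton) simp

lemma measurable_into_odometer:
  assumes "\<And>x. x \<in> space N \<Longrightarrow> f x \<in> odometer_space G"
    and "\<And>j. (\<lambda>x. f x j) \<in> N \<rightarrow>\<^sub>M count_space (rcosets\<^bsub>Zd\<^esub> (G j))"
  shows "f \<in> N \<rightarrow>\<^sub>M odometer_borel G"
  unfolding odometer_borel_def
proof (rule measurable_restrict_space2)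
  show "f \<in> N \<rightarrow>\<^sub>M (\<Pi>\<^sub>M j\<in>UNIV. count_space (rcosets\<^bsub>Zd\<^esub> (G j)))"
    using measurable_PiM_single'[of UNIV "\<lambda>j x. f x j" N "\<lambda>j. count_space (rcosets\<^bsub>Zd\<^esub> (G j))"]
      assms by (auto simp: odometer_space_def PiE_def Pi_def)
qed (use assms(1) in auto)

text \<open>Needed to recognise, by a Borel condition, the real sequences that encode points of the odometer.\<close>

lemma odometer_space_in_sets:
  assumes G: "odometer_data G"
  shows "odometer_space G \<in> sets (\<Pi>\<^sub>M j\<in>UNIV. count_space (rcosets\<^bsub>Zd\<^esub> (G j)))" (is "_ \<in> sets ?P")
proof -
  have [measurable]: "(\<lambda>y. y j) \<in> ?P \<rightarrow>\<^sub>M count_space (rcosets\<^bsub>Zd\<^esub> (G j))" for j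
    by (rule measurable_component_singleton) simp
  have "{y \<in> space ?P. quotient_map (G j) (y (Suc j)) = y j} \<in> sets ?P" for j
  proof -
    let ?A = "\<lambda>c. {y \<in> space ?P. y (Suc j) = c} \<inter> {y \<in> space ?P. y j = quotient_map (G j) c}"
    have "{y \<in> space ?P. y j = c} \<in> sets ?P" for j c
    proof (cases "c \<in> rcosets\<^bsub>Zd\<^esub> (G j)")
      case True
      then show ?thesis by measurable
    next
      case False
      then have "{y \<in> space ?P. y j = c} = {}" by (auto simp: space_PiM PiE_def Pi_def)
      then show ?thesis by (simp only: sets.empty_sets)
    qed
    then have "(\<Union>c\<in>rcosets\<^bsub>Zd\<^esub> (G (Suc j)). ?A c) \<in> sets ?P"
      using odometer_data_subgroup(2)[OF G] by (intro sets.finite_UN sets.Int) auto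
    also have "(\<Union>c\<in>rcosets\<^bsub>Zd\<^esub> (G (Suc j)). ?A c) =
        {y \<in> space ?P. quotient_map (G j) (y (Suc j)) = y j}"
      by (auto simp: space_PiM PiE_def Pi_def)
    finally show ?thesis .
  qed
  then have "{y \<in> space ?P. \<forall>j. quotient_map (G j) (y (Suc j)) = y j} \<in> sets ?P"
    by (intro sets.sets_Collect_countable_All) auto
  also have "{y \<in> space ?P. \<forall>j. quotient_map (G j) (y (Suc j)) = y j} = odometer_space G"
    by (auto simp: space_PiM PiE_def Pi_def odometer_space_def)
  finally show ?thesis .
qed

lemma odometer_mem_antimono:
  assumes G: "odometer_data G" and y: "y \<in> odometer_space G" and "j \<le> k" "v \<in> y k"
  shows "v \<in> y j"
  using assms(3,4)
proof (induction k rule: dec_induct)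
  case (step n)
  have "y (Suc n) = G (Suc n) #>\<^bsub>Zd\<^esub> v"
    using Zd_coset_rep[OF odometer_data_subgroup(1)[OF G] odometer_spaceD(1)[OF y] step.prems] .
  then have "y n = G n #>\<^bsub>Zd\<^esub> v"
    using odometer_spaceD(2)[OF y, of n] G
    by (subst (asm) (2) eq_commute)
      (auto simp: quotient_map_coset odometer_data_subgroup odometer_data_def decseq_Suc_iff)
  then show ?case
    using step.IH odometer_data_subgroup(1)[OF G, of n] by (auto simp: mem_Zd_coset_iff Zd_subgroup_iff)
qed simp

lemma odometer_coordinate_rep:
  assumes G: "odometer_data G" and y: "y \<in> odometer_space G" and "j \<le> k" "v \<in> y k"
  shows "y j = G j #>\<^bsub>Zd\<^esub> v"
  using Zd_coset_rep[OF odometer_data_subgroup(1)[OF G] odometer_spaceD(1)[OF y]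
      odometer_mem_antimono[OF assms]] .

lemma odometer_coordinate_nonempty:
  assumes G: "odometer_data G" and y: "y \<in> odometer_space G"
  shows "\<exists>v. v \<in> y j"
  using Zd_rcosets_nonempty[OF odometer_data_subgroup(1)[OF G] odometer_spaceD(1)[OF y]] by blast

definition odometer_cylinders :: "(nat \<Rightarrow> (int ^ 'd) set) \<Rightarrow> (nat \<Rightarrow> (int ^ 'd) set) set set" where
  "odometer_cylinders G = {{y \<in> odometer_space G. y j \<in> D} |j D. True}"

lemma odometer_cylinder_in_sets: "{y \<in> odometer_space G. y j \<in> D} \<in> sets (odometer_borel G)"
proof -
  have "(\<lambda>y. y j) -` (D \<inter> rcosets\<^bsub>Zd\<^esub> (G j)) \<inter> space (odometer_borel G) \<in> sets (odometer_borel G)"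
    by (rule measurable_sets[OF measurable_odometer_coordinate]) auto
  also have "(\<lambda>y. y j) -` (D \<inter> rcosets\<^bsub>Zd\<^esub> (G j)) \<inter> space (odometer_borel G) =
      {y \<in> odometer_space G. y j \<in> D}"
    by (auto dest: odometer_spaceD)
  finally show ?thesis .
qed

lemma odometer_cylinder_refine:
  assumes G: "odometer_data G" and "j \<le> k"
  shows "{y \<in> odometer_space G. y j \<in> D} =
    {y \<in> odometer_space G. y k \<in> {c. G j #>\<^bsub>Zd\<^esub> (SOME v. v \<in> c) \<in> D}}"
proof -
  have "y j = G j #>\<^bsub>Zd\<^esub> (SOME v. v \<in> y k)" if "y \<in> odometer_space G" for y
    using odometer_coordinate_rep[OF G that \<open>j \<le> k\<close>]
      someI_ex[OF odometer_coordinate_nonempty[OF G that]] by blast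
  then show ?thesis by auto
qed

lemma algebra_odometer_cylinders:
  assumes G: "odometer_data G"
  shows "algebra (odometer_space G) (odometer_cylinders G)"
  unfolding algebra_iff_Un
proof (intro conjI ballI)
  show "odometer_cylinders G \<subseteq> Pow (odometer_space G)" by (auto simp: odometer_cylinders_def)
  show "{} \<in> odometer_cylinders G"
    by (auto simp: odometer_cylinders_def intro!: exI[of _ 0] exI[of _ "{}"])
next
  fix a assume "a \<in> odometer_cylinders G"
  then obtain j D where "a = {y \<in> odometer_space G. y j \<in> D}" by (auto simp: odometer_cylinders_def)
  then have "odometer_space G - a = {y \<in> odometer_space G. y j \<in> - D}" by auto
  then show "odometer_space G - a \<in> odometer_cylinders G" unfolding odometer_cylinders_def by blast
next
  fix a b assume "a \<in> odometer_cylinders G" "b \<in> odometer_cylinders G"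
  then obtain j D k E where ab: "a = {y \<in> odometer_space G. y j \<in> D}" "b = {y \<in> odometer_space G. y k \<in> E}"
    by (auto simp: odometer_cylinders_def)
  obtain D' E' where "a = {y \<in> odometer_space G. y (max j k) \<in> D'}" "b = {y \<in> odometer_space G. y (max j k) \<in> E'}"
    using that[OF odometer_cylinder_refine[OF G, of j "max j k" D, folded ab]
        odometer_cylinder_refine[OF G, of k "max j k" E, folded ab]] by simp
  then have "a \<union> b = {y \<in> odometer_space G. y (max j k) \<in> D' \<union> E'}" by auto
  then show "a \<union> b \<in> odometer_cylinders G" by (auto simp only: odometer_cylinders_def)
qed

lemma sets_odometer_borel:
  "sets (odometer_borel G) = sigma_sets (odometer_space G) (odometer_cylinders G)"
proof
  define N where "N = sigma (odometer_space G) (odometer_cylinders G)"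
  have cyl: "odometer_cylinders G \<subseteq> Pow (odometer_space G)" by (auto simp: odometer_cylinders_def)
  have sp: "space N = odometer_space G" by (simp add: N_def space_measure_of[OF cyl])
  have sN: "sets N = sigma_sets (odometer_space G) (odometer_cylinders G)"
    by (simp add: N_def sets_measure_of[OF cyl])
  have "(\<lambda>y. y) \<in> N \<rightarrow>\<^sub>M odometer_borel G"
  proof (rule measurable_into_odometer)
    fix j show "(\<lambda>y. y j) \<in> N \<rightarrow>\<^sub>M count_space (rcosets\<^bsub>Zd\<^esub> (G j))"
    proof (rule measurableI)
      fix D
      have "(\<lambda>y. y j) -` D \<inter> space N = {y \<in> odometer_space G. y j \<in> D}" by (auto simp: sp)
      then show "(\<lambda>y. y j) -` D \<inter> space N \<in> sets N"
        unfolding sN by (intro sigma_sets.Basic) (auto simp: odometer_cylinders_def)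
    qed (auto simp: sp dest: odometer_spaceD)
  qed (simp add: sp)
  then show "sets (odometer_borel G) \<subseteq> sigma_sets (odometer_space G) (odometer_cylinders G)"
    using measurable_sets[of "\<lambda>y. y" N "odometer_borel G"] sN sp sets.sets_into_space[of _ "odometer_borel G"]
    by (force simp: vimage_def Int_absorb2)
  have "sigma_sets (space (odometer_borel G)) (odometer_cylinders G) \<subseteq> sets (odometer_borel G)"
    by (rule sets.sigma_sets_subset) (use odometer_cylinder_in_sets[of G] in \<open>force simp: odometer_cylinders_def\<close>)
  then show "sigma_sets (odometer_space G) (odometer_cylinders G) \<subseteq> sets (odometer_borel G)" by simp
qed

text \<open>An encoding of odometer points by real sequences, a Polish space, so that regularity of Borel measures
is available. A coset is represented by the number of a chosen element in an enumeration of
the integer vectors; decoding returns the coset of that vector.\<close>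

definition odometer_encode :: "(nat \<Rightarrow> (int ^ 'd) set) \<Rightarrow> nat \<Rightarrow> real" where
  "odometer_encode y = (\<lambda>j. real (to_nat (SOME v. v \<in> y j)))"

definition odometer_decode :: "(nat \<Rightarrow> (int ^ 'd) set) \<Rightarrow> (nat \<Rightarrow> real) \<Rightarrow> nat \<Rightarrow> (int ^ 'd) set" where
  "odometer_decode G w = (\<lambda>j. G j #>\<^bsub>Zd\<^esub> from_nat (nat \<lfloor>w j\<rfloor>))"

lemma odometer_decode_encode:
  assumes G: "odometer_data G" and y: "y \<in> odometer_space G"
  shows "odometer_decode G (odometer_encode y) = y"
proof
  fix j
  show "odometer_decode G (odometer_encode y) j = y j"
    using odometer_coordinate_rep[OF G y order_refl, of "SOME v. v \<in> y j" j]
      someI_ex[OF odometer_coordinate_nonempty[OF G y]]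
    by (simp add: odometer_decode_def odometer_encode_def)
qed

lemma measurable_odometer_encode: "odometer_encode \<in> borel_measurable (odometer_borel G)"
proof (rule measurable_coordinatewise_then_product)
  fix j
  show "(\<lambda>y. odometer_encode y j) \<in> borel_measurable (odometer_borel G)"
    unfolding odometer_encode_def
    by (rule measurable_compose[OF measurable_odometer_coordinate]) simp
qed

lemma measurable_odometer_decode:
  "odometer_decode G \<in> borel \<rightarrow>\<^sub>M (\<Pi>\<^sub>M j\<in>UNIV. count_space (rcosets\<^bsub>Zd\<^esub> (G j)))"
  unfolding odometer_decode_def
proof (rule measurable_PiM_single')
  fix j
  have "(\<lambda>w::nat \<Rightarrow> real. \<lfloor>w j\<rfloor>) \<in> borel \<rightarrow>\<^sub>M count_space UNIV" by measurable
  from measurable_compose[OF this, of "\<lambda>n. G j #>\<^bsub>Zd\<^esub> from_nat (nat n)" "count_space (rcosets\<^bsub>Zd\<^esub> (G j))"]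
  show "(\<lambda>w::nat \<Rightarrow> real. G j #>\<^bsub>Zd\<^esub> from_nat (nat \<lfloor>w j\<rfloor>)) \<in> borel \<rightarrow>\<^sub>M count_space (rcosets\<^bsub>Zd\<^esub> (G j))"
    by (simp add: Zd_coset_in_rcosets)
qed (auto intro: Zd_coset_in_rcosets)

section \<open>Haar measure on an odometer\<close>

lemma odometer_haar_props:
  assumes "odometer_haar G \<nu>"
  shows "sets \<nu> = sets (odometer_borel G)" "space \<nu> = odometer_space G" "finite_measure \<nu>"
    "measure \<nu> (space \<nu>) = 1"
proof -
  show s: "sets \<nu> = sets (odometer_borel G)" using assms by (simp add: odometer_haar_def odometer_borel_def)
  show "space \<nu> = odometer_space G" using sets_eq_imp_space_eq[OF s] by simp
  show "finite_measure \<nu>" by (rule finite_measureI) (use assms in \<open>simp add: odometer_haar_def\<close>)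
  show "measure \<nu> (space \<nu>) = 1" using assms by (simp add: odometer_haar_def measure_def)
qed

lemma odometer_cylinder_approximation:
  assumes G: "odometer_data G" and \<nu>: "sets \<nu> = sets (odometer_borel G)" "finite_measure \<nu>"
    and A: "A \<in> sets \<nu>" and e: "e > 0"
  shows "\<exists>j D. measure \<nu> (sym_diff A {y \<in> odometer_space G. y j \<in> D}) < e"
proof -
  interpret finite_measure \<nu> by fact
  have sp: "space \<nu> = odometer_space G" using sets_eq_imp_space_eq[OF \<nu>(1)] by simp
  have "\<exists>C\<in>odometer_cylinders G. measure \<nu> (sym_diff A C) < e"
    by (rule approximable_by_algebra) (use A e \<nu>(1) algebra_odometer_cylinders[OF G] sets_odometer_borel in \<open>auto simp: sp\<close>)
  then show ?thesis by (auto simp: odometer_cylinders_def)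
qed

lemma odometer_shift_in_space:
  assumes G: "odometer_data G" and y: "y \<in> odometer_space G"
  shows "odometer_shift v y \<in> odometer_space G"
proof -
  have "quotient_map (G j) (y (Suc j) #>\<^bsub>Zd\<^esub> v) = y j #>\<^bsub>Zd\<^esub> v" for j
  proof -
    obtain w where w: "w \<in> y (Suc j)" using odometer_coordinate_nonempty[OF G y] by blast
    have "y (Suc j) = G (Suc j) #>\<^bsub>Zd\<^esub> w" "y j = G j #>\<^bsub>Zd\<^esub> w"
      using odometer_coordinate_rep[OF G y _ w] by auto
    then show ?thesis using G
      by (auto simp: Zd_coset_coset quotient_map_coset odometer_data_subgroup odometer_data_def decseq_Suc_iff)
  qed
  then show ?thesis
    using odometer_spaceD(1)[OF y] by (auto simp: odometer_space_def odometer_shift_def intro: Zd_coset_shift_in_rcosets)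
qed

lemma measurable_odometer_shift:
  assumes G: "odometer_data G"
  shows "odometer_shift v \<in> odometer_borel G \<rightarrow>\<^sub>M odometer_borel G"
proof (rule measurable_into_odometer)
  fix j
  show "(\<lambda>x. odometer_shift v x j) \<in> odometer_borel G \<rightarrow>\<^sub>M count_space (rcosets\<^bsub>Zd\<^esub> (G j))"
    unfolding odometer_shift_def
    by (rule measurable_compose[OF measurable_odometer_coordinate]) (auto intro: Zd_coset_shift_in_rcosets)
qed (use odometer_shift_in_space[OF G] in auto)

lemma odometer_base_point:
  assumes G: "odometer_data G"
  shows "(\<lambda>j. G j #>\<^bsub>Zd\<^esub> v) \<in> odometer_space G"
  using G by (auto simp: odometer_space_def Zd_coset_in_rcosets quotient_map_coset odometer_data_subgroup
      odometer_data_def decseq_Suc_iff)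

lemma odometer_shift_eq_add:
  assumes G: "odometer_data G" and y: "y \<in> odometer_space G"
  shows "odometer_shift v y = odometer_add (\<lambda>j. G j #>\<^bsub>Zd\<^esub> v) y"
proof
  fix j
  obtain w where w: "w \<in> y j" using odometer_coordinate_nonempty[OF G y] by blast
  have "y j = G j #>\<^bsub>Zd\<^esub> w" using odometer_coordinate_rep[OF G y order_refl w] .
  then show "odometer_shift v y j = odometer_add (\<lambda>j. G j #>\<^bsub>Zd\<^esub> v) y j"
    by (simp add: odometer_shift_def odometer_add_def Zd_coset_coset Zd_coset_add[OF odometer_data_subgroup(1)[OF G]] add.commute)
qed

lemma odometer_shift_shift: "odometer_shift v (odometer_shift w y) = odometer_shift (w + v) y"
  by (simp add: odometer_shift_def Zd_coset_coset)

lemma odometer_shift_0: "odometer_shift 0 y = y"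
  by (simp add: odometer_shift_def Zd_coset_0)

lemma odometer_haar_shift_invariant:
  assumes G: "odometer_data G" and \<nu>: "odometer_haar G \<nu>"
  shows "odometer_shift v \<in> \<nu> \<rightarrow>\<^sub>M \<nu>" "distr \<nu> \<nu> (odometer_shift v) = \<nu>"
proof -
  note P = odometer_haar_props[OF \<nu>]
  show m: "odometer_shift v \<in> \<nu> \<rightarrow>\<^sub>M \<nu>"
    using measurable_odometer_shift[OF G] measurable_cong_sets[OF P(1) P(1)] by blast
  show "distr \<nu> \<nu> (odometer_shift v) = \<nu>"
  proof (rule measure_eqI)
    fix A assume "A \<in> sets (distr \<nu> \<nu> (odometer_shift v))"
    then have A: "A \<in> sets \<nu>" by simp
    have Asub: "A \<subseteq> odometer_space G" using sets.sets_into_space[OF A] P by simp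
    let ?g = "\<lambda>j. G j #>\<^bsub>Zd\<^esub> (- v)"
    have "odometer_shift v -` A \<inter> space \<nu> = odometer_shift (- v) ` A" (is "?L = ?R")
    proof (intro equalityI subsetI)
      fix y assume "y \<in> ?L"
      then show "y \<in> ?R"
        by (intro image_eqI[of _ _ "odometer_shift v y"]) (auto simp: odometer_shift_shift odometer_shift_0)
    next
      fix y assume "y \<in> ?R"
      then show "y \<in> ?L"
        using Asub by (auto simp: odometer_shift_shift odometer_shift_0 P odometer_shift_in_space[OF G])
    qed
    also have "\<dots> = odometer_add ?g ` A"
      using Asub odometer_shift_eq_add[OF G] by (intro image_cong) auto
    finally show "emeasure (distr \<nu> \<nu> (odometer_shift v)) A = emeasure \<nu> A"
      using A m \<nu> odometer_base_point[OF G] by (auto simp: emeasure_distr odometer_haar_def)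
  qed simp
qed

lemma odometer_add_mem_space:
  assumes G: "odometer_data G" and g: "g \<in> odometer_space G" and y: "y \<in> odometer_space G"
  shows "odometer_add g y \<in> odometer_space G"
proof -
  have "quotient_map (G j) (g (Suc j) <#>\<^bsub>Zd\<^esub> y (Suc j)) = g j <#>\<^bsub>Zd\<^esub> y j
      \<and> g j <#>\<^bsub>Zd\<^esub> y j \<in> rcosets\<^bsub>Zd\<^esub> (G j)" for j
  proof -
    obtain v w where w: "w \<in> y (Suc j)" "v \<in> g (Suc j)"
      using odometer_coordinate_nonempty[OF G y] odometer_coordinate_nonempty[OF G g] by blast
    have "y (Suc j) = G (Suc j) #>\<^bsub>Zd\<^esub> w" "y j = G j #>\<^bsub>Zd\<^esub> w"
      "g (Suc j) = G (Suc j) #>\<^bsub>Zd\<^esub> v" "g j = G j #>\<^bsub>Zd\<^esub> v"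
      using odometer_coordinate_rep[OF G y _ w(1)] odometer_coordinate_rep[OF G g _ w(2)] by auto
    then show ?thesis using G
      by (auto simp: Zd_coset_add quotient_map_coset odometer_data_subgroup odometer_data_def decseq_Suc_iff
          Zd_coset_in_rcosets)
  qed
  then show ?thesis by (auto simp: odometer_space_def odometer_add_def)
qed

lemma odometer_add_coordinate:
  assumes G: "odometer_data G" and g: "g \<in> odometer_space G" and y: "y \<in> odometer_space G" and v: "v \<in> g j"
  shows "odometer_add g y j = y j #>\<^bsub>Zd\<^esub> v"
proof -
  obtain w where w: "w \<in> y j" using odometer_coordinate_nonempty[OF G y] by blast
  show ?thesis
    using odometer_coordinate_rep[OF G y order_refl w] odometer_coordinate_rep[OF G g order_refl v]
    by (simp add: odometer_add_def Zd_coset_add[OF odometer_data_subgroup(1)[OF G]] Zd_coset_coset add.commute)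
qed

text \<open>The integer vectors are dense in the odometer. On a cylinder set, which depends on a single coordinate,
translation by any odometer point \<open>g\<close> agrees with the shift by a vector in the corresponding coset of \<open>g\<close>.
So invariance under shifts is invariance under all translations, first on the generating
algebra of cylinder sets and then everywhere.\<close>

lemma odometer_haar_if_shift_invariant:
  assumes G: "odometer_data G"
    and s: "sets \<nu> = sets (odometer_borel G)" and one: "emeasure \<nu> (space \<nu>) = 1"
    and inv: "\<And>v. distr \<nu> \<nu> (odometer_shift v) = \<nu>"
  shows "odometer_haar G \<nu>"
  unfolding odometer_haar_def
proof (intro conjI ballI)
  show "sets \<nu> = sets (restrict_space (\<Pi>\<^sub>M j\<in>UNIV. count_space (rcosets\<^bsub>Zd\<^esub> (G j))) (odometer_space G))"
    using s by (simp add: odometer_borel_def)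
  show "emeasure \<nu> (space \<nu>) = 1" by fact
  have sp: "space \<nu> = odometer_space G" using sets_eq_imp_space_eq[OF s] by simp
  have shift_meas: "odometer_shift v \<in> \<nu> \<rightarrow>\<^sub>M \<nu>" for v
    using measurable_odometer_shift[OF G] measurable_cong_sets[OF s s] by blast
  fix g A assume g: "g \<in> odometer_space G" and A: "A \<in> sets \<nu>"
  define g' where "g' = (\<lambda>j. (\<lambda>v. - v) ` g j)"
  have g'j: "g' j = G j #>\<^bsub>Zd\<^esub> (- v)" if "v \<in> g j" for j v
  proof -
    have gj: "g j = G j #>\<^bsub>Zd\<^esub> v" using odometer_coordinate_rep[OF G g order_refl that] .
    have neg: "- u - v \<in> G j \<longleftrightarrow> u + v \<in> G j" for u
      using odometer_data_subgroup(1)[OF G, of j] unfolding Zd_subgroup_iff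
      by (metis add.inverse_inverse minus_add_distrib diff_conv_add_uminus)
    have mem: "u \<in> g' j \<longleftrightarrow> - u \<in> g j" for u
      by (metis (no_types, lifting) add.inverse_inverse g'_def image_iff)
    show ?thesis
      by (intro equalityI subsetI; simp only: mem gj mem_Zd_coset_iff neg diff_minus_eq_add)
  qed
  have g': "g' \<in> odometer_space G"
  proof -
    have "g' j \<in> rcosets\<^bsub>Zd\<^esub> (G j) \<and> quotient_map (G j) (g' (Suc j)) = g' j" for j
    proof -
      obtain v where v: "v \<in> g (Suc j)" using odometer_coordinate_nonempty[OF G g] by blast
      have "v \<in> g j" using odometer_mem_antimono[OF G g _ v, of j] by simp
      from g'j[OF v] g'j[OF this] show ?thesis using G
        by (auto simp: quotient_map_coset odometer_data_subgroup odometer_data_def decseq_Suc_iff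
          Zd_coset_in_rcosets)
    qed
    then show ?thesis by (simp add: odometer_space_def)
  qed
  have cancel: "odometer_add g' (odometer_add g y) = y" "odometer_add g (odometer_add g' y) = y"
    if y: "y \<in> odometer_space G" for y
  proof -
    have "odometer_add g' (odometer_add g y) j = y j \<and> odometer_add g (odometer_add g' y) j = y j" for j
    proof -
      obtain v where v: "v \<in> g j" using odometer_coordinate_nonempty[OF G g] by blast
      then have v': "- v \<in> g' j" by (simp add: g'_def)
      show ?thesis
        using odometer_add_coordinate[OF G g y v] odometer_add_coordinate[OF G g' y v']
          odometer_add_coordinate[OF G g' odometer_add_mem_space[OF G g y] v']
          odometer_add_coordinate[OF G g odometer_add_mem_space[OF G g' y] v]
        by (simp add: Zd_coset_coset Zd_coset_0)
    qed
    then show "odometer_add g' (odometer_add g y) = y" "odometer_add g (odometer_add g' y) = y" by auto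
  qed
  have meas: "odometer_add g' \<in> \<nu> \<rightarrow>\<^sub>M \<nu>"
  proof -
    have "odometer_add g' \<in> odometer_borel G \<rightarrow>\<^sub>M odometer_borel G"
    proof (rule measurable_into_odometer)
      fix j
      obtain v where v: "v \<in> g' j" using odometer_coordinate_nonempty[OF G g'] by blast
      have "(\<lambda>y. y j #>\<^bsub>Zd\<^esub> v) \<in> odometer_borel G \<rightarrow>\<^sub>M count_space (rcosets\<^bsub>Zd\<^esub> (G j))"
        by (rule measurable_compose[OF measurable_odometer_coordinate]) (auto intro: Zd_coset_shift_in_rcosets)
      then show "(\<lambda>y. odometer_add g' y j) \<in> odometer_borel G \<rightarrow>\<^sub>M count_space (rcosets\<^bsub>Zd\<^esub> (G j))"
        by (rule measurable_cong[THEN iffD1, rotated]) (simp add: odometer_add_coordinate[OF G g' _ v])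
    qed (simp add: odometer_add_mem_space[OF G g'])
    then show ?thesis using measurable_cong_sets[OF s s] by blast
  qed
  have "distr \<nu> \<nu> (odometer_add g') = \<nu>"
  proof (rule measure_eqI_generator_eq[where E = "odometer_cylinders G" and \<Omega> = "odometer_space G"
        and A = "\<lambda>_. odometer_space G"])
    interpret algebra "odometer_space G" "odometer_cylinders G" by (rule algebra_odometer_cylinders[OF G])
    show "Int_stable (odometer_cylinders G)" by (rule Int_stable)
    show "odometer_cylinders G \<subseteq> Pow (odometer_space G)" by (rule space_closed)
    show "range (\<lambda>_. odometer_space G) \<subseteq> odometer_cylinders G" by auto
    show "emeasure (distr \<nu> \<nu> (odometer_add g')) (odometer_space G) \<noteq> \<infinity>"
    proof -
      have "odometer_add g' -` odometer_space G \<inter> space \<nu> = space \<nu>"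
        using odometer_add_mem_space[OF G g'] by (auto simp: sp)
      then show ?thesis using sets.top[of \<nu>] one meas by (simp add: emeasure_distr sp)
    qed
    fix X assume "X \<in> odometer_cylinders G"
    then obtain j D where X: "X = {y \<in> odometer_space G. y j \<in> D}" by (auto simp: odometer_cylinders_def)
    then have Xs: "X \<in> sets \<nu>" using odometer_cylinder_in_sets s by simp
    obtain v where v: "v \<in> g' j" using odometer_coordinate_nonempty[OF G g'] by blast
    have "emeasure (distr \<nu> \<nu> (odometer_add g')) X = emeasure \<nu> (odometer_add g' -` X \<inter> space \<nu>)"
      using meas Xs by (rule emeasure_distr)
    also have "odometer_add g' -` X \<inter> space \<nu> = odometer_shift v -` X \<inter> space \<nu>"
      using odometer_add_mem_space[OF G g'] odometer_shift_in_space[OF G] odometer_add_coordinate[OF G g' _ v]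
      by (auto simp: X sp odometer_shift_def)
    also have "emeasure \<nu> \<dots> = emeasure (distr \<nu> \<nu> (odometer_shift v)) X"
      using shift_meas Xs by (simp add: emeasure_distr)
    finally show "emeasure (distr \<nu> \<nu> (odometer_add g')) X = emeasure \<nu> X" by (simp add: inv)
  qed (use s sets_odometer_borel in auto)
  then have "emeasure \<nu> A = emeasure \<nu> (odometer_add g' -` A \<inter> space \<nu>)"
    using emeasure_distr[OF meas A] by simp
  also have "odometer_add g' -` A \<inter> space \<nu> = odometer_add g ` A" (is "?L = ?R")
  proof (intro equalityI subsetI)
    fix y assume "y \<in> ?L"
    then show "y \<in> ?R"
      by (intro image_eqI[of _ _ "odometer_add g' y"]) (auto simp: cancel sp)
  next
    fix y assume "y \<in> ?R"
    then show "y \<in> ?L"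
      using sets.sets_into_space[OF A] odometer_add_mem_space[OF G g]
      by (auto simp: cancel sp subset_eq)
  qed
  finally show "emeasure \<nu> (odometer_add g ` A) = emeasure \<nu> A" by simp
qed

section \<open>Lebesgue probability spaces\<close>

text \<open>A real coordinate \<open>r\<close> with almost everywhere inverse \<open>k\<close>. Since the isomorphism with the unit interval only
respects completed sigma-algebras, \<open>r\<close> is a version of it that is measurable before
completion, while \<open>k\<close> is not claimed to be measurable. What replaces measurability of \<open>k\<close> are the last two
properties: full sets contain the \<open>k\<close>-image of a Borel set of full measure, and measurable functions
are Borel functions of \<open>r\<close> almost everywhere.\<close>

lemma lebesgue_probability_space_coordinate:
  fixes M :: "'a measure"
  assumes "lebesgue_probability_space M"
  obtains r :: "'a \<Rightarrow> real" and k :: "real \<Rightarrow> 'a"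
  where "emeasure M (space M) = 1"
    and "r \<in> borel_measurable M" and "AE x in M. k (r x) = x"
    and "\<And>X. AE x in M. x \<in> X \<Longrightarrow>
      \<exists>T\<in>sets borel. (\<forall>t\<in>T. k t \<in> X \<and> r (k t) = t) \<and> (AE x in M. r x \<in> T)"
    and "\<And>g::'a \<Rightarrow> real. g \<in> borel_measurable M \<Longrightarrow>
      \<exists>b\<in>borel_measurable borel. AE x in M. b (r x) = g x"
proof -
  obtain Z Z' h k where Z: "Z \<in> null_sets (completion M)"
    and Z': "Z' \<in> null_sets (lebesgue_on {0..1::real})"
    and h: "h \<in> restrict_space (completion M) (space M - Z) \<rightarrow>\<^sub>M
                restrict_space (lebesgue_on {0..1}) ({0..1} - Z')"
    and k: "k \<in> restrict_space (lebesgue_on {0..1}) ({0..1} - Z') \<rightarrow>\<^sub>M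
                restrict_space (completion M) (space M - Z)"
    and kh: "\<And>x. x \<in> space (restrict_space (completion M) (space M - Z)) \<Longrightarrow> k (h x) = x"
    and hk: "\<And>t. t \<in> space (restrict_space (lebesgue_on {0..1}) ({0..1} - Z')) \<Longrightarrow> h (k t) = t"
    and dist: "distr (restrict_space (completion M) (space M - Z))
           (restrict_space (lebesgue_on {0..1}) ({0..1} - Z')) h =
         restrict_space (lebesgue_on {0..1}) ({0..1} - Z')"
    using assms unfolding lebesgue_probability_space_def iso_mod_0_def Let_def by auto
  define M' where "M' = restrict_space (completion M) (space M - Z)"
  define I where "I = {0..1} - Z'"
  have Zs: "Z \<in> sets (completion M)" using Z by auto
  have Z'l: "Z' \<in> null_sets lebesgue" "Z' \<subseteq> {0..1}"
    using Z' by (auto simp: null_sets_restrict_space)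
  have Is: "I \<in> sets lebesgue" unfolding I_def using Z'l by auto
  have N': "restrict_space (lebesgue_on {0..1}) ({0..1} - Z') = lebesgue_on I"
    using Is by (subst restrict_restrict_space) (auto simp: I_def Int_absorb1 intro!: arg_cong[where f="restrict_space _"])
  note h = h[folded M'_def, unfolded N'] and k = k[folded M'_def, unfolded N']
    and dist = dist[folded M'_def, unfolded N']
  have spM': "space M' = space M - Z" using sets.sets_into_space[OF Zs] by (auto simp: M'_def space_restrict_space)
  have spI: "space (lebesgue_on I) = I" by simp
  note kh = kh[folded M'_def, unfolded spM'] and hk = hk[unfolded N' spI]
  have M's: "space M - Z \<in> sets (completion M)" using Zs by (metis sets.compl_sets space_completion)
  have AE_M': "(AE x in M'. P x) \<longleftrightarrow> (AE x in M. x \<in> space M - Z \<longrightarrow> P x)" for P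
    unfolding M'_def using M's by (subst AE_restrict_space_iff) (auto simp: AE_completion_iff)
  have AE_Z: "AE x in M. x \<notin> Z"
    using AE_not_in[OF Z] by (simp add: AE_completion_iff)
  have AE_I: "(AE t in lebesgue_on I. P t) \<longleftrightarrow> (AE t in lborel. t \<in> I \<longrightarrow> P t)" for P
    using Is by (subst AE_restrict_space_iff) (auto simp: AE_completion_iff)
  have "(\<lambda>x. if x \<in> space M - Z then h x else 0) \<in> borel_measurable (completion M)"
  proof -
    have "h \<in> borel_measurable M'"
      using measurable_compose[OF h, of "\<lambda>x. x" borel]
      by (simp add: measurable_completion measurable_restrict_space1)
    then show ?thesis
      unfolding M'_def using M's by (subst (asm) measurable_restrict_space_iff) auto
  qed
  from completion_ex_borel_measurable_real[OF this]
  obtain r where r: "r \<in> borel_measurable M"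
    and rh0: "AE x in M. (if x \<in> space M - Z then h x else 0) = r x" by blast
  have rh: "AE x in M. x \<in> space M - Z \<and> r x = h x"
    using rh0 AE_Z AE_space by eventually_elim auto
  \<comment> \<open>Almost sure statements travel along the isomorphism in both directions.\<close>
  have push: "AE x in M. P (r x)" if "AE t in lebesgue_on I. P t" for P
  proof -
    have "AE x in M'. P (h x)"
      by (rule AE_distrD[OF h, of P, unfolded dist, OF that])
    then have "AE x in M. x \<in> space M - Z \<longrightarrow> P (h x)" by (simp only: AE_M')
    then show ?thesis using rh by eventually_elim auto
  qed
  have pull: "AE t in lebesgue_on I. P (k t)" if "AE x in M. P x" for P
  proof -
    have "AE x in M'. P x" unfolding AE_M' using that by eventually_elim auto
    then obtain U where U: "U \<in> null_sets M'" "{x \<in> space M'. \<not> P x} \<subseteq> U"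
      unfolding eventually_ae_filter by blast
    have Us: "U \<in> sets M'" using U by auto
    have kU: "k -` U \<inter> space (lebesgue_on I) \<in> sets (lebesgue_on I)"
      using k Us by (rule measurable_sets)
    have "emeasure (lebesgue_on I) (k -` U \<inter> space (lebesgue_on I)) =
        emeasure M' (h -` (k -` U \<inter> space (lebesgue_on I)) \<inter> space M')"
      using emeasure_distr[OF h kU] by (simp only: dist)
    also have "h -` (k -` U \<inter> space (lebesgue_on I)) \<inter> space M' = U"
      using sets.sets_into_space[OF Us] measurable_space[OF h] kh spM' by auto
    finally have "k -` U \<inter> space (lebesgue_on I) \<in> null_sets (lebesgue_on I)"
      using U kU by (auto simp: null_sets_def)
    then show ?thesis
      by (rule AE_I') (use U(2) measurable_space[OF k] in auto)
  qed
  show thesis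
  proof (rule that[where r = r and k = k, OF _ r])
    have "emeasure M (space M) = emeasure (completion M) (space M - Z)"
    proof -
      have "space M \<in> sets (completion M)" using sets.top[of "completion M"] by simp
      from emeasure_Diff_null_set[OF Z this] show ?thesis by simp
    qed
    also have "\<dots> = emeasure M' (space M')"
    proof -
      have "(space M - Z) \<inter> space (completion M) = space M - Z" by auto
      then show ?thesis
        unfolding M'_def using M's by (subst emeasure_restrict_space) (simp_all add: space_restrict_space)
    qed
    also have "\<dots> = emeasure (lebesgue_on I) (space (lebesgue_on I))"
    proof -
      have "h -` space (lebesgue_on I) \<inter> space M' = space M'" using measurable_space[OF h] by auto
      then show ?thesis using emeasure_distr[OF h sets.top] by (simp only: dist)
    qed
    also have "\<dots> = emeasure lebesgue I"
      using Is by (subst emeasure_restrict_space) auto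
    also have "\<dots> = 1"
      unfolding I_def using Z'l by (subst emeasure_Diff_null_set) auto
    finally show "emeasure M (space M) = 1" .
  next
    show "AE x in M. k (r x) = x"
      using rh by eventually_elim (use kh in auto)
  next
    fix X assume "AE x in M. x \<in> X"
    then have "AE x in M. x \<in> X \<and> r x = h x" using rh by eventually_elim auto
    then have "AE t in lebesgue_on I. k t \<in> X \<and> r (k t) = h (k t)" by (rule pull)
    then have "AE t in lborel. t \<in> I \<longrightarrow> k t \<in> X \<and> r (k t) = t"
      unfolding AE_I by eventually_elim (use hk in auto)
    moreover have "AE t in lborel. t \<notin> Z'"
      using AE_not_in[OF Z'l(1)] by (simp add: AE_completion_iff)
    ultimately have "AE t in lborel. t \<in> {0..1} \<longrightarrow> t \<in> I \<and> k t \<in> X \<and> r (k t) = t"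
      by eventually_elim (auto simp: I_def)
    then obtain U where U: "U \<in> null_sets lborel"
      "{t. \<not> (t \<in> {0..1} \<longrightarrow> t \<in> I \<and> k t \<in> X \<and> r (k t) = t)} \<subseteq> U"
      unfolding eventually_ae_filter by auto
    have "AE t in lebesgue_on I. t \<in> {0..1} - U"
      unfolding AE_I using AE_not_in[OF U(1)] by eventually_elim (auto simp: I_def)
    then have "AE x in M. r x \<in> {0..1} - U" by (rule push)
    then show "\<exists>T\<in>sets borel. (\<forall>t\<in>T. k t \<in> X \<and> r (k t) = t) \<and> (AE x in M. r x \<in> T)"
      using U by (intro bexI[of _ "{0..1} - U"]) auto
  next
    fix g :: "'a \<Rightarrow> real" assume g: "g \<in> borel_measurable M"
    have "g \<in> borel_measurable M'"
      unfolding M'_def using g by (intro measurable_restrict_space1 measurable_completion)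
    then have "(\<lambda>t. g (k t)) \<in> borel_measurable (lebesgue_on I)"
      by (rule measurable_compose[OF k])
    then have "(\<lambda>t. if t \<in> I then g (k t) else 0) \<in> borel_measurable lebesgue"
      using Is by (subst (asm) measurable_restrict_space_iff) auto
    from completion_ex_borel_measurable_real[OF this]
    obtain b where b: "b \<in> borel_measurable lborel"
      and bg: "AE t in lborel. (if t \<in> I then g (k t) else 0) = b t" by blast
    have "AE t in lebesgue_on I. b t = g (k t)"
      unfolding AE_I using bg by eventually_elim auto
    then have "AE x in M. b (r x) = g (k (r x))" by (rule push)
    then have "AE x in M. b (r x) = g x" using rh by eventually_elim (use kh in auto)
    then show "\<exists>b\<in>borel_measurable borel. AE x in M. b (r x) = g x" using b by auto
  qed
qed

section \<open>Almost injective maps between standard spaces\<close>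

lemma measurable_extend_decoded:
  assumes G: "odometer_data G" and f: "f \<in> odometer_borel G \<rightarrow>\<^sub>M N" and c: "c \<in> space N"
  shows "(\<lambda>w. if odometer_decode G w \<in> odometer_space G then f (odometer_decode G w) else c) \<in> borel \<rightarrow>\<^sub>M N"
proof -
  have "(\<lambda>y. if y \<in> odometer_space G then f y else c)
      \<in> (\<Pi>\<^sub>M j\<in>UNIV. count_space (rcosets\<^bsub>Zd\<^esub> (G j))) \<rightarrow>\<^sub>M N"
    using f odometer_space_in_sets[OF G] c unfolding odometer_borel_def
    by (subst (asm) measurable_restrict_space_iff) auto
  from measurable_compose[OF measurable_odometer_decode this] show ?thesis .
qed

lemma decoded_vimage_borel:
  assumes G: "odometer_data G" and A: "A \<in> sets (odometer_borel G)"
  shows "{w. odometer_decode G w \<in> A} \<in> sets borel"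
proof -
  have "A \<in> sets (\<Pi>\<^sub>M j\<in>UNIV. count_space (rcosets\<^bsub>Zd\<^esub> (G j)))"
    using A odometer_space_in_sets[OF G] unfolding odometer_borel_def
    by (subst (asm) sets_restrict_space_iff) auto
  from measurable_sets[OF measurable_odometer_decode this] show ?thesis
    by (simp add: vimage_def)
qed

lemma borel_measurable_graph:
  fixes f :: "'a::second_countable_topology \<Rightarrow> 'b::{second_countable_topology, t2_space}"
  assumes [measurable]: "f \<in> borel_measurable borel" "C \<in> sets borel"
  shows "{z. fst z \<in> C \<and> snd z = f (fst z)} \<in> sets borel"
proof -
  have [measurable]: "fst \<in> borel_measurable (borel :: ('a \<times> 'b) measure)"
     "snd \<in> borel_measurable (borel :: ('a \<times> 'b) measure)"
    by (intro borel_measurable_continuous_onI continuous_on_fst continuous_on_snd continuous_on_id)+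
  have "{z \<in> space (borel :: ('a \<times> 'b) measure). snd z = f (fst z)} \<in> sets borel"
    by measurable
  moreover have "fst -` C \<inter> space (borel :: ('a \<times> 'b) measure) \<in> sets borel"
    by measurable
  moreover have "{z. fst z \<in> C \<and> snd z = f (fst z)} =
      {z \<in> space (borel :: ('a \<times> 'b) measure). snd z = f (fst z)} \<inter> (fst -` C \<inter> space borel)" by auto
  ultimately show ?thesis by simp
qed

text \<open>The joint law of the coordinate \<open>r x\<close> and of the encoding of \<open>\<phi> x\<close> lives on the graph of a Borel function
\<open>b'\<close> over a Borel set \<open>T\<close>. The second projection is injective there because \<open>\<phi>\<close> is
almost injective. So a set that is described by the first coordinate is approximately described by the second one,
which means by \<open>\<phi> x\<close>, and there cylinder sets are dense.\<close>

lemma sets_approximable_by_preimages_of_cylinders: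
  assumes M: "lebesgue_probability_space M" and G: "odometer_data G"
    and \<phi>: "\<phi> \<in> M \<rightarrow>\<^sub>M odometer_borel G" and inj: "ae_injective M \<phi>"
    and A: "A \<in> sets M" and e: "e > 0"
  shows "\<exists>j D. measure M (sym_diff A {x \<in> space M. \<phi> x j \<in> D}) < e"
proof -
  obtain r :: "'a \<Rightarrow> real" and k where one: "emeasure M (space M) = 1"
    and r [measurable]: "r \<in> borel_measurable M" and kr: "AE x in M. k (r x) = x"
    and tight: "\<And>X. AE x in M. x \<in> X \<Longrightarrow>
      \<exists>T\<in>sets borel. (\<forall>t\<in>T. k t \<in> X \<and> r (k t) = t) \<and> (AE x in M. r x \<in> T)"
    and fac: "\<And>g::'a \<Rightarrow> real. g \<in> borel_measurable M \<Longrightarrow>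
      \<exists>b\<in>borel_measurable borel. AE x in M. b (r x) = g x"
    by (rule lebesgue_probability_space_coordinate[OF M]) blast
  interpret finite_measure M by (rule finite_measureI) (simp add: one)
  have enc [measurable]: "(\<lambda>x. odometer_encode (\<phi> x)) \<in> borel_measurable M"
    by (rule measurable_compose[OF \<phi> measurable_odometer_encode])
  have "(\<lambda>x. odometer_encode (\<phi> x) j) \<in> borel_measurable M" for j
    by (rule measurable_product_then_coordinatewise[OF enc])
  then have "\<forall>j. \<exists>b\<in>borel_measurable borel. AE x in M. b (r x) = odometer_encode (\<phi> x) j"
    using fac by blast
  then obtain b where bm: "\<And>j. b j \<in> borel_measurable borel"
    and b: "\<And>j. AE x in M. b j (r x) = odometer_encode (\<phi> x) j" by metis
  define b' where "b' = (\<lambda>t j. b j t)"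
  have b'm: "b' \<in> borel_measurable borel"
    by (rule measurable_coordinatewise_then_product) (simp add: b'_def bm)
  have b': "AE x in M. b' (r x) = odometer_encode (\<phi> x)"
  proof -
    have "AE x in M. \<forall>j. b j (r x) = odometer_encode (\<phi> x) j" using b by (simp add: AE_all_countable)
    then show ?thesis by eventually_elim (auto simp: b'_def fun_eq_iff)
  qed
  obtain Z where Z: "Z \<in> null_sets M" "inj_on \<phi> (space M - Z)"
    using inj by (auto simp: ae_injective_def)
  define X where "X = {x \<in> space M - Z. k (r x) = x \<and> b' (r x) = odometer_encode (\<phi> x)}"
  have "AE x in M. x \<in> X"
    using AE_not_in[OF Z(1)] kr b' AE_space unfolding X_def by eventually_elim auto
  from tight[OF this] obtain T where T: "T \<in> sets borel"
    and Tx: "\<And>t. t \<in> T \<Longrightarrow> k t \<in> X \<and> r (k t) = t" and rT: "AE x in M. r x \<in> T" by blast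
  have "(indicator A :: 'a \<Rightarrow> real) \<in> borel_measurable M" using A by simp
  from fac[OF this] obtain a where am: "a \<in> borel_measurable borel"
    and a: "AE x in M. a (r x) = (indicator A x :: real)" by blast
  define z where "z = (\<lambda>x. (r x, odometer_encode (\<phi> x)))"
  have zm: "z \<in> borel_measurable M" unfolding z_def by measurable
  define \<rho> where "\<rho> = distr M borel z"
  define S where "S = {w :: real \<times> (nat \<Rightarrow> real). fst w \<in> T \<and> snd w = b' (fst w)}"
  have S: "S \<in> sets borel" unfolding S_def by (rule borel_measurable_graph[OF b'm T])
  have fst_m: "fst \<in> borel_measurable (borel :: (real \<times> (nat \<Rightarrow> real)) measure)"
    and snd_m: "snd \<in> borel_measurable (borel :: (real \<times> (nat \<Rightarrow> real)) measure)"
    by (intro borel_measurable_continuous_onI continuous_on_fst continuous_on_snd continuous_on_id)+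
  define A' where "A' = {w :: real \<times> (nat \<Rightarrow> real). a (fst w) = 1}"
  have A': "A' \<in> sets borel"
  proof -
    have "(\<lambda>w :: real \<times> (nat \<Rightarrow> real). a (fst w)) \<in> borel_measurable borel"
      by (rule measurable_compose[OF fst_m am])
    then have "{w \<in> space (borel :: (real \<times> (nat \<Rightarrow> real)) measure). a (fst w) = 1} \<in> sets borel"
      by measurable
    then show ?thesis by (simp add: A'_def)
  qed
  have "\<exists>E\<in>sets borel. measure \<rho> (sym_diff A' (snd -` E)) < e/2"
  proof (rule injective_continuous_image_separates_sets)
    show "finite_measure \<rho>" unfolding \<rho>_def by (rule finite_measure_distr[OF zm])
    show "AE w in \<rho>. w \<in> S"
      unfolding \<rho>_def using S
      by (subst AE_distr_iff[OF zm]) (use rT b' in \<open>auto simp: S_def z_def\<close>)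
    show "inj_on snd S"
    proof (rule inj_onI)
      fix v w assume v: "v \<in> S" and w: "w \<in> S" and "snd v = snd w"
      let ?x = "k (fst v)" and ?y = "k (fst w)"
      have xy: "?x \<in> X" "?y \<in> X" "r ?x = fst v" "r ?y = fst w"
        using Tx v w by (auto simp: S_def)
      then have "odometer_encode (\<phi> ?x) = odometer_encode (\<phi> ?y)"
        using v w \<open>snd v = snd w\<close> by (auto simp: S_def X_def)
      moreover have "\<phi> ?x \<in> odometer_space G" "\<phi> ?y \<in> odometer_space G"
        using xy measurable_space[OF \<phi>] by (auto simp: X_def)
      ultimately have "\<phi> ?x = \<phi> ?y" using odometer_decode_encode[OF G] by metis
      then have "?x = ?y" using Z(2) xy by (auto simp: X_def inj_on_def)
      then have "fst v = fst w" using xy(3,4) by metis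
      then show "v = w" using \<open>snd v = snd w\<close> by (simp add: prod_eq_iff)
    qed
  qed (use S A' e in \<open>auto simp: \<rho>_def intro!: continuous_on_snd continuous_on_id\<close>)
  then obtain E where E: "E \<in> sets borel" "measure \<rho> (sym_diff A' (snd -` E)) < e/2" by blast
  have Es: "snd -` E \<in> sets (borel :: (real \<times> (nat \<Rightarrow> real)) measure)"
    using measurable_sets[OF snd_m E(1)] by simp
  let ?B = "{x \<in> space M. odometer_encode (\<phi> x) \<in> E}"
  have Bs: "?B \<in> sets M" using measurable_sets[OF enc E(1)] by (simp add: vimage_def Int_def conj_commute)
  have "measure M (sym_diff A ?B) = measure M (z -` (sym_diff A' (snd -` E)) \<inter> space M)"
  proof (rule measure_eq_AE)
    show "AE x in M. x \<in> sym_diff A ?B \<longleftrightarrow> x \<in> z -` (sym_diff A' (snd -` E)) \<inter> space M"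
      using a AE_space
      by eventually_elim (use sets.sets_into_space[OF A] in \<open>auto simp: z_def A'_def indicator_def split: if_splits\<close>)
    show "sym_diff A ?B \<in> sets M" using A Bs by auto
    show "z -` (sym_diff A' (snd -` E)) \<inter> space M \<in> sets M"
      using A' Es by (intro measurable_sets[OF zm]) auto
  qed
  also have "\<dots> = measure \<rho> (sym_diff A' (snd -` E))"
    unfolding \<rho>_def using zm A' Es by (subst measure_distr) auto
  finally have 1: "measure M (sym_diff A ?B) < e/2" using E by simp
  define \<nu> where "\<nu> = distr M (odometer_borel G) \<phi>"
  define C where "C = odometer_encode -` E \<inter> space (odometer_borel G)"
  have C: "C \<in> sets (odometer_borel G)"
    unfolding C_def by (rule measurable_sets[OF measurable_odometer_encode E(1)])
  have "\<exists>j D. measure \<nu> (sym_diff C {y \<in> odometer_space G. y j \<in> D}) < e/2"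
    by (rule odometer_cylinder_approximation[OF G])
      (use C e finite_measure_distr[OF \<phi>] in \<open>auto simp: \<nu>_def\<close>)
  then obtain j D where jD: "measure \<nu> (sym_diff C {y \<in> odometer_space G. y j \<in> D}) < e/2" by blast
  let ?P = "{x \<in> space M. \<phi> x j \<in> D}"
  have Ps: "?P \<in> sets M"
  proof -
    have "\<phi> -` {y \<in> odometer_space G. y j \<in> D} \<inter> space M = ?P"
      using measurable_space[OF \<phi>] by auto
    then show ?thesis using measurable_sets[OF \<phi> odometer_cylinder_in_sets[of G j D]] by simp
  qed
  have "measure \<nu> (sym_diff C {y \<in> odometer_space G. y j \<in> D}) =
      measure M (\<phi> -` (sym_diff C {y \<in> odometer_space G. y j \<in> D}) \<inter> space M)"
    unfolding \<nu>_def using C odometer_cylinder_in_sets[of G j D] by (intro measure_distr[OF \<phi>]) auto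
  also have "\<phi> -` (sym_diff C {y \<in> odometer_space G. y j \<in> D}) \<inter> space M = sym_diff ?B ?P"
    using measurable_space[OF \<phi>] by (auto simp: C_def)
  finally have 2: "measure M (sym_diff ?B ?P) < e/2" using jD by simp
  have "measure M (sym_diff A ?P) \<le> measure M (sym_diff A ?B) + measure M (sym_diff ?B ?P)"
    by (rule measure_sym_diff_triangle[OF A Bs Ps])
  with 1 2 show ?thesis by (intro exI[of _ j] exI[of _ D]) linarith
qed

text \<open>The same argument with the roles exchanged: now the odometer is the source, and the graph over the encoded
odometer points is projected to the real coordinate of \<open>\<psi> y\<close>.\<close>

lemma odometer_sets_approximable_by_preimages:
  fixes M :: "'a measure"
  assumes M: "lebesgue_probability_space M" and G: "odometer_data G"
    and \<nu>: "sets \<nu> = sets (odometer_borel G)" "finite_measure \<nu>"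
    and \<psi>: "\<psi> \<in> \<nu> \<rightarrow>\<^sub>M M" "distr \<nu> M \<psi> = M" and inj: "ae_injective \<nu> \<psi>"
    and A: "A \<in> sets \<nu>" and e: "e > 0"
  shows "\<exists>E\<in>sets M. measure \<nu> (sym_diff A (\<psi> -` E \<inter> space \<nu>)) < e"
proof -
  obtain r :: "'a \<Rightarrow> real" and k :: "real \<Rightarrow> 'a"
    where r [measurable]: "r \<in> borel_measurable M" and kr: "AE x in M. k (r x) = x"
  proof (rule lebesgue_probability_space_coordinate[OF M])
    fix r :: "'a \<Rightarrow> real" and k :: "real \<Rightarrow> 'a"
    assume "r \<in> borel_measurable M" "AE x in M. k (r x) = x"
    then show thesis by (rule that[of r k])
  qed
  interpret finite_measure \<nu> by fact
  have sp: "space \<nu> = odometer_space G" using sets_eq_imp_space_eq[OF \<nu>(1)] by simp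
  have kr': "AE y in \<nu>. k (r (\<psi> y)) = \<psi> y"
    by (rule AE_distrD[OF \<psi>(1), of "\<lambda>x. k (r x) = x", unfolded \<psi>(2), OF kr])
  obtain Z where Z: "Z \<in> null_sets \<nu>" "inj_on \<psi> (space \<nu> - Z)"
    using inj by (auto simp: ae_injective_def)
  from kr' obtain Z2 where Z2: "Z2 \<in> null_sets \<nu>" "{y \<in> space \<nu>. k (r (\<psi> y)) \<noteq> \<psi> y} \<subseteq> Z2"
    unfolding eventually_ae_filter by blast
  define Y where "Y = odometer_space G - (Z \<union> Z2)"
  have Ys: "Y \<in> sets (odometer_borel G)"
    using sets.Diff[OF sets.top sets.Un[OF null_setsD2[OF Z(1)] null_setsD2[OF Z2(1)]]]
    unfolding Y_def sp \<nu>(1) by simp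
  have enc: "odometer_encode \<in> borel_measurable \<nu>"
    using measurable_odometer_encode[of G] measurable_cong_sets[OF \<nu>(1) refl] by blast
  have rpsi: "(\<lambda>y. r (\<psi> y)) \<in> borel_measurable \<nu>" by (rule measurable_compose[OF \<psi>(1) r])
  then have rpsi': "(\<lambda>y. r (\<psi> y)) \<in> borel_measurable (odometer_borel G)"
    using measurable_cong_sets[OF \<nu>(1) refl] by blast
  define u where "u = (\<lambda>w. if odometer_decode G w \<in> odometer_space G then r (\<psi> (odometer_decode G w)) else 0)"
  have um: "u \<in> borel_measurable borel"
    unfolding u_def by (rule measurable_extend_decoded[OF G rpsi']) simp
  define c where "c = (\<lambda>w. if odometer_decode G w \<in> odometer_space G
    then odometer_encode (odometer_decode G w) else (\<lambda>_. 0))"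
  have cm: "c \<in> borel_measurable borel"
    unfolding c_def by (rule measurable_extend_decoded[OF G measurable_odometer_encode]) simp
  define C where "C = {w. odometer_decode G w \<in> Y} \<inter> {w \<in> space borel. c w = w}"
  have Cs: "C \<in> sets borel"
  proof -
    have "{w \<in> space borel. c w = w} \<in> sets borel" using cm by measurable
    then show ?thesis unfolding C_def using decoded_vimage_borel[OF G Ys] by (rule sets.Int[rotated])
  qed
  define S where "S = {z. fst z \<in> C \<and> snd z = u (fst z)}"
  have S: "S \<in> sets borel" unfolding S_def by (rule borel_measurable_graph[OF um Cs])
  define z where "z = (\<lambda>y. (odometer_encode y, r (\<psi> y)))"
  have zm: "z \<in> borel_measurable \<nu>" unfolding z_def using enc rpsi by measurable
  define \<rho> where "\<rho> = distr \<nu> borel z"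
  have fst_m: "fst \<in> borel_measurable (borel :: ((nat \<Rightarrow> real) \<times> real) measure)"
    and snd_m: "snd \<in> borel_measurable (borel :: ((nat \<Rightarrow> real) \<times> real) measure)"
    by (intro borel_measurable_continuous_onI continuous_on_fst continuous_on_snd continuous_on_id)+
  define A' where "A' = {w :: (nat \<Rightarrow> real) \<times> real. odometer_decode G (fst w) \<in> A}"
  have A': "A' \<in> sets borel"
    using measurable_sets[OF fst_m decoded_vimage_borel[OF G, of A]] A \<nu>(1)
    by (simp add: A'_def vimage_def)
  have "\<exists>E\<in>sets borel. measure \<rho> (sym_diff A' (snd -` E)) < e"
  proof (rule injective_continuous_image_separates_sets)
    show "finite_measure \<rho>" unfolding \<rho>_def by (rule finite_measure_distr[OF zm])
    have "z y \<in> S" if "y \<in> Y" for y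
      using that odometer_decode_encode[OF G, of y]
      by (auto simp: S_def z_def C_def c_def u_def Y_def)
    moreover have "AE y in \<nu>. y \<in> Y"
      using AE_not_in[OF Z(1)] AE_not_in[OF Z2(1)] AE_space by eventually_elim (auto simp: Y_def sp)
    ultimately show "AE w in \<rho>. w \<in> S"
      unfolding \<rho>_def using S by (subst AE_distr_iff[OF zm]) auto
    show "inj_on snd S"
    proof (rule inj_onI)
      fix v w assume v: "v \<in> S" and w: "w \<in> S" and eq: "snd v = snd w"
      let ?x = "odometer_decode G (fst v)" and ?y = "odometer_decode G (fst w)"
      have xy: "?x \<in> Y" "?y \<in> Y" "odometer_encode ?x = fst v" "odometer_encode ?y = fst w"
        "r (\<psi> ?x) = r (\<psi> ?y)"
        using v w eq by (auto simp: S_def C_def c_def u_def Y_def)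
      have "k (r (\<psi> ?x)) = \<psi> ?x" "k (r (\<psi> ?y)) = \<psi> ?y"
        using xy Z2(2) by (auto simp: Y_def sp)
      then have "\<psi> ?x = \<psi> ?y" using xy(5) by metis
      moreover have "?x \<in> space \<nu> - Z" "?y \<in> space \<nu> - Z" using xy(1,2) by (auto simp only: Y_def sp)
      ultimately have "?x = ?y" by (rule inj_onD[OF Z(2)])
      then have "fst v = fst w" using xy(3,4) by metis
      then show "v = w" using eq by (simp add: prod_eq_iff)
    qed
  qed (use S A' e in \<open>auto simp: \<rho>_def intro!: continuous_on_snd continuous_on_id\<close>)
  then obtain E where E: "E \<in> sets borel" "measure \<rho> (sym_diff A' (snd -` E)) < e" by blast
  have Es: "snd -` E \<in> sets (borel :: ((nat \<Rightarrow> real) \<times> real) measure)"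
    using measurable_sets[OF snd_m E(1)] by simp
  have "z -` (sym_diff A' (snd -` E)) \<inter> space \<nu> = sym_diff A (\<psi> -` (r -` E \<inter> space M) \<inter> space \<nu>)"
    using sets.sets_into_space[OF A] odometer_decode_encode[OF G] measurable_space[OF \<psi>(1)]
    by (auto simp: z_def A'_def sp)
  moreover have "measure \<rho> (sym_diff A' (snd -` E)) = measure \<nu> (z -` (sym_diff A' (snd -` E)) \<inter> space \<nu>)"
    unfolding \<rho>_def using zm A' Es by (subst measure_distr) auto
  ultimately have "measure \<nu> (sym_diff A (\<psi> -` (r -` E \<inter> space M) \<inter> space \<nu>)) < e"
    using E(2) by (simp only:)
  then show ?thesis by (rule bexI[OF _ measurable_sets[OF r E(1)]])
qed

section \<open>Stacking towers\<close>

lemma zd_action_total_mass: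
  assumes "zd_action M T" shows "emeasure M (space M) = 1"
proof -
  from assms consider "lebesgue_probability_space M" | "finite_uniform_space M"
    by (auto simp: zd_action_def)
  then show ?thesis
  proof cases
    case 1
    then show ?thesis by (rule lebesgue_probability_space_coordinate)
  next
    case 2
    then have "finite (space M)" "space M \<noteq> {}" "M = uniform_count_measure (space M)"
      by (auto simp: finite_uniform_space_def)
    then show ?thesis
      by (metis emeasure_uniform_count_measure ennreal_1 divide_self_if card_gt_0_iff
          of_nat_eq_0_iff less_numeral_extra(3) order_refl)
  qed
qed

locale stacking_towers =
  fixes M :: "'a measure" and T :: "int ^ 'd \<Rightarrow> 'a \<Rightarrow> 'a"
    and F :: "nat \<Rightarrow> (int ^ 'd) set" and B :: "nat \<Rightarrow> 'a set"
  assumes action: "zd_action M T" and folner: "folner_sequence F" and zero_mem: "\<And>n. 0 \<in> F n"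
    and rank_one: "rank_one_towers M T F B" and stacking: "stacking M T F B"
begin

sublocale finite_measure M
  by (rule finite_measureI) (simp add: zd_action_total_mass[OF action])

lemma measure_space_1: "measure M (space M) = 1"
  by (simp add: measure_def zd_action_total_mass[OF action])

lemma T_measurable: "T v \<in> M \<rightarrow>\<^sub>M M"
  and T_distr: "distr M M (T v) = M"
  and T_add: "x \<in> space M \<Longrightarrow> T v (T w x) = T (v + w) x"
  and T_0: "x \<in> space M \<Longrightarrow> T 0 x = x"
  using action by (auto simp: zd_action_def)

lemma T_in_space: "x \<in> space M \<Longrightarrow> T v x \<in> space M"
  by (rule measurable_space[OF T_measurable])

lemma AE_translate: "AE x in M. P x \<Longrightarrow> AE x in M. P (T v x)"
  using AE_distrD[OF T_measurable, of P v, unfolded T_distr] .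

lemma mem_T_image_iff:
  assumes "x \<in> space M" "A \<subseteq> space M"
  shows "x \<in> T v ` A \<longleftrightarrow> T (- v) x \<in> A"
proof
  assume "x \<in> T v ` A"
  then show "T (- v) x \<in> A" using assms by (auto simp: T_add T_0 subset_eq)
next
  assume "T (- v) x \<in> A"
  then show "x \<in> T v ` A" using assms by (intro image_eqI[of _ _ "T (- v) x"]) (auto simp: T_add T_0)
qed

lemma T_image_subset_space: "A \<subseteq> space M \<Longrightarrow> T v ` A \<subseteq> space M"
  using T_in_space by auto

lemma T_image_image: "A \<subseteq> space M \<Longrightarrow> T v ` T w ` A = T (v + w) ` A"
  by (auto simp: image_image T_add subset_eq)

lemma T_image_0: "A \<subseteq> space M \<Longrightarrow> T 0 ` A = A"
  by (force simp: T_0 subset_eq)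

lemma T_image_eq_vimage:
  assumes "A \<subseteq> space M" shows "T v ` A = T (- v) -` A \<inter> space M"
  using mem_T_image_iff[OF _ assms, of _ v] T_image_subset_space[OF assms, of v] by blast

lemma T_image_in_sets:
  assumes "A \<in> sets M" shows "T v ` A \<in> sets M"
  using measurable_sets[OF T_measurable assms] T_image_eq_vimage[OF sets.sets_into_space[OF assms]] by simp

lemma measure_T_image:
  assumes "A \<in> sets M" shows "measure M (T v ` A) = measure M A"
  using measure_distr[OF T_measurable assms, of "- v"]
  by (simp add: T_distr T_image_eq_vimage[OF sets.sets_into_space[OF assms]])

lemma base_in_sets: "B n \<in> sets M" and base_pos: "measure M (B n) > 0"
  and shape_finite: "finite (F n)" and levels_disjoint: "disjoint_family_on (\<lambda>v. T v ` B n) (F n)"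
  using rank_one by (auto simp: rank_one_towers_def tower_def)

lemma base_subset_space: "B n \<subseteq> space M"
  by (rule sets.sets_into_space[OF base_in_sets])

lemma level_in_sets: "T v ` B n \<in> sets M"
  by (rule T_image_in_sets[OF base_in_sets])

lemma level_nonempty: "T v ` B n \<noteq> {}"
  using base_pos[of n] by auto

abbreviation levels :: "nat \<Rightarrow> (int ^ 'd) set \<Rightarrow> 'a set" where
  "levels n S \<equiv> \<Union>v\<in>S. T v ` B n"

lemma levels_in_sets: "levels n S \<in> sets M"
  by (rule sets.countable_UN') (auto simp: level_in_sets)

lemma measure_levels:
  assumes "S \<subseteq> F n" shows "measure M (levels n S) = card S * measure M (B n)"
proof -
  have "measure M (levels n S) = (\<Sum>v\<in>S. measure M (T v ` B n))"
    using assms shape_finite levels_disjoint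
    by (intro finite_measure_finite_Union)
      (auto simp: level_in_sets intro: finite_subset disjoint_family_on_mono)
  then show ?thesis by (simp add: measure_T_image[OF base_in_sets])
qed

definition err :: "nat \<Rightarrow> 'a set" where "err n = tower_error M T (F n) (B n)"

lemma err_eq: "err n = space M - levels n (F n)"
  by (simp add: err_def tower_error_def)

lemma err_in_sets: "err n \<in> sets M"
  unfolding err_eq using levels_in_sets by auto

lemma shape_mass: "card (F n) * measure M (B n) + measure M (err n) = 1"
  using finite_measure_compl[OF levels_in_sets, of n "F n"] measure_levels[of "F n" n]
  by (simp add: err_eq measure_space_1)

lemma shape_mass_le: "card (F n) * measure M (B n) \<le> 1"
  using shape_mass[of n] measure_nonneg[of M "err n"] by linarith

text \<open>Only the set of sublevels is asserted to exist. It need not be the translate by \<open>v\<close> of the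
descendant set, since a translated index may leave the shape \<open>F n\<close> even though the translated
sublevel is still covered by levels.\<close>

lemma level_is_union_of_levels:
  assumes "m \<le> n" "v \<in> F m"
  shows "\<exists>D\<subseteq>F n. T v ` B m = levels n D"
  using assms
proof (induction n rule: dec_induct)
  case base
  then show ?case by (intro exI[of _ "{v}"]) auto
next
  case (step n)
  then obtain D where D: "D \<subseteq> F n" "T v ` B m = levels n D" by blast
  have "\<forall>i\<in>F n. \<exists>E\<subseteq>F (Suc n). T i ` B n = levels (Suc n) E"
    using stacking by (auto simp: stacking_def union_of_levels_def)
  then obtain E where E: "\<And>i. i \<in> F n \<Longrightarrow> E i \<subseteq> F (Suc n)" "\<And>i. i \<in> F n \<Longrightarrow> T i ` B n = levels (Suc n) (E i)"
    by metis
  have "levels n D = (\<Union>i\<in>D. levels (Suc n) (E i))" using D(1) E(2) by (intro SUP_cong) blast+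
  then have "T v ` B m = levels (Suc n) (\<Union>i\<in>D. E i)" using D by auto
  moreover have "(\<Union>i\<in>D. E i) \<subseteq> F (Suc n)" using E(1) D(1) by blast
  ultimately show ?case by blast
qed

abbreviation desc :: "nat \<Rightarrow> nat \<Rightarrow> (int ^ 'd) set" where
  "desc m n \<equiv> descendants T F B m n"

lemma desc_subset: "desc m n \<subseteq> F n"
  by (auto simp: descendants_def)

lemma finite_desc: "finite (desc m n)"
  by (rule finite_subset[OF desc_subset shape_finite])

lemma level_unique: "i \<in> F n \<Longrightarrow> j \<in> F n \<Longrightarrow> x \<in> T i ` B n \<Longrightarrow> x \<in> T j ` B n \<Longrightarrow> i = j"
  using levels_disjoint[of n] by (auto simp: disjoint_family_on_def)

lemma desc_decomposition:
  assumes "m \<le> n"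
  shows "B m = levels n (desc m n)"
    and "i \<in> F n \<Longrightarrow> i \<notin> desc m n \<Longrightarrow> T i ` B n \<inter> B m = {}"
proof -
  obtain D where D: "D \<subseteq> F n" "B m = levels n D"
    using level_is_union_of_levels[OF assms zero_mem] T_image_0[OF base_subset_space] by metis
  have "i \<in> desc m n \<longleftrightarrow> i \<in> D" if "i \<in> F n" for i
  proof
    assume "i \<in> desc m n"
    obtain x where x: "x \<in> T i ` B n" using level_nonempty by blast
    have "T i ` B n \<subseteq> B m" using \<open>i \<in> desc m n\<close> by (simp add: descendants_def)
    then have "x \<in> levels n D" using x D(2) by blast
    then obtain j where "j \<in> D" "x \<in> T j ` B n" by blast
    then show "i \<in> D" using level_unique[OF that _ x] D(1) by blast
  next
    assume "i \<in> D"
    then show "i \<in> desc m n" using that D(2) by (auto simp: descendants_def)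
  qed
  then have eq: "desc m n = D" using D(1) desc_subset by blast
  show "B m = levels n (desc m n)" using D eq by simp
  fix i assume i: "i \<in> F n" "i \<notin> desc m n"
  show "T i ` B n \<inter> B m = {}"
  proof (rule ccontr)
    assume "T i ` B n \<inter> B m \<noteq> {}"
    then obtain x j where "x \<in> T i ` B n" "j \<in> D" "x \<in> T j ` B n" using D(2) by blast
    then show False using level_unique[OF i(1), of j] D(1) i(2) eq by blast
  qed
qed

lemma measure_base_desc: "m \<le> n \<Longrightarrow> measure M (B m) = card (desc m n) * measure M (B n)"
  using desc_decomposition(1) measure_levels[OF desc_subset] by metis

lemma card_desc_pos: "m \<le> n \<Longrightarrow> card (desc m n) > 0"
  using measure_base_desc[of m n] base_pos[of m] by (cases "card (desc m n)") auto

lemma rank_one_approx: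
  assumes "A \<in> sets M" "e > 0"
  shows "\<exists>N. \<forall>n\<ge>N. \<exists>D\<subseteq>F n. measure M (sym_diff A (levels n D)) < e"
proof -
  obtain L where L: "\<And>n. union_of_levels T (F n) (B n) (L n)"
    "(\<lambda>n. measure M (sym_diff (L n) A)) \<longlonglongrightarrow> 0"
    using rank_one assms(1) unfolding rank_one_towers_def by blast
  have "\<forall>\<^sub>F n in sequentially. measure M (sym_diff (L n) A) < e"
    using order_tendstoD(2)[OF L(2) assms(2)] .
  then obtain N where N: "\<And>n. n \<ge> N \<Longrightarrow> measure M (sym_diff (L n) A) < e"
    by (auto simp: eventually_sequentially)
  show ?thesis
  proof (intro exI[of _ N] allI impI)
    fix n assume n: "n \<ge> N"
    obtain D where "D \<subseteq> F n" "L n = levels n D" using L(1)[of n] by (auto simp: union_of_levels_def)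
    then show "\<exists>D\<subseteq>F n. measure M (sym_diff A (levels n D)) < e"
      using N[OF n] by (auto simp: Un_commute)
  qed
qed

lemma err_tendsto_0: "(\<lambda>n. measure M (err n)) \<longlonglongrightarrow> 0"
proof (rule LIMSEQ_I)
  fix e :: real assume "e > 0"
  then obtain N where N: "\<And>n. n \<ge> N \<Longrightarrow> \<exists>D\<subseteq>F n. measure M (sym_diff (space M) (levels n D)) < e"
    using rank_one_approx[OF sets.top] by blast
  have "measure M (err n) < e" if n: "n \<ge> N" for n
  proof -
    obtain D where D: "D \<subseteq> F n" "measure M (sym_diff (space M) (levels n D)) < e" using N[OF n] by blast
    have "measure M (err n) \<le> measure M (sym_diff (space M) (levels n D))"
      using D(1) levels_in_sets by (intro finite_measure_mono) (auto simp: err_eq)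
    then show ?thesis using D by simp
  qed
  then show "\<exists>N. \<forall>n\<ge>N. norm (measure M (err n) - 0) < e" by auto
qed

text \<open>The indices that the translation by \<open>v\<close> moves out of the shape; the Folner property makes the levels with
these indices negligible.\<close>

definition boundary :: "nat \<Rightarrow> int ^ 'd \<Rightarrow> (int ^ 'd) set" where
  "boundary n v = {i \<in> F n. i + v \<notin> F n}"

lemma boundary_mass_tendsto_0: "(\<lambda>n. card (boundary n v) * measure M (B n)) \<longlonglongrightarrow> 0"
proof (rule tendsto_sandwich[OF _ _ tendsto_const])
  show "(\<lambda>n. real (card (sym_diff (F n) ((\<lambda>i. i + v) ` F n))) / real (card (F n))) \<longlonglongrightarrow> 0"
    using folner by (simp add: folner_sequence_def)
  have "card (boundary n v) * measure M (B n) \<le>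
      real (card (sym_diff (F n) ((\<lambda>i. i + v) ` F n))) / real (card (F n))" for n
  proof -
    have "card (boundary n v) = card ((\<lambda>i. i + v) ` boundary n v)"
      by (rule card_image[symmetric]) (auto simp: inj_on_def)
    also have "\<dots> \<le> card (sym_diff (F n) ((\<lambda>i. i + v) ` F n))"
      using shape_finite by (intro card_mono) (auto simp: boundary_def)
    finally have 1: "card (boundary n v) \<le> card (sym_diff (F n) ((\<lambda>i. i + v) ` F n))" .
    have pos: "card (F n) > 0" using shape_finite[of n] zero_mem[of n] by (auto simp: card_gt_0_iff)
    then have "measure M (B n) \<le> 1 / card (F n)"
      using shape_mass_le[of n] by (simp add: field_simps)
    then show ?thesis using 1
      by (metis (no_types, lifting) mult_mono of_nat_0_le_iff of_nat_mono measure_nonneg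
          times_divide_eq_right mult.right_neutral)
  qed
  then show "\<forall>\<^sub>F n in sequentially. card (boundary n v) * measure M (B n) \<le>
      real (card (sym_diff (F n) ((\<lambda>i. i + v) ` F n))) / real (card (F n))" by simp
qed simp

text \<open>If the sizes were bounded, the Folner ratio would eventually vanish, and a nonempty finite shape would
equal its translate by \<open>v\<close>. Summing a coordinate over the shape rules this out.\<close>

lemma shape_unbounded: "\<exists>n. card (F n) > K"
proof (rule ccontr)
  assume "\<not> ?thesis"
  then have K: "card (F n) \<le> K" for n by (simp add: not_less)
  define v :: "int ^ 'd" where "v = (\<chi> i. 1)"
  have "(\<lambda>n. real (card (sym_diff (F n) ((\<lambda>i. i + v) ` F n))) / real (card (F n))) \<longlonglongrightarrow> 0"
    using folner by (simp add: folner_sequence_def)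
  then have "\<forall>\<^sub>F n in sequentially.
      real (card (sym_diff (F n) ((\<lambda>i. i + v) ` F n))) / real (card (F n)) < 1 / (real K + 1)"
    by (rule order_tendstoD) simp
  then obtain n where n: "real (card (sym_diff (F n) ((\<lambda>i. i + v) ` F n))) / real (card (F n)) < 1 / (real K + 1)"
    by (auto simp: eventually_sequentially)
  have pos: "card (F n) > 0" using shape_finite[of n] zero_mem[of n] by (auto simp: card_gt_0_iff)
  then have "real (card (sym_diff (F n) ((\<lambda>i. i + v) ` F n))) < real (card (F n)) / (real K + 1)"
    using n by (simp add: field_simps)
  also have "\<dots> < 1" using K[of n] by (simp add: field_simps)
  finally have "card (sym_diff (F n) ((\<lambda>i. i + v) ` F n)) = 0" by simp
  then have eq: "F n = (\<lambda>i. i + v) ` F n" using shape_finite[of n] by auto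
  have "(\<Sum>i\<in>F n. i $ k) = (\<Sum>i\<in>F n. i $ k) + int (card (F n))" for k
  proof -
    have "(\<Sum>i\<in>F n. i $ k) = (\<Sum>i\<in>(\<lambda>i. i + v) ` F n. i $ k)" using eq by simp
    also have "\<dots> = (\<Sum>i\<in>F n. (i + v) $ k)" by (subst sum.reindex) (auto simp: inj_on_def)
    also have "\<dots> = (\<Sum>i\<in>F n. i $ k) + int (card (F n))" by (simp add: v_def sum.distrib)
    finally show ?thesis .
  qed
  then show False using pos by simp
qed

text \<open>Each level has positive measure and so contains a point outside \<open>Z\<close>; these points are distinct.\<close>

lemma infinite_if_almost_full:
  assumes "Z \<in> null_sets M" shows "infinite (space M - Z)"
proof
  assume fin: "finite (space M - Z)"
  obtain n where n: "card (F n) > card (space M - Z)" using shape_unbounded by blast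
  have "\<exists>x. x \<in> T v ` B n - Z" for v
  proof (rule ccontr)
    assume "\<nexists>x. x \<in> T v ` B n - Z"
    then have "T v ` B n \<subseteq> Z" by auto
    then have "measure M (T v ` B n) \<le> measure M Z" using assms by (intro finite_measure_mono) auto
    also have "measure M Z = 0" using assms by (simp add: measure_def null_sets_def)
    finally show False using base_pos[of n] measure_T_image[OF base_in_sets, of v n] by linarith
  qed
  then obtain p where p: "\<And>v. p v \<in> T v ` B n - Z" by metis
  have "inj_on p (F n)"
    by (rule inj_onI) (metis p level_unique DiffD1)
  moreover have "p ` F n \<subseteq> space M - Z"
    using p T_image_subset_space[OF base_subset_space, of _ n] by blast
  ultimately have "card (F n) \<le> card (space M - Z)" using fin by (metis card_inj_on_le)
  then show False using n by simp
qed

text \<open>A finite space has no room for towers with arbitrarily many disjoint nonempty levels.\<close>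

lemma lebesgue_space: "lebesgue_probability_space M"
proof -
  have "\<not> finite_uniform_space M"
    using infinite_if_almost_full[of "{}"] by (auto simp: finite_uniform_space_def)
  then show ?thesis using action by (auto simp: zd_action_def)
qed

end

section \<open>Equivariant labellings by cosets\<close>

context stacking_towers
begin

definition coset_label :: "(int ^ 'd) set \<Rightarrow> ('a \<Rightarrow> (int ^ 'd) set) \<Rightarrow> bool" where
  "coset_label G f \<longleftrightarrow> f \<in> M \<rightarrow>\<^sub>M count_space (rcosets\<^bsub>Zd\<^esub> G) \<and>
     (\<forall>v. AE x in M. f (T v x) = f x #>\<^bsub>Zd\<^esub> v)"

text \<open>For a single subgroup, \<open>descendants_traced\<close> is condition (a) of the theorem and
\<open>descendants_concentrate\<close> is condition (b).\<close>

definition descendants_traced :: "(int ^ 'd) set \<Rightarrow> nat \<Rightarrow> real \<Rightarrow> bool" where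
  "descendants_traced G l \<epsilon> \<longleftrightarrow>
     (\<exists>N. \<forall>m\<ge>N. m \<ge> l \<longrightarrow>
       (\<exists>D \<subseteq> rcosets\<^bsub>Zd\<^esub> G.
          real (card (sym_diff (desc l m) {i \<in> F m. G #>\<^bsub>Zd\<^esub> i \<in> D})) / real (card (desc l m)) < \<epsilon>))"

definition descendants_concentrate :: "(int ^ 'd) set \<Rightarrow> bool" where
  "descendants_concentrate G \<longleftrightarrow>
     (\<forall>\<eta>::real. \<eta> > 0 \<longrightarrow>
       (\<exists>N. \<forall>m\<ge>N. \<forall>n>m.
         (\<exists>g. real (card {i \<in> desc m n. i \<notin> G #>\<^bsub>Zd\<^esub> g}) / real (card (desc m n)) < \<eta>)))"

lemma card_levels_mostly_inside:
  fixes c :: real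
  assumes J: "J \<subseteq> F n" and A: "A \<in> sets M"
    and ge: "\<And>i. i \<in> J \<Longrightarrow> measure M (T i ` B n \<inter> A) \<ge> c"
  shows "card J * c \<le> measure M A"
proof -
  have fin: "finite J" using J shape_finite finite_subset by blast
  have "card J * c = (\<Sum>i\<in>J. c)" by simp
  also have "\<dots> \<le> (\<Sum>i\<in>J. measure M (T i ` B n \<inter> A))" by (rule sum_mono[OF ge])
  also have "\<dots> = measure M (\<Union>i\<in>J. T i ` B n \<inter> A)"
    using fin A disjoint_family_on_mono[OF J levels_disjoint[of n]]
    by (intro finite_measure_finite_Union[symmetric])
      (auto simp: level_in_sets sets.Int image_subset_iff disjoint_family_on_def)
  also have "\<dots> \<le> measure M A" using A by (intro finite_measure_mono) auto
  finally show ?thesis .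
qed

text \<open>If every level had a proportion of more than \<open>\<eta>\<close> outside \<open>P\<close>, so would every union of levels, and
it could approximate \<open>P\<close> well only by being small, although \<open>P\<close> is not.\<close>

lemma some_level_mostly_inside:
  assumes P: "P \<in> sets M" "measure M P > 0" and \<eta>: "\<eta> > 0"
  shows "\<exists>N. \<forall>m\<ge>N. \<exists>i\<in>F m. measure M (T i ` B m - P) \<le> \<eta> * measure M (B m)"
proof -
  \<comment> \<open>The largest error with \<open>\<delta> + \<delta>/\<eta> \<le> measure M P\<close>.\<close>
  define \<delta> where "\<delta> = measure M P / (1 + 1/\<eta>)"
  have "1 + 1/\<eta> > 0" using \<eta> by (simp add: add_pos_pos)
  then have "\<delta> > 0" "\<delta> * (1 + 1/\<eta>) = measure M P"
    using P(2) by (auto simp: \<delta>_def)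
  then have \<delta>: "\<delta> > 0" "\<delta> + \<delta>/\<eta> = measure M P" by (auto simp: distrib_left)
  obtain N where N: "\<And>m. m \<ge> N \<Longrightarrow> \<exists>D\<subseteq>F m. measure M (sym_diff P (levels m D)) < \<delta>"
    using rank_one_approx[OF P(1) \<delta>(1)] by blast
  have "\<exists>i\<in>F m. measure M (T i ` B m - P) \<le> \<eta> * measure M (B m)" if m: "m \<ge> N" for m
  proof (rule ccontr)
    assume "\<not> ?thesis"
    then have big: "\<And>i. i \<in> F m \<Longrightarrow> \<eta> * measure M (B m) \<le> measure M (T i ` B m - P)" by force
    obtain D where D: "D \<subseteq> F m" "measure M (sym_diff P (levels m D)) < \<delta>" using N[OF m] by blast
    have "card D * (\<eta> * measure M (B m)) \<le> measure M (levels m D - P)"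
    proof (rule card_levels_mostly_inside[OF D(1)])
      show "levels m D - P \<in> sets M" using levels_in_sets P by auto
      fix i assume i: "i \<in> D"
      then have "T i ` B m \<inter> (levels m D - P) = T i ` B m - P" by blast
      then show "\<eta> * measure M (B m) \<le> measure M (T i ` B m \<inter> (levels m D - P))"
        using big i D by auto
    qed
    also have "\<dots> \<le> measure M (sym_diff P (levels m D))"
      using levels_in_sets P by (intro finite_measure_mono) auto
    finally have "\<eta> * measure M (levels m D) < \<delta>"
      using D measure_levels[OF D(1)] by (simp add: algebra_simps)
    then have 1: "measure M (levels m D) < \<delta>/\<eta>" using \<eta> by (simp add: field_simps)
    have "measure M P \<le> measure M (levels m D \<union> sym_diff P (levels m D))"
      using levels_in_sets P by (intro finite_measure_mono) auto
    also have "\<dots> \<le> measure M (levels m D) + measure M (sym_diff P (levels m D))"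
      using levels_in_sets P by (intro measure_Un_le) auto
    finally show False using 1 D(2) \<delta>(2) by linarith
  qed
  then show ?thesis by blast
qed

lemma coset_labelD:
  assumes "coset_label G f"
  shows "x \<in> space M \<Longrightarrow> f x \<in> rcosets\<^bsub>Zd\<^esub> G" "{x \<in> space M. f x \<in> D} \<in> sets M"
    "AE x in M. f (T v x) = f x #>\<^bsub>Zd\<^esub> v"
proof -
  have f: "f \<in> M \<rightarrow>\<^sub>M count_space (rcosets\<^bsub>Zd\<^esub> G)" using assms by (simp add: coset_label_def)
  show *: "x \<in> space M \<Longrightarrow> f x \<in> rcosets\<^bsub>Zd\<^esub> G" for x using measurable_space[OF f] by simp
  have "f -` (D \<inter> rcosets\<^bsub>Zd\<^esub> G) \<inter> space M \<in> sets M" by (rule measurable_sets[OF f]) simp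
  also have "f -` (D \<inter> rcosets\<^bsub>Zd\<^esub> G) \<inter> space M = {x \<in> space M. f x \<in> D}" using * by auto
  finally show "{x \<in> space M. f x \<in> D} \<in> sets M" .
  show "AE x in M. f (T v x) = f x #>\<^bsub>Zd\<^esub> v" using assms by (simp add: coset_label_def)
qed

lemma label_set_in_sets:
  assumes "coset_label G f" "A \<in> sets M"
  shows "{x \<in> A. f x \<in> D} \<in> sets M"
proof -
  have "{x \<in> A. f x \<in> D} = A \<inter> {x \<in> space M. f x \<in> D}"
    using sets.sets_into_space[OF assms(2)] by auto
  then show ?thesis using coset_labelD(2)[OF assms(1)] assms(2) by simp
qed

lemma measure_label_translate:
  assumes f: "coset_label G f" and A: "A \<in> sets M"
  shows "measure M {x \<in> T i ` A. f x \<noteq> c #>\<^bsub>Zd\<^esub> i} = measure M {y \<in> A. f y \<noteq> c}"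
proof -
  have s1: "{x \<in> A'. f x \<noteq> c'} \<in> sets M" if "A' \<in> sets M" for c' A'
    using label_set_in_sets[OF f that, of "- {c'}"] by simp
  have *: "T (- i) ` {x \<in> T i ` A. f x \<noteq> c #>\<^bsub>Zd\<^esub> i} = {y \<in> A. f (T i y) \<noteq> c #>\<^bsub>Zd\<^esub> i}"
  proof -
    have "T (- i) (T i y) = y" if "y \<in> A" for y
      using that sets.sets_into_space[OF A] by (auto simp: T_add T_0)
    then show ?thesis by (intro equalityI subsetI; force)
  qed
  have "measure M {x \<in> T i ` A. f x \<noteq> c #>\<^bsub>Zd\<^esub> i} = measure M {y \<in> A. f (T i y) \<noteq> c #>\<^bsub>Zd\<^esub> i}"
    using measure_T_image[OF s1[OF T_image_in_sets[OF A]], of "- i" i "c #>\<^bsub>Zd\<^esub> i"] by (simp add: *)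
  also have "\<dots> = measure M {y \<in> A. f y \<noteq> c}"
  proof (rule measure_eq_AE)
    have fi: "f y #>\<^bsub>Zd\<^esub> i = c #>\<^bsub>Zd\<^esub> i \<longleftrightarrow> f y = c" for y
      by (metis Zd_coset_coset Zd_coset_0 add.right_inverse)
    show "AE x in M. x \<in> {y \<in> A. f (T i y) \<noteq> c #>\<^bsub>Zd\<^esub> i} \<longleftrightarrow> x \<in> {y \<in> A. f y \<noteq> c}"
      using coset_labelD(3)[OF f, of i] by eventually_elim (auto simp: fi)
    show "{y \<in> A. f (T i y) \<noteq> c #>\<^bsub>Zd\<^esub> i} \<in> sets M"
      using T_image_in_sets[OF s1[OF T_image_in_sets[OF A]], of "- i" i "c #>\<^bsub>Zd\<^esub> i"] by (simp add: *)
    show "{y \<in> A. f y \<noteq> c} \<in> sets M" by (rule s1[OF A])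
  qed
  finally show ?thesis .
qed

text \<open>Some level is almost contained in a class of positive measure, and translating the level back to the
base translates the class.\<close>

lemma base_mostly_in_one_class:
  assumes G: "finite_index_subgroup G" and f: "coset_label G f" and \<eta>: "\<eta> > 0"
  shows "\<exists>N. \<forall>m\<ge>N. \<exists>h. measure M {x \<in> B m. f x \<noteq> G #>\<^bsub>Zd\<^esub> h} \<le> \<eta> * measure M (B m)"
proof -
  let ?R = "rcosets\<^bsub>Zd\<^esub> G"
  have fin: "finite ?R" using G by (simp add: finite_index_subgroup_def)
  have s: "{x \<in> space M. f x = c} \<in> sets M" for c
    using coset_labelD(2)[OF f, of "{c}"] by simp
  have "\<exists>c\<in>?R. measure M {x \<in> space M. f x = c} > 0"
  proof (rule ccontr)
    assume "\<not> ?thesis"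
    then have z: "\<And>c. c \<in> ?R \<Longrightarrow> measure M {x \<in> space M. f x = c} = 0"
      by (metis less_le measure_nonneg)
    have "space M = (\<Union>c\<in>?R. {x \<in> space M. f x = c})" using coset_labelD(1)[OF f] by auto
    then have "measure M (space M) \<le> (\<Sum>c\<in>?R. measure M {x \<in> space M. f x = c})"
      using finite_measure_subadditive_finite[OF fin, of "\<lambda>c. {x \<in> space M. f x = c}"] s by auto
    then show False using z measure_space_1 by simp
  qed
  then obtain c where c: "c \<in> ?R" "measure M {x \<in> space M. f x = c} > 0" by blast
  then obtain h where h: "c = G #>\<^bsub>Zd\<^esub> h" by (auto simp: Zd_rcosets)
  obtain N where N: "\<And>m. m \<ge> N \<Longrightarrow>
      \<exists>i\<in>F m. measure M (T i ` B m - {x \<in> space M. f x = c}) \<le> \<eta> * measure M (B m)"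
    using some_level_mostly_inside[OF s c(2) \<eta>] by blast
  show ?thesis
  proof (intro exI[of _ N] allI impI)
    fix m assume "m \<ge> N"
    then obtain i where i: "measure M (T i ` B m - {x \<in> space M. f x = c}) \<le> \<eta> * measure M (B m)"
      using N by blast
    have "T i ` B m - {x \<in> space M. f x = c} = {x \<in> T i ` B m. f x \<noteq> (G #>\<^bsub>Zd\<^esub> (h - i)) #>\<^bsub>Zd\<^esub> i}"
      using T_image_subset_space[OF base_subset_space] by (auto simp: Zd_coset_coset h)
    then have "measure M {x \<in> B m. f x \<noteq> G #>\<^bsub>Zd\<^esub> (h - i)} \<le> \<eta> * measure M (B m)"
      using i measure_label_translate[OF f base_in_sets] by simp
    then show "\<exists>h. measure M {x \<in> B m. f x \<noteq> G #>\<^bsub>Zd\<^esub> h} \<le> \<eta> * measure M (B m)" by blast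
  qed
qed

text \<open>The level is a translate of the base, so it lies in the translated class up to the same proportion
\<open>\<eta>\<close>; hence \<open>A\<close> occupies most of the level if it contains the part of the level in that class.\<close>

lemma level_mostly_in_translated_class:
  assumes f: "coset_label G f" and h: "measure M {x \<in> B n. f x \<noteq> G #>\<^bsub>Zd\<^esub> h} \<le> \<eta> * measure M (B n)"
    and A: "A \<in> sets M"
    and sub: "\<And>x. x \<in> T i ` B n \<Longrightarrow> f x = G #>\<^bsub>Zd\<^esub> (h + i) \<Longrightarrow> x \<in> A"
  shows "measure M (T i ` B n \<inter> A) \<ge> (1 - \<eta>) * measure M (B n)"
proof -
  let ?W = "{x \<in> T i ` B n. f x \<noteq> (G #>\<^bsub>Zd\<^esub> h) #>\<^bsub>Zd\<^esub> i}"
  have W: "?W \<in> sets M"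
    using label_set_in_sets[OF f level_in_sets, where D = "- {(G #>\<^bsub>Zd\<^esub> h) #>\<^bsub>Zd\<^esub> i}"] by simp
  have "measure M (B n) = measure M (T i ` B n)" by (simp add: measure_T_image[OF base_in_sets])
  also have "\<dots> \<le> measure M ((T i ` B n \<inter> A) \<union> ?W)"
    using W A level_in_sets sub by (intro finite_measure_mono) (auto simp: Zd_coset_coset)
  also have "\<dots> \<le> measure M (T i ` B n \<inter> A) + measure M ?W"
    using W A level_in_sets by (intro measure_Un_le) auto
  also have "measure M ?W \<le> \<eta> * measure M (B n)"
    using h measure_label_translate[OF f base_in_sets] by simp
  finally show ?thesis by (simp add: algebra_simps)
qed

lemma label_imp_descendants_concentrate:
  assumes G: "finite_index_subgroup G" and f: "coset_label G f"
  shows "descendants_concentrate G"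
  unfolding descendants_concentrate_def
proof (intro allI impI)
  fix \<eta> :: real assume \<eta>: "\<eta> > 0"
  \<comment> \<open>The count yields the bound \<open>\<eta>' / (1 - \<eta>')\<close>, which is at most \<open>2 * \<eta>'\<close> if \<open>\<eta>' \<le> 1/2\<close>.\<close>
  define \<eta>' where "\<eta>' = min (\<eta>/4) (1/2)"
  have \<eta>': "\<eta>' > 0" "\<eta>' \<le> 1/2" "2 * \<eta>' < \<eta>" using \<eta> by (auto simp: \<eta>'_def)
  have subG: "subgroup G Zd" using G by (simp add: finite_index_subgroup_def)
  obtain N where N: "\<And>m. m \<ge> N \<Longrightarrow> \<exists>h. measure M {x \<in> B m. f x \<noteq> G #>\<^bsub>Zd\<^esub> h} \<le> \<eta>' * measure M (B m)"
    using base_mostly_in_one_class[OF G f \<eta>'(1)] by blast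
  show "\<exists>N. \<forall>m\<ge>N. \<forall>n>m.
         (\<exists>g. real (card {i \<in> desc m n. i \<notin> G #>\<^bsub>Zd\<^esub> g}) / real (card (desc m n)) < \<eta>)"
  proof (intro exI[of _ N] allI impI)
    fix m n assume mn: "m \<ge> N" "n > m"
    obtain h where h: "measure M {x \<in> B m. f x \<noteq> G #>\<^bsub>Zd\<^esub> h} \<le> \<eta>' * measure M (B m)" using N mn by blast
    obtain k where k: "measure M {x \<in> B n. f x \<noteq> G #>\<^bsub>Zd\<^esub> k} \<le> \<eta>' * measure M (B n)"
      using N[of n] mn by auto
    \<comment> \<open>The level of index \<open>i\<close> is mainly in the class of \<open>k + i\<close>, which is that of \<open>h\<close> if and only if
      \<open>i\<close> is congruent to \<open>h - k\<close>.\<close>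
    let ?J = "{i \<in> desc m n. i \<notin> G #>\<^bsub>Zd\<^esub> (h - k)}"
    let ?A = "{x \<in> B m. f x \<noteq> G #>\<^bsub>Zd\<^esub> h}"
    have A: "?A \<in> sets M" using label_set_in_sets[OF f base_in_sets, where D = "- {G #>\<^bsub>Zd\<^esub> h}"] by simp
    have "card ?J * ((1 - \<eta>') * measure M (B n)) \<le> measure M ?A"
    proof (rule card_levels_mostly_inside[OF _ A])
      show "?J \<subseteq> F n" using desc_subset by auto
      fix i assume i: "i \<in> ?J"
      show "(1 - \<eta>') * measure M (B n) \<le> measure M (T i ` B n \<inter> ?A)"
      proof (rule level_mostly_in_translated_class[OF f k A])
        fix x assume x: "x \<in> T i ` B n" "f x = G #>\<^bsub>Zd\<^esub> (k + i)"
        have "x \<in> B m" using x i by (auto simp: descendants_def)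
        moreover have "G #>\<^bsub>Zd\<^esub> (k + i) \<noteq> G #>\<^bsub>Zd\<^esub> h"
          using i Zd_coset_eq_iff[OF subG, of "k + i" h] by (auto simp: mem_Zd_coset_iff algebra_simps)
        ultimately show "x \<in> ?A" using x by auto
      qed
    qed
    also have "\<dots> \<le> \<eta>' * measure M (B m)" by (rule h)
    also have "\<dots> = \<eta>' * card (desc m n) * measure M (B n)"
      using measure_base_desc[of m n] mn by simp
    finally have "(card ?J * (1 - \<eta>')) * measure M (B n) \<le> (\<eta>' * card (desc m n)) * measure M (B n)"
      by (simp add: mult.assoc)
    then have "card ?J * (1 - \<eta>') \<le> \<eta>' * card (desc m n)"
      using base_pos[of n] by (simp only: mult_le_cancel_right_pos)
    moreover have "card ?J * (1/2) \<le> card ?J * (1 - \<eta>')" using \<eta>' by (intro mult_left_mono) auto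
    ultimately have "card ?J \<le> 2 * \<eta>' * card (desc m n)" by linarith
    also have "\<dots> < \<eta> * card (desc m n)" using \<eta>' card_desc_pos[of m n] mn by (intro mult_strict_right_mono) auto
    finally have "real (card ?J) / real (card (desc m n)) < \<eta>"
      using card_desc_pos[of m n] mn by (simp add: divide_less_eq)
    then show "\<exists>g. real (card {i \<in> desc m n. i \<notin> G #>\<^bsub>Zd\<^esub> g}) / real (card (desc m n)) < \<eta>" by blast
  qed
qed

text \<open>Every index in the symmetric difference to be counted has a level of which at least half lies in the
symmetric difference of \<open>B l\<close> and the union of classes. The factor 2 that is lost is the one in the hypothesis.\<close>

lemma label_imp_descendants_traced:
  assumes G: "finite_index_subgroup G" and f: "coset_label G f"
    and D: "measure M (sym_diff (B l) {x \<in> space M. f x \<in> D}) < \<epsilon> / 2 * measure M (B l)"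
  shows "descendants_traced G l \<epsilon>"
proof -
  obtain N where N: "\<And>m. m \<ge> N \<Longrightarrow> \<exists>h. measure M {x \<in> B m. f x \<noteq> G #>\<^bsub>Zd\<^esub> h} \<le> 1/2 * measure M (B m)"
    using base_mostly_in_one_class[OF G f, of "1/2"] by auto
  show ?thesis
    unfolding descendants_traced_def
  proof (intro exI[of _ N] allI impI)
    fix m assume m: "m \<ge> N" "m \<ge> l"
    obtain h where h: "measure M {x \<in> B m. f x \<noteq> G #>\<^bsub>Zd\<^esub> h} \<le> 1/2 * measure M (B m)"
      using N m by blast
    let ?D = "{c \<in> rcosets\<^bsub>Zd\<^esub> G. c #>\<^bsub>Zd\<^esub> h \<in> D}"
    let ?J = "sym_diff (desc l m) {i \<in> F m. G #>\<^bsub>Zd\<^esub> i \<in> ?D}"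
    let ?A = "sym_diff (B l) {x \<in> space M. f x \<in> D}"
    have A: "?A \<in> sets M" using coset_labelD(2)[OF f] base_in_sets by auto
    have "card ?J * ((1 - 1/2) * measure M (B m)) \<le> measure M ?A"
    proof (rule card_levels_mostly_inside[OF _ A])
      show "?J \<subseteq> F m" using desc_subset by auto
      fix i assume i: "i \<in> ?J"
      show "(1 - 1/2) * measure M (B m) \<le> measure M (T i ` B m \<inter> ?A)"
      proof (rule level_mostly_in_translated_class[OF f h A])
        fix x assume x: "x \<in> T i ` B m" "f x = G #>\<^bsub>Zd\<^esub> (h + i)"
        then have xs: "x \<in> space M" using T_image_subset_space[OF base_subset_space] by blast
        have fD: "f x \<in> D \<longleftrightarrow> G #>\<^bsub>Zd\<^esub> i \<in> ?D"
          using x(2) by (simp add: Zd_coset_coset Zd_coset_in_rcosets add.commute)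
        have "i \<in> F m" using i desc_subset by blast
        then have "x \<in> B l \<longleftrightarrow> i \<in> desc l m"
          using x(1) desc_decomposition(2)[OF m(2), of i] by (auto simp: descendants_def)
        then show "x \<in> ?A" using fD i xs \<open>i \<in> F m\<close> by auto
      qed
    qed
    also have "\<dots> < \<epsilon> / 2 * (card (desc l m) * measure M (B m))"
      using D measure_base_desc[OF m(2)] by simp
    finally have "real (card ?J) * measure M (B m) < (\<epsilon> * card (desc l m)) * measure M (B m)" by simp
    then have "real (card ?J) < \<epsilon> * card (desc l m)"
      using base_pos[of m] by (simp only: mult_less_cancel_right_pos)
    then have "real (card ?J) / real (card (desc l m)) < \<epsilon>"
      using card_desc_pos[OF m(2)] by (simp add: divide_less_eq)
    then show "\<exists>D \<subseteq> rcosets\<^bsub>Zd\<^esub> G.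
          real (card (sym_diff (desc l m) {i \<in> F m. G #>\<^bsub>Zd\<^esub> i \<in> D})) / real (card (desc l m)) < \<epsilon>"
      by (intro exI[of _ ?D]) auto
  qed
qed

end

context stacking_towers
begin

lemma conjugacy_to_odometer_label:
  assumes G: "odometer_data G" and \<nu>: "odometer_haar G \<nu>"
    and \<phi>: "factor_map M T \<nu> odometer_shift \<phi>" "ae_injective M \<phi>"
    and A: "A \<in> sets M" and e: "e > 0"
  shows "\<exists>H f D. finite_index_subgroup H \<and> coset_label H f \<and>
    measure M (sym_diff A {x \<in> space M. f x \<in> D}) < e"
proof -
  note P = odometer_haar_props[OF \<nu>]
  have \<phi>m: "\<phi> \<in> M \<rightarrow>\<^sub>M odometer_borel G"
    using \<phi>(1) measurable_cong_sets[OF refl P(1)] by (auto simp: factor_map_def)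
  obtain j D where jD: "measure M (sym_diff A {x \<in> space M. \<phi> x j \<in> D}) < e"
    using sets_approximable_by_preimages_of_cylinders[OF lebesgue_space G \<phi>m \<phi>(2) A e] by blast
  have "coset_label (G j) (\<lambda>x. \<phi> x j)"
    unfolding coset_label_def
  proof (intro conjI allI)
    show "(\<lambda>x. \<phi> x j) \<in> M \<rightarrow>\<^sub>M count_space (rcosets\<^bsub>Zd\<^esub> (G j))"
      by (rule measurable_compose[OF \<phi>m measurable_odometer_coordinate])
    fix v
    have "AE x in M. \<phi> (T v x) = odometer_shift v (\<phi> x)" using \<phi>(1) by (simp add: factor_map_def)
    then show "AE x in M. \<phi> (T v x) j = \<phi> x j #>\<^bsub>Zd\<^esub> v"
      by eventually_elim (simp add: odometer_shift_def)
  qed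
  moreover have "finite_index_subgroup (G j)" using G by (simp add: odometer_data_def)
  ultimately show ?thesis using jD by (intro exI[of _ "G j"] exI[of _ "\<lambda>x. \<phi> x j"] exI[of _ D]) blast
qed

text \<open>If the factor map starts at the odometer, its almost injectivity makes each of the finitely many sets
\<open>{y. y j = c}\<close> a preimage modulo a null set, and these preimages define the label.\<close>

lemma odometer_coordinate_descends:
  assumes G: "odometer_data G" and \<nu>: "odometer_haar G \<nu>"
    and \<psi>: "factor_map \<nu> odometer_shift M T \<psi>" "ae_injective \<nu> \<psi>"
  shows "\<exists>f. coset_label (G j) f \<and> (AE y in \<nu>. f (\<psi> y) = y j)"
proof -
  note P = odometer_haar_props[OF \<nu>]
  interpret \<nu>: finite_measure \<nu> by (rule P)
  have \<psi>m: "\<psi> \<in> \<nu> \<rightarrow>\<^sub>M M" and \<psi>d: "distr \<nu> M \<psi> = M"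
    and \<psi>e: "\<And>v. AE y in \<nu>. \<psi> (odometer_shift v y) = T v (\<psi> y)"
    using \<psi>(1) by (auto simp: factor_map_def)
  let ?R = "rcosets\<^bsub>Zd\<^esub> (G j)"
  have fin: "finite ?R" by (rule odometer_data_subgroup(2)[OF G])
  have "\<exists>E\<in>sets M. AE y in \<nu>. y \<in> {y \<in> odometer_space G. y j \<in> {c}} \<longleftrightarrow> \<psi> y \<in> E" for c
  proof (rule \<nu>.measurable_modulo_null_if_approximable[OF _ \<psi>m])
    show s: "{y \<in> odometer_space G. y j \<in> {c}} \<in> sets \<nu>"
      unfolding P(1) by (rule odometer_cylinder_in_sets)
    fix e :: real assume "e > 0"
    then show "\<exists>C\<in>sets M. measure \<nu> (sym_diff {y \<in> odometer_space G. y j \<in> {c}} (\<psi> -` C \<inter> space \<nu>)) < e"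
      by (rule odometer_sets_approximable_by_preimages[OF lebesgue_space G P(1) P(3) \<psi>m \<psi>d \<psi>(2) s])
  qed
  then have "\<forall>c. \<exists>E. E \<in> sets M \<and> (AE y in \<nu>. y \<in> {y \<in> odometer_space G. y j \<in> {c}} \<longleftrightarrow> \<psi> y \<in> E)"
    unfolding Bex_def by (rule allI)
  from choice[OF this] obtain E where E': "\<forall>c. E c \<in> sets M \<and>
      (AE y in \<nu>. y \<in> {y \<in> odometer_space G. y j \<in> {c}} \<longleftrightarrow> \<psi> y \<in> E c)"
    by (rule exE)
  have Es: "E c \<in> sets M"
    and E: "AE y in \<nu>. y \<in> {y \<in> odometer_space G. y j \<in> {c}} \<longleftrightarrow> \<psi> y \<in> E c" for c
    using spec[OF E', of c] by (rule conjunct1, rule conjunct2)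
  \<comment> \<open>The value \<open>G j\<close> is a default for points that do not lie in exactly one \<open>E c\<close>.\<close>
  define f where "f = (\<lambda>x. let S = {c \<in> ?R. x \<in> E c} in if is_singleton S then the_elem S else G j)"
  have GR: "G j \<in> ?R" using Zd_coset_in_rcosets[of "G j" 0] by (simp add: Zd_coset_0)
  have fm: "f \<in> M \<rightarrow>\<^sub>M count_space ?R"
  proof -
    have 1: "(\<lambda>x. {c \<in> ?R. x \<in> E c}) \<in> M \<rightarrow>\<^sub>M count_space (Pow ?R)"
    proof (subst measurable_count_space_eq2)
      show "finite (Pow ?R)" using fin by simp
      show "(\<lambda>x. {c \<in> ?R. x \<in> E c}) \<in> space M \<rightarrow> Pow ?R \<and>
        (\<forall>S\<in>Pow ?R. (\<lambda>x. {c \<in> ?R. x \<in> E c}) -` {S} \<inter> space M \<in> sets M)"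
      proof (intro conjI ballI)
        fix S assume S: "S \<in> Pow ?R"
        have "{x \<in> space M. \<forall>c\<in>?R. x \<in> E c \<longleftrightarrow> c \<in> S} \<in> sets M"
        proof (rule sets.sets_Collect_finite_All[OF _ fin])
          fix c
          have "{x \<in> space M. x \<in> E c \<longleftrightarrow> c \<in> S} = (if c \<in> S then E c else space M - E c)"
            using sets.sets_into_space[OF Es[of c]] by auto
          then show "{x \<in> space M. x \<in> E c \<longleftrightarrow> c \<in> S} \<in> sets M" using Es[of c] by auto
        qed
        also have "{x \<in> space M. \<forall>c\<in>?R. x \<in> E c \<longleftrightarrow> c \<in> S} =
            (\<lambda>x. {c \<in> ?R. x \<in> E c}) -` {S} \<inter> space M" using S by auto
        finally show "(\<lambda>x. {c \<in> ?R. x \<in> E c}) -` {S} \<inter> space M \<in> sets M" .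
      qed auto
    qed
    have "(\<lambda>S. if is_singleton S then the_elem S else G j) \<in> count_space (Pow ?R) \<rightarrow>\<^sub>M count_space ?R"
      using GR by (auto simp: is_singleton_def)
    from measurable_compose[OF 1 this] show ?thesis by (simp add: f_def Let_def)
  qed
  have fpsi: "AE y in \<nu>. f (\<psi> y) = y j"
  proof -
    have "AE y in \<nu>. \<forall>c\<in>?R. y \<in> {y \<in> odometer_space G. y j \<in> {c}} \<longleftrightarrow> \<psi> y \<in> E c"
      using E fin by (intro AE_finite_allI) auto
    then show ?thesis
    proof (rule AE_mp, intro AE_I2 impI)
      fix y assume y: "y \<in> space \<nu>"
        and *: "\<forall>c\<in>?R. y \<in> {y \<in> odometer_space G. y j \<in> {c}} \<longleftrightarrow> \<psi> y \<in> E c"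
      have "y j \<in> ?R" using y P(2) odometer_spaceD(1) by auto
      then have "{c \<in> ?R. \<psi> y \<in> E c} = {y j}" using * y P(2) by auto
      then show "f (\<psi> y) = y j" by (simp add: f_def Let_def)
    qed
  qed
  have "AE x in M. f (T v x) = f x #>\<^bsub>Zd\<^esub> v" for v
  proof -
    have "AE y in \<nu>. f (\<psi> (odometer_shift v y)) = odometer_shift v y j"
      using AE_distrD[OF odometer_haar_shift_invariant(1)[OF G \<nu>, of v],
          of "\<lambda>y. f (\<psi> y) = y j", unfolded odometer_haar_shift_invariant(2)[OF G \<nu>], OF fpsi] .
    then have ae: "AE y in \<nu>. f (T v (\<psi> y)) = f (\<psi> y) #>\<^bsub>Zd\<^esub> v"
      using fpsi \<psi>e[of v] by eventually_elim (auto simp: odometer_shift_def)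
    have fR: "x \<in> space M \<Longrightarrow> f x \<in> ?R" for x using measurable_space[OF fm] by simp
    have "{x \<in> space M. \<exists>c\<in>?R. f x = c \<and> f (T v x) = c #>\<^bsub>Zd\<^esub> v} \<in> sets M"
    proof (rule sets.sets_Collect_finite_Ex[OF _ fin])
      fix c assume c: "c \<in> ?R"
      have "f -` {c} \<inter> space M \<in> sets M" by (rule measurable_sets[OF fm]) (use c in simp)
      moreover have "(\<lambda>x. f (T v x)) -` {c #>\<^bsub>Zd\<^esub> v} \<inter> space M \<in> sets M"
        by (rule measurable_sets[OF measurable_compose[OF T_measurable fm]])
          (use c Zd_coset_shift_in_rcosets in simp)
      moreover have "{x \<in> space M. f x = c \<and> f (T v x) = c #>\<^bsub>Zd\<^esub> v} =
        (f -` {c} \<inter> space M) \<inter> ((\<lambda>x. f (T v x)) -` {c #>\<^bsub>Zd\<^esub> v} \<inter> space M)" by auto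
      ultimately show "{x \<in> space M. f x = c \<and> f (T v x) = c #>\<^bsub>Zd\<^esub> v} \<in> sets M" by simp
    qed
    also have "{x \<in> space M. \<exists>c\<in>?R. f x = c \<and> f (T v x) = c #>\<^bsub>Zd\<^esub> v} =
        {x \<in> space M. f (T v x) = f x #>\<^bsub>Zd\<^esub> v}" using fR by auto
    finally have "(AE x in distr \<nu> M \<psi>. f (T v x) = f x #>\<^bsub>Zd\<^esub> v) \<longleftrightarrow>
        (AE y in \<nu>. f (T v (\<psi> y)) = f (\<psi> y) #>\<^bsub>Zd\<^esub> v)"
      by (rule AE_distr_iff[OF \<psi>m])
    then show ?thesis using ae unfolding \<psi>d by blast
  qed
  then show ?thesis using fm fpsi unfolding coset_label_def by blast
qed

lemma conjugacy_from_odometer_label: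
  assumes G: "odometer_data G" and \<nu>: "odometer_haar G \<nu>"
    and \<psi>: "factor_map \<nu> odometer_shift M T \<psi>" "ae_injective \<nu> \<psi>"
    and A: "A \<in> sets M" and e: "e > 0"
  shows "\<exists>H f D. finite_index_subgroup H \<and> coset_label H f \<and>
    measure M (sym_diff A {x \<in> space M. f x \<in> D}) < e"
proof -
  note P = odometer_haar_props[OF \<nu>]
  have \<psi>m: "\<psi> \<in> \<nu> \<rightarrow>\<^sub>M M" and \<psi>d: "distr \<nu> M \<psi> = M" using \<psi>(1) by (auto simp: factor_map_def)
  have A': "\<psi> -` A \<inter> space \<nu> \<in> sets \<nu>" by (rule measurable_sets[OF \<psi>m A])
  obtain j D where jD: "measure \<nu> (sym_diff (\<psi> -` A \<inter> space \<nu>) {y \<in> odometer_space G. y j \<in> D}) < e"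
    using odometer_cylinder_approximation[OF G P(1) P(3) A' e] by (elim exE) (rule that)
  obtain f where f: "coset_label (G j) f" "AE y in \<nu>. f (\<psi> y) = y j"
    using odometer_coordinate_descends[OF G \<nu> \<psi>, of j] by (elim exE conjE) (rule that)
  let ?S = "sym_diff A {x \<in> space M. f x \<in> D}"
  have S: "?S \<in> sets M" using A coset_labelD(2)[OF f(1)] by auto
  have "measure M ?S = measure \<nu> (\<psi> -` ?S \<inter> space \<nu>)"
    using measure_distr[OF \<psi>m S] by (simp only: \<psi>d)
  also have "\<dots> = measure \<nu> (sym_diff (\<psi> -` A \<inter> space \<nu>) {y \<in> odometer_space G. y j \<in> D})"
  proof (rule measure_eq_AE)
    show "AE y in \<nu>. y \<in> \<psi> -` ?S \<inter> space \<nu> \<longleftrightarrow>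
        y \<in> sym_diff (\<psi> -` A \<inter> space \<nu>) {y \<in> odometer_space G. y j \<in> D}"
      using f(2) AE_space
      by eventually_elim (use measurable_space[OF \<psi>m] in \<open>auto simp: P(2)\<close>)
    show "\<psi> -` ?S \<inter> space \<nu> \<in> sets \<nu>" by (rule measurable_sets[OF \<psi>m S])
    show "sym_diff (\<psi> -` A \<inter> space \<nu>) {y \<in> odometer_space G. y j \<in> D} \<in> sets \<nu>"
      using A' odometer_cylinder_in_sets[of G j D] P(1) by auto
  qed
  finally have "measure M ?S < e" using jD by simp
  moreover have "finite_index_subgroup (G j)" using G by (simp add: odometer_data_def)
  ultimately show ?thesis using f(1)
    by (intro exI[of _ "G j"] exI[of _ f] exI[of _ D] conjI)
qed

lemma descendants_condition_if_odometer:
  assumes "conjugate_to_infinite_odometer M T" and \<epsilon>: "\<epsilon> > 0"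
  shows "\<exists>G. finite_index_subgroup G \<and> descendants_traced G l \<epsilon> \<and> descendants_concentrate G"
proof -
  obtain G \<nu> where G: "odometer_data G" "odometer_haar G \<nu>" and c: "conjugate M T \<nu> odometer_shift"
    using assms(1) unfolding conjugate_to_infinite_odometer_def by (elim exE conjE) (rule that)
  have e: "\<epsilon> / 2 * measure M (B l) > 0" using \<epsilon> base_pos by simp
  have "\<exists>H f D. finite_index_subgroup H \<and> coset_label H f \<and>
    measure M (sym_diff (B l) {x \<in> space M. f x \<in> D}) < \<epsilon> / 2 * measure M (B l)" (is ?label)
    using c unfolding conjugate_def
  proof (elim disjE exE conjE)
    fix \<phi> assume "factor_map M T \<nu> odometer_shift \<phi>" "ae_injective M \<phi>"
    then show ?label by (rule conjugacy_to_odometer_label[OF G _ _ base_in_sets e])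
  next
    fix \<psi> assume "factor_map \<nu> odometer_shift M T \<psi>" "ae_injective \<nu> \<psi>"
    then show ?label by (rule conjugacy_from_odometer_label[OF G _ _ base_in_sets e])
  qed
  then obtain H f D where H: "finite_index_subgroup H" "coset_label H f"
    "measure M (sym_diff (B l) {x \<in> space M. f x \<in> D}) < \<epsilon> / 2 * measure M (B l)"
    by (elim exE conjE) (rule that)
  show ?thesis
    by (intro exI[of _ H] conjI H(1) label_imp_descendants_traced[OF H] label_imp_descendants_concentrate[OF H(1,2)])
qed

end

section \<open>The odometer read off from the towers\<close>

text \<open>The data chosen in the proof that the counting conditions suffice. The vectors \<open>h k\<close> accumulate the
majority cosets of condition (b): most descendants of tower \<open>m k\<close> in tower \<open>m (Suc k)\<close> have
indices congruent to \<open>h (Suc k) - h k\<close> modulo \<open>G k\<close>. The errors are at most \<open>(1/2)^k\<close> so that they are summable.\<close>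

locale odometer_construction = stacking_towers M T F B
  for M :: "'a measure" and T :: "int ^ 'd \<Rightarrow> 'a \<Rightarrow> 'a"
    and F :: "nat \<Rightarrow> (int ^ 'd) set" and B :: "nat \<Rightarrow> 'a set" +
  fixes G :: "nat \<Rightarrow> (int ^ 'd) set" and m :: "nat \<Rightarrow> nat" and h :: "nat \<Rightarrow> int ^ 'd"
  assumes G: "odometer_data G"
    and m_mono: "strict_mono m"
    and err_small: "\<And>k. measure M (err (m k)) \<le> (1/2)^k"
    and boundary_small: "\<And>k. (\<Sum>i\<in>F (m k). card (boundary (m (Suc k)) i) * measure M (B (m (Suc k)))) \<le> (1/2)^k"
    and concentrated: "\<And>k. card {i \<in> desc (m k) (m (Suc k)). i - (h (Suc k) - h k) \<notin> G k}
        \<le> (1/2)^k * card (desc (m k) (m (Suc k)))"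
    and traced: "\<And>l \<epsilon>. \<epsilon> > 0 \<Longrightarrow> \<exists>j. descendants_traced (G j) l \<epsilon>"
begin

text \<open>Specified only off the error set of tower \<open>n\<close>.\<close>

definition pos :: "nat \<Rightarrow> 'a \<Rightarrow> int ^ 'd" where
  "pos n x = (THE i. i \<in> F n \<and> x \<in> T i ` B n)"

lemma pos_eq: "i \<in> F n \<Longrightarrow> x \<in> T i ` B n \<Longrightarrow> pos n x = i"
  unfolding pos_def by (intro the_equality conjI) (auto dest: level_unique)

lemma pos_level:
  assumes "x \<in> space M" "x \<notin> err n"
  shows "pos n x \<in> F n" "x \<in> T (pos n x) ` B n"
proof -
  obtain i where "i \<in> F n" "x \<in> T i ` B n" using assms unfolding err_eq by blast
  then show "pos n x \<in> F n" "x \<in> T (pos n x) ` B n" using pos_eq by auto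
qed

lemma measurable_pos: "pos n \<in> M \<rightarrow>\<^sub>M count_space UNIV"
proof -
  have "(\<lambda>x. THE i. i \<in> F n \<and> x \<in> T i ` B n) \<in> M \<rightarrow>\<^sub>M count_space UNIV"
  proof (rule measurable_THE)
    show "Measurable.pred M (\<lambda>x. i \<in> F n \<and> x \<in> T i ` B n)" for i
    proof -
      have "{x \<in> space M. i \<in> F n \<and> x \<in> T i ` B n} = (if i \<in> F n then T i ` B n else {})"
        using sets.sets_into_space[OF level_in_sets[of i n]] by auto
      then show ?thesis using level_in_sets[of i n] by (simp add: pred_def)
    qed
    show "countable (UNIV :: (int ^ 'd) set)" by simp
  qed (auto dest: level_unique)
  then show ?thesis by (simp add: pos_def[abs_def])
qed

text \<open>The normalised index of a point in tower \<open>m k\<close>, which will be shown to converge in the odometer.\<close>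

definition p :: "nat \<Rightarrow> 'a \<Rightarrow> int ^ 'd" where "p k x = pos (m k) x - h k"

definition misplaced :: "nat \<Rightarrow> (int ^ 'd) set" where
  "misplaced k = {i \<in> desc (m k) (m (Suc k)). i - (h (Suc k) - h k) \<notin> G k}"

text \<open>The points at which the normalised index may change modulo \<open>G k\<close> at step \<open>k\<close>. A point of the level with
index \<open>i\<close> of tower \<open>m k\<close> lies in \<open>T (i + i') ` B (m (Suc k))\<close> for a descendant index \<open>i'\<close>. Either \<open>i'\<close> is
in the wrong coset, or \<open>i + i'\<close> is not an index of the next tower, or the index grows by \<open>i'\<close>, which is
congruent to \<open>h (Suc k) - h k\<close> modulo \<open>G k\<close>.\<close>

definition jump :: "nat \<Rightarrow> 'a set" where
  "jump k = err (m k) \<union> (\<Union>i\<in>F (m k). T i ` levels (m (Suc k)) (misplaced k))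
     \<union> (\<Union>i\<in>F (m k). T i ` levels (m (Suc k)) (boundary (m (Suc k)) i))"

lemma jump_in_sets: "jump k \<in> sets M"
  unfolding jump_def
  by (intro sets.Un err_in_sets sets.finite_UN shape_finite T_image_in_sets levels_in_sets)

lemma measure_jump: "measure M (jump k) \<le> 3 * (1/2)^k"
proof -
  let ?n = "m (Suc k)"
  have mk: "m k \<le> ?n" using m_mono by (simp add: strict_mono_less_eq)
  let ?U = "\<Union>i\<in>F (m k). T i ` levels ?n (misplaced k)"
  let ?V = "\<Union>i\<in>F (m k). T i ` levels ?n (boundary ?n i)"
  have s: "?U \<in> sets M" "?V \<in> sets M"
    by (intro sets.finite_UN shape_finite T_image_in_sets levels_in_sets)+
  have "measure M ?U \<le> (\<Sum>i\<in>F (m k). measure M (T i ` levels ?n (misplaced k)))"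
    by (intro finite_measure_subadditive_finite shape_finite) (auto intro!: T_image_in_sets levels_in_sets)
  also have "\<dots> = card (F (m k)) * (card (misplaced k) * measure M (B ?n))"
    using measure_levels[of "misplaced k" ?n] desc_subset
    by (auto simp: measure_T_image[OF levels_in_sets] misplaced_def)
  also have "\<dots> \<le> card (F (m k)) * (((1/2)^k * card (desc (m k) ?n)) * measure M (B ?n))"
    using concentrated[of k] by (intro mult_left_mono mult_right_mono) (auto simp: misplaced_def)
  also have "\<dots> = (1/2)^k * (card (F (m k)) * measure M (B (m k)))"
    using measure_base_desc[OF mk] by simp
  also have "\<dots> \<le> (1/2)^k * 1" using shape_mass_le by (intro mult_left_mono) auto
  finally have U: "measure M ?U \<le> (1/2)^k" by simp
  have "measure M ?V \<le> (\<Sum>i\<in>F (m k). measure M (T i ` levels ?n (boundary ?n i)))"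
    by (intro finite_measure_subadditive_finite shape_finite) (auto intro!: T_image_in_sets levels_in_sets)
  also have "\<dots> = (\<Sum>i\<in>F (m k). card (boundary ?n i) * measure M (B ?n))"
    using measure_levels by (intro sum.cong) (auto simp: measure_T_image[OF levels_in_sets] boundary_def)
  also have "\<dots> \<le> (1/2)^k" by (rule boundary_small)
  finally have V: "measure M ?V \<le> (1/2)^k" .
  have "measure M (jump k) \<le> measure M (err (m k) \<union> ?U) + measure M ?V"
    unfolding jump_def using err_in_sets s by (intro measure_Un_le sets.Un)
  also have "measure M (err (m k) \<union> ?U) \<le> measure M (err (m k)) + measure M ?U"
    using err_in_sets s by (intro measure_Un_le)
  finally show ?thesis using U V err_small[of k] by linarith
qed

lemma p_step:
  assumes x: "x \<in> space M" "x \<notin> jump k"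
  shows "p (Suc k) x - p k x \<in> G k"
proof -
  let ?n = "m (Suc k)"
  define i where "i = pos (m k) x"
  have mk: "m k \<le> ?n" using m_mono by (simp add: strict_mono_less_eq)
  have "x \<notin> err (m k)" using x by (auto simp: jump_def)
  then have i: "i \<in> F (m k)" "x \<in> T i ` B (m k)" using pos_level x by (auto simp: i_def)
  then obtain y where y: "y \<in> B (m k)" "x = T i y" by blast
  then obtain i' where i': "i' \<in> desc (m k) ?n" "y \<in> T i' ` B ?n"
    using desc_decomposition(1)[OF mk] by blast
  have i'F: "i' \<in> F ?n" using i'(1) desc_subset by blast
  have "i' \<notin> misplaced k" using x(2) i(1) y(2) i'(2) unfolding jump_def by blast
  moreover have "i' \<notin> boundary ?n i" using x(2) i(1) y(2) i'(2) unfolding jump_def by blast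
  ultimately have *: "i' - (h (Suc k) - h k) \<in> G k" "i' + i \<in> F ?n"
    using i'(1) i'F by (auto simp: misplaced_def boundary_def)
  have "x \<in> T (i' + i) ` B ?n"
    using i'(2) y(2) T_image_image[OF base_subset_space, of i i' ?n] by (auto simp: add.commute)
  then have "pos ?n x = i' + i" by (rule pos_eq[OF *(2)])
  then have "p (Suc k) x - p k x = i' - (h (Suc k) - h k)"
    unfolding p_def i_def[symmetric] by simp
  then show ?thesis using *(1) by (simp only:)
qed

lemma p_stable:
  assumes x: "x \<in> space M" "\<And>k'. k' \<ge> k \<Longrightarrow> x \<notin> jump k'" and "j \<le> k" "k \<le> k'"
  shows "p k' x - p k x \<in> G j"
  using \<open>k \<le> k'\<close>
proof (induction k' rule: dec_induct)
  case base
  then show ?case using odometer_data_subgroup(1)[OF G, of j] by (simp add: Zd_subgroup_iff)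
next
  case (step n)
  have "p (Suc n) x - p n x \<in> G n" using p_step x step by auto
  moreover have "G n \<subseteq> G j" using G step \<open>j \<le> k\<close> by (auto simp: odometer_data_def decseq_def)
  ultimately have "(p (Suc n) x - p n x) + (p n x - p k x) \<in> G j"
    using step.IH odometer_data_subgroup(1)[OF G, of j] unfolding Zd_subgroup_iff by blast
  then show ?case by simp
qed

definition tail_jump :: "nat \<Rightarrow> 'a set" where "tail_jump k = (\<Union>k'\<in>{k..}. jump k')"

definition stable_points :: "'a set" where "stable_points = space M - (\<Inter>k. tail_jump k)"

lemma tail_jump_in_sets: "tail_jump k \<in> sets M"
  unfolding tail_jump_def using jump_in_sets by (intro sets.countable_UN') auto

lemma stable_points_in_sets: "stable_points \<in> sets M"
  unfolding stable_points_def using tail_jump_in_sets by auto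

lemma AE_stable: "AE x in M. x \<in> stable_points"
proof -
  have "AE x in M. eventually (\<lambda>k. x \<in> space M - jump k) sequentially"
  proof (rule borel_cantelli_AE1)
    show "summable (\<lambda>k. measure M (jump k))"
      by (rule summable_comparison_test'[of "\<lambda>k. 3 * (1/2)^k :: real" 0])
        (use measure_jump in \<open>auto intro!: summable_mult\<close>)
  qed (use jump_in_sets in \<open>auto simp: less_top[symmetric]\<close>)
  then show ?thesis
    by eventually_elim (auto simp: stable_points_def tail_jump_def eventually_sequentially)
qed

lemma tail_jump_tendsto_0: "(\<lambda>k. measure M (tail_jump k)) \<longlonglongrightarrow> 0"
proof -
  have "(\<lambda>k. measure M (tail_jump k)) \<longlonglongrightarrow> measure M (\<Inter>k. tail_jump k)"
    using tail_jump_in_sets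
    by (intro finite_Lim_measure_decseq) (force simp: decseq_def tail_jump_def)+
  also have "measure M (\<Inter>k. tail_jump k) = measure M {}"
    by (rule measure_eq_AE)
      (use AE_stable tail_jump_in_sets in \<open>auto simp: stable_points_def elim!: eventually_mono\<close>)
  finally show ?thesis by simp
qed

text \<open>The limit of the normalised indices, as a coset for each \<open>j\<close>. On the null set where there is no limit the
value is the neutral element of the odometer.\<close>

definition phi :: "'a \<Rightarrow> nat \<Rightarrow> (int ^ 'd) set" where
  "phi x = (\<lambda>j. if x \<in> stable_points then {v. \<forall>\<^sub>F k in sequentially. v - p k x \<in> G j} else G j)"

lemma phi_eq:
  assumes x: "x \<in> space M" "x \<notin> tail_jump k" and j: "j \<le> k"
  shows "phi x j = G j #>\<^bsub>Zd\<^esub> p k x"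
proof -
  have good: "\<And>k'. k' \<ge> k \<Longrightarrow> x \<notin> jump k'" using x(2) by (auto simp: tail_jump_def)
  have sub: "subgroup (G j) Zd" by (rule odometer_data_subgroup(1)[OF G])
  have st: "x \<in> stable_points" using x by (auto simp: stable_points_def)
  have same: "v - p k' x \<in> G j \<longleftrightarrow> v - p k x \<in> G j" if k': "k' \<ge> k" for v k'
  proof -
    have d: "p k' x - p k x \<in> G j" by (rule p_stable[OF x(1) good j k'])
    have "v - p k x = (v - p k' x) + (p k' x - p k x)" "v - p k' x = (v - p k x) - (p k' x - p k x)"
      by simp_all
    then show ?thesis using d sub Zd_subgroup_diff[OF sub] unfolding Zd_subgroup_iff by metis
  qed
  have ev: "(\<forall>\<^sub>F k' in sequentially. v - p k' x \<in> G j) \<longleftrightarrow> v - p k x \<in> G j" for v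
  proof
    assume "\<forall>\<^sub>F k' in sequentially. v - p k' x \<in> G j"
    then obtain N where "\<And>k'. k' \<ge> N \<Longrightarrow> v - p k' x \<in> G j" by (auto simp: eventually_sequentially)
    then have "v - p (max N k) x \<in> G j" by simp
    then show "v - p k x \<in> G j" using same[of "max N k" v] by simp
  next
    assume "v - p k x \<in> G j"
    then show "\<forall>\<^sub>F k' in sequentially. v - p k' x \<in> G j"
      unfolding eventually_sequentially using same by blast
  qed
  have "phi x j = {v. v - p k x \<in> G j}"
    unfolding phi_def if_P[OF st] ev by (rule refl)
  also have "\<dots> = G j #>\<^bsub>Zd\<^esub> p k x"
    unfolding set_eq_iff mem_Zd_coset_iff by simp
  finally show ?thesis .
qed

lemma stable_pointsE:
  assumes "x \<in> stable_points"
  obtains k where "j \<le> k" "x \<in> space M" "x \<notin> tail_jump k"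
proof -
  obtain k where k: "x \<in> space M" "x \<notin> tail_jump k" using assms by (auto simp: stable_points_def)
  then have "x \<notin> tail_jump (max j k)" by (auto simp: tail_jump_def)
  then show thesis using that[of "max j k"] k by simp
qed

lemma phi_in_space: "phi x \<in> odometer_space G"
proof (cases "x \<in> stable_points")
  case True
  have "phi x j \<in> rcosets\<^bsub>Zd\<^esub> (G j) \<and> quotient_map (G j) (phi x (Suc j)) = phi x j" for j
  proof -
    obtain k where k: "Suc j \<le> k" "x \<in> space M" "x \<notin> tail_jump k" by (rule stable_pointsE[OF True])
    then show ?thesis
      using phi_eq[OF k(2,3), of j] phi_eq[OF k(2,3), of "Suc j"] G
      by (simp add: Zd_coset_in_rcosets quotient_map_coset odometer_data_subgroup odometer_data_def decseq_Suc_iff)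
  qed
  then show ?thesis by (simp add: odometer_space_def)
next
  case False
  then have "phi x = (\<lambda>j. G j #>\<^bsub>Zd\<^esub> 0)" by (simp add: phi_def Zd_coset_0)
  then show ?thesis using odometer_base_point[OF G, of 0] by (simp only:)
qed

lemma measurable_phi: "phi \<in> M \<rightarrow>\<^sub>M odometer_borel G"
proof (rule measurable_into_odometer)
  fix j
  have sub: "subgroup (G j) Zd" by (rule odometer_data_subgroup(1)[OF G])
  show "(\<lambda>x. phi x j) \<in> M \<rightarrow>\<^sub>M count_space (rcosets\<^bsub>Zd\<^esub> (G j))"
  proof (subst measurable_count_space_eq2[OF odometer_data_subgroup(2)[OF G]], intro conjI ballI)
    show "(\<lambda>x. phi x j) \<in> space M \<rightarrow> rcosets\<^bsub>Zd\<^esub> (G j)"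
      by (intro funcsetI odometer_spaceD(1) phi_in_space)
    fix c assume c: "c \<in> rcosets\<^bsub>Zd\<^esub> (G j)"
    then obtain v where v: "c = G j #>\<^bsub>Zd\<^esub> v" by (auto simp: Zd_rcosets)
    have ev: "{x \<in> space M. \<forall>\<^sub>F k in sequentially. v - p k x \<in> G j} \<in> sets M"
    proof -
      have *: "{x \<in> space M. v - p k x \<in> G j} \<in> sets M" for k
      proof -
        have "pos (m k) -` {i. v - (i - h k) \<in> G j} \<inter> space M \<in> sets M"
          by (rule measurable_sets[OF measurable_pos]) simp
        moreover have "pos (m k) -` {i. v - (i - h k) \<in> G j} \<inter> space M = {x \<in> space M. v - p k x \<in> G j}"
          by (auto simp: p_def)
        ultimately show ?thesis by simp
      qed
      show ?thesis
        unfolding eventually_sequentially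
        by (intro sets.sets_Collect_countable_Ex sets.sets_Collect_countable_All sets.sets_Collect_imp
            sets.sets_Collect_const *)
    qed
    have mem: "phi x j = c \<longleftrightarrow> v \<in> phi x j" for x
      unfolding v by (rule Zd_rcosets_eq_iff[OF sub odometer_spaceD(1)[OF phi_in_space]])
    have "(\<lambda>x. phi x j) -` {c} \<inter> space M = {x \<in> space M. v \<in> phi x j}"
      by (intro equalityI subsetI) (simp_all only: vimage_eq Int_iff singleton_iff mem mem_Collect_eq)
    also have "\<dots> = (stable_points \<inter> {x \<in> space M. \<forall>\<^sub>F k in sequentially. v - p k x \<in> G j})
        \<union> (if v \<in> G j then space M - stable_points else {})"
      using sets.sets_into_space[OF stable_points_in_sets] by (auto simp: phi_def)
    also have "\<dots> \<in> sets M"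
      using ev stable_points_in_sets by auto
    finally show "(\<lambda>x. phi x j) -` {c} \<inter> space M \<in> sets M" .
  qed
qed (rule phi_in_space)

text \<open>Infinitely many towers are enough, because the limit defining \<open>phi\<close> exists. So it suffices that the
measure of the exceptional sets tends to zero, with no summability for the given \<open>v\<close>.\<close>

lemma pos_equivariant_frequently:
  "AE x in M. \<exists>\<^sub>F k in sequentially. pos (m k) (T v x) = pos (m k) x + v"
proof -
  define W where "W = (\<lambda>k. err (m k) \<union> levels (m k) (boundary (m k) v))"
  have Ws: "W k \<in> sets M" for k unfolding W_def by (intro sets.Un err_in_sets levels_in_sets)
  have good: "pos (m k) (T v x) = pos (m k) x + v" if x: "x \<in> space M" "x \<notin> W k" for x k
  proof -
    let ?i = "pos (m k) x"
    have i: "?i \<in> F (m k)" "x \<in> T ?i ` B (m k)" using pos_level x by (auto simp: W_def)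
    then have "?i \<notin> boundary (m k) v" using x(2) unfolding W_def by blast
    then have "?i + v \<in> F (m k)" using i(1) by (simp add: boundary_def)
    moreover have "T v x \<in> T (v + ?i) ` B (m k)"
      using i(2) T_image_image[OF base_subset_space, of v ?i "m k"] by blast
    ultimately show ?thesis by (intro pos_eq) (simp_all add: add.commute)
  qed
  have "(\<lambda>k. measure M (W k)) \<longlonglongrightarrow> 0"
  proof (rule tendsto_sandwich[OF _ _ tendsto_const])
    have "(\<lambda>n. measure M (err n) + card (boundary n v) * measure M (B n)) \<longlonglongrightarrow> 0 + 0"
      by (intro tendsto_add err_tendsto_0 boundary_mass_tendsto_0)
    from LIMSEQ_subseq_LIMSEQ[OF this m_mono]
    show "(\<lambda>k. measure M (err (m k)) + card (boundary (m k) v) * measure M (B (m k))) \<longlonglongrightarrow> 0"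
      by (simp add: o_def)
    have "measure M (W k) \<le> measure M (err (m k)) + card (boundary (m k) v) * measure M (B (m k))" for k
    proof -
      have "measure M (W k) \<le> measure M (err (m k)) + measure M (levels (m k) (boundary (m k) v))"
        unfolding W_def by (intro measure_Un_le err_in_sets levels_in_sets)
      then show ?thesis using measure_levels[of "boundary (m k) v" "m k"] by (auto simp: boundary_def)
    qed
    then show "\<forall>\<^sub>F k in sequentially. measure M (W k) \<le>
        measure M (err (m k)) + card (boundary (m k) v) * measure M (B (m k))" by simp
  qed simp
  then have W0: "(\<lambda>k. measure M (W k)) \<longlonglongrightarrow> 0" .
  have "AE x in M. x \<notin> (\<Inter>k\<in>{K..}. W k)" for K
  proof -
    have s: "(\<Inter>k\<in>{K..}. W k) \<in> sets M" using Ws by (intro sets.countable_INT') auto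
    have "measure M (\<Inter>k\<in>{K..}. W k) \<le> 0"
    proof (rule LIMSEQ_le_const[OF W0], intro exI[of _ K] allI impI)
      fix k assume "K \<le> k"
      then show "measure M (\<Inter>k\<in>{K..}. W k) \<le> measure M (W k)"
        using Ws by (intro finite_measure_mono) auto
    qed
    then have "measure M (\<Inter>k\<in>{K..}. W k) = 0" using measure_nonneg by (rule antisym)
    then show ?thesis
      using s by (intro AE_not_in null_setsI) (simp_all add: emeasure_eq_measure)
  qed
  then have "AE x in M. \<forall>K. x \<notin> (\<Inter>k\<in>{K..}. W k)" by (simp only: AE_all_countable) simp
  then show ?thesis
  proof (rule AE_mp, intro AE_I2 impI)
    fix x assume x: "x \<in> space M" and *: "\<forall>K. x \<notin> (\<Inter>k\<in>{K..}. W k)"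
    have "\<exists>k\<ge>K. x \<notin> W k" for K using spec[OF *, of K] by auto
    then show "\<exists>\<^sub>F k in sequentially. pos (m k) (T v x) = pos (m k) x + v"
      unfolding frequently_sequentially using good[OF x] by blast
  qed
qed

lemma phi_equivariant: "AE x in M. phi (T v x) = odometer_shift v (phi x)"
  using AE_stable AE_translate[OF AE_stable, of v] pos_equivariant_frequently[of v]
proof eventually_elim
  case (elim x)
  show ?case
  proof
    fix j
    obtain k where k: "j \<le> k" "x \<in> space M" "x \<notin> tail_jump k" by (rule stable_pointsE[OF elim(1)])
    obtain k' where k': "j \<le> k'" "T v x \<in> space M" "T v x \<notin> tail_jump k'" by (rule stable_pointsE[OF elim(2)])
    from elim(3) obtain n where n: "n \<ge> max k k'" "pos (m n) (T v x) = pos (m n) x + v"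
      unfolding frequently_sequentially by blast
    have "x \<notin> tail_jump n" "T v x \<notin> tail_jump n" using k(3) k'(3) n(1) by (auto simp: tail_jump_def)
    then have "phi x j = G j #>\<^bsub>Zd\<^esub> p n x" "phi (T v x) j = G j #>\<^bsub>Zd\<^esub> p n (T v x)"
      using phi_eq[OF k(2), of n j] phi_eq[OF k'(2), of n j] k(1) n(1) by auto
    then show "phi (T v x) j = odometer_shift v (phi x) j"
      using n(2) by (simp add: odometer_shift_def Zd_coset_coset p_def algebra_simps)
  qed
qed

end

context odometer_construction
begin

text \<open>By condition (a) the base is nearly the union of the levels of tower \<open>m k\<close> with indices in certain cosets. Outside
the tail of jumps the coset of the index is the coordinate of \<open>phi\<close> shifted by \<open>h k\<close>.\<close>

lemma base_approximable:
  assumes e: "e > 0"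
  shows "\<exists>j D. measure M (sym_diff (B l) {x \<in> space M. phi x j \<in> D}) < e"
proof -
  have "e / 2 > 0" using e by simp
  then obtain j where "descendants_traced (G j) l (e/2)" using traced by blast
  then obtain N where N: "\<And>n. n \<ge> N \<Longrightarrow> n \<ge> l \<Longrightarrow>
      \<exists>D \<subseteq> rcosets\<^bsub>Zd\<^esub> (G j).
        real (card (sym_diff (desc l n) {i \<in> F n. G j #>\<^bsub>Zd\<^esub> i \<in> D})) / real (card (desc l n)) < e/2"
    unfolding descendants_traced_def by blast
  have "\<forall>\<^sub>F k in sequentially. measure M (tail_jump k) < e/2"
    using order_tendstoD(2)[OF tail_jump_tendsto_0 \<open>e / 2 > 0\<close>] .
  then obtain K where K: "\<And>k. k \<ge> K \<Longrightarrow> measure M (tail_jump k) < e/2"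
    by (auto simp: eventually_sequentially)
  define k where "k = Max {K, N, l, j}"
  have k: "k \<ge> K" "k \<ge> N" "k \<ge> l" "k \<ge> j" by (auto simp: k_def)
  have mk: "m k \<ge> N" "m k \<ge> l" using seq_suble[OF m_mono, of k] k by auto
  obtain D where D: "real (card (sym_diff (desc l (m k)) {i \<in> F (m k). G j #>\<^bsub>Zd\<^esub> i \<in> D}))
      / real (card (desc l (m k))) < e/2" using N[OF mk] by blast
  let ?S = "{i \<in> F (m k). G j #>\<^bsub>Zd\<^esub> i \<in> D}"
  let ?J = "sym_diff (desc l (m k)) ?S"
  let ?L = "levels (m k) ?S"
  let ?C = "{x \<in> space M. phi x j \<in> {c. c #>\<^bsub>Zd\<^esub> h k \<in> D}}"
  have C: "?C \<in> sets M"
  proof -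
    have "phi -` {y \<in> odometer_space G. y j \<in> {c. c #>\<^bsub>Zd\<^esub> h k \<in> D}} \<inter> space M \<in> sets M"
      by (rule measurable_sets[OF measurable_phi odometer_cylinder_in_sets])
    moreover have "phi -` {y \<in> odometer_space G. y j \<in> {c. c #>\<^bsub>Zd\<^esub> h k \<in> D}} \<inter> space M = ?C"
      using phi_in_space by blast
    ultimately show ?thesis by (simp only:)
  qed
  have "measure M (sym_diff (B l) ?L) \<le> measure M (levels (m k) ?J)"
  proof (rule finite_measure_mono[OF _ levels_in_sets])
    show "sym_diff (B l) ?L \<subseteq> levels (m k) ?J"
      unfolding desc_decomposition(1)[OF mk(2)] by blast
  qed
  also have "\<dots> = card ?J * measure M (B (m k))"
    using desc_subset by (intro measure_levels) blast
  also have "\<dots> < (e/2 * card (desc l (m k))) * measure M (B (m k))"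
  proof (rule mult_strict_right_mono[OF _ base_pos])
    show "real (card ?J) < e/2 * card (desc l (m k))"
      using D card_desc_pos[OF mk(2)] by (simp add: divide_less_eq)
  qed
  also have "\<dots> = e/2 * measure M (B l)" using measure_base_desc[OF mk(2)] by simp
  also have "\<dots> \<le> e/2 * 1"
    using e bounded_measure[of "B l"] by (intro mult_left_mono) (auto simp: measure_space_1)
  finally have 1: "measure M (sym_diff (B l) ?L) < e/2" by simp
  have "sym_diff ?L ?C \<subseteq> tail_jump k"
  proof
    fix x assume x: "x \<in> sym_diff ?L ?C"
    show "x \<in> tail_jump k"
    proof (rule ccontr)
      assume nt: "x \<notin> tail_jump k"
      have xs: "x \<in> space M"
        using x sets.sets_into_space[OF levels_in_sets[of "m k" ?S]] by blast
      have "x \<notin> err (m k)" using nt by (auto simp: tail_jump_def jump_def)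
      then have pos: "pos (m k) x \<in> F (m k)" "x \<in> T (pos (m k) x) ` B (m k)" using pos_level xs by auto
      have "x \<in> ?L \<longleftrightarrow> pos (m k) x \<in> ?S"
      proof
        assume "x \<in> ?L"
        then obtain i where "i \<in> ?S" "x \<in> T i ` B (m k)" by blast
        then show "pos (m k) x \<in> ?S" using pos_eq[of i "m k" x] by simp
      next
        assume "pos (m k) x \<in> ?S"
        then show "x \<in> ?L" using pos(2) by blast
      qed
      moreover have "phi x j #>\<^bsub>Zd\<^esub> h k = G j #>\<^bsub>Zd\<^esub> pos (m k) x"
        unfolding phi_eq[OF xs nt k(4)] Zd_coset_coset by (simp add: p_def)
      then have "x \<in> ?C \<longleftrightarrow> G j #>\<^bsub>Zd\<^esub> pos (m k) x \<in> D" using xs by simp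
      ultimately show False using x pos(1) by blast
    qed
  qed
  then have 2: "measure M (sym_diff ?L ?C) < e/2"
    using K[OF k(1)] finite_measure_mono[OF _ tail_jump_in_sets] by (meson le_less_trans)
  have "measure M (sym_diff (B l) ?C) < e"
    using measure_sym_diff_triangle[OF base_in_sets levels_in_sets C, of l "m k" ?S] 1 2 by linarith
  then show ?thesis by (intro exI)
qed

text \<open>Membership in the sigma-algebra generated by \<open>phi\<close>, up to a null set.\<close>

definition captured :: "'a set \<Rightarrow> bool" where
  "captured A \<longleftrightarrow> (\<exists>C\<in>sets (odometer_borel G). AE x in M. x \<in> A \<longleftrightarrow> phi x \<in> C)"

lemma captured_base: "captured (B l)"
  unfolding captured_def
proof (rule measurable_modulo_null_if_approximable[OF base_in_sets measurable_phi])
  fix e :: real assume "e > 0"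
  then obtain j D where jD: "measure M (sym_diff (B l) {x \<in> space M. phi x j \<in> D}) < e"
    using base_approximable by blast
  have eq: "phi -` {y \<in> odometer_space G. y j \<in> D} \<inter> space M = {x \<in> space M. phi x j \<in> D}"
    using phi_in_space by blast
  show "\<exists>C\<in>sets (odometer_borel G). measure M (sym_diff (B l) (phi -` C \<inter> space M)) < e"
    by (rule bexI[OF _ odometer_cylinder_in_sets[of G j D]]) (use jD in \<open>simp only: eq\<close>)
qed

lemma captured_translate:
  assumes A: "A \<in> sets M" "captured A"
  shows "captured (T v ` A)"
proof -
  obtain C where C: "C \<in> sets (odometer_borel G)" and ae: "AE x in M. x \<in> A \<longleftrightarrow> phi x \<in> C"
    using A(2) unfolding captured_def by blast
  let ?C = "odometer_shift (- v) -` C \<inter> space (odometer_borel G)"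
  have "AE x in M. x \<in> T v ` A \<longleftrightarrow> phi x \<in> ?C"
    using AE_translate[OF ae, of "- v"] phi_equivariant[of "- v"] AE_space
  proof eventually_elim
    case (elim x)
    then show ?case
      using mem_T_image_iff[OF elim(3) sets.sets_into_space[OF A(1)], of v] phi_in_space[of x]
      by (simp only: vimage_eq Int_iff space_odometer_borel simp_thms)
  qed
  moreover have "?C \<in> sets (odometer_borel G)"
    by (rule measurable_sets[OF measurable_odometer_shift[OF G] C])
  ultimately show ?thesis unfolding captured_def by blast
qed

lemma captured_levels:
  assumes "finite S" shows "captured (levels n S)"
  using assms
proof (induction S rule: finite_induct)
  case empty
  show ?case unfolding captured_def by (rule bexI[of _ "{}"]) auto
next
  case (insert v S)
  obtain C where C: "C \<in> sets (odometer_borel G)" "AE x in M. x \<in> levels n S \<longleftrightarrow> phi x \<in> C"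
    using insert.IH unfolding captured_def by blast
  obtain E where E: "E \<in> sets (odometer_borel G)" "AE x in M. x \<in> T v ` B n \<longleftrightarrow> phi x \<in> E"
    using captured_translate[OF base_in_sets captured_base] unfolding captured_def by blast
  have "AE x in M. x \<in> levels n (insert v S) \<longleftrightarrow> phi x \<in> E \<union> C"
    using C(2) E(2)
  proof eventually_elim
    case (elim x)
    have "x \<in> levels n (insert v S) \<longleftrightarrow> x \<in> T v ` B n \<or> x \<in> levels n S" by blast
    then show ?case using elim by (simp only: Un_iff)
  qed
  then show ?case unfolding captured_def using C(1) E(1) by blast
qed

lemma captured_all:
  assumes A: "A \<in> sets M" shows "captured A"
  unfolding captured_def
proof (rule measurable_modulo_null_if_approximable[OF A measurable_phi])
  fix e :: real assume "e > 0"
  then obtain n D where D: "D \<subseteq> F n" "measure M (sym_diff A (levels n D)) < e"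
    using rank_one_approx[OF A] by blast
  have "captured (levels n D)" using D(1) shape_finite finite_subset by (intro captured_levels) blast
  then obtain C where C: "C \<in> sets (odometer_borel G)" "AE x in M. x \<in> levels n D \<longleftrightarrow> phi x \<in> C"
    unfolding captured_def by blast
  have Cs: "phi -` C \<inter> space M \<in> sets M" by (rule measurable_sets[OF measurable_phi C(1)])
  have "measure M (sym_diff A (phi -` C \<inter> space M)) = measure M (sym_diff A (levels n D))"
  proof (rule measure_eq_AE)
    show "AE x in M. x \<in> sym_diff A (phi -` C \<inter> space M) \<longleftrightarrow> x \<in> sym_diff A (levels n D)"
      using C(2) AE_space
    proof eventually_elim
      case (elim x)
      then show ?case by (simp only: Un_iff Diff_iff Int_iff vimage_eq simp_thms)
    qed
  qed (use A Cs levels_in_sets in auto)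
  then have "measure M (sym_diff A (phi -` C \<inter> space M)) < e" using D(2) by (simp only:)
  then show "\<exists>C\<in>sets (odometer_borel G). measure M (sym_diff A (phi -` C \<inter> space M)) < e"
    by (rule bexI[OF _ C(1)])
qed

text \<open>The sets \<open>{x. r x < q}\<close> for rational \<open>q\<close> separate points off a null set and are all captured, so two
points with the same image have the same coordinate \<open>r\<close>.\<close>

lemma phi_ae_injective: "ae_injective M phi"
proof -
  obtain r :: "'a \<Rightarrow> real" and k :: "real \<Rightarrow> 'a"
    where r: "r \<in> borel_measurable M" and kr: "AE x in M. k (r x) = x"
  proof (rule lebesgue_probability_space_coordinate[OF lebesgue_space])
    fix r :: "'a \<Rightarrow> real" and k :: "real \<Rightarrow> 'a"
    assume "r \<in> borel_measurable M" "AE x in M. k (r x) = x"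
    then show thesis by (rule that[of r k])
  qed
  have "captured {x \<in> space M. r x < of_rat q}" for q
    by (rule captured_all) (use r in measurable)
  then have "\<forall>q. \<exists>C. AE x in M. x \<in> {x \<in> space M. r x < of_rat q} \<longleftrightarrow> phi x \<in> C"
    unfolding captured_def by blast
  from choice[OF this] obtain C where "\<forall>q. AE x in M. x \<in> {x \<in> space M. r x < of_rat q} \<longleftrightarrow> phi x \<in> C q"
    by (rule exE)
  then have "AE x in M. \<forall>q. x \<in> {x \<in> space M. r x < of_rat q} \<longleftrightarrow> phi x \<in> C q"
    by (subst AE_all_countable)
  then have "AE x in M. (\<forall>q. r x < of_rat q \<longleftrightarrow> phi x \<in> C q) \<and> k (r x) = x"
    using kr AE_space by eventually_elim simp
  then obtain Z where Z: "Z \<in> null_sets M"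
    "{x \<in> space M. \<not> ((\<forall>q. r x < of_rat q \<longleftrightarrow> phi x \<in> C q) \<and> k (r x) = x)} \<subseteq> Z"
    unfolding eventually_ae_filter by blast
  have "inj_on phi (space M - Z)"
  proof (rule inj_onI)
    fix x y assume xy: "x \<in> space M - Z" "y \<in> space M - Z" "phi x = phi y"
    have good: "(\<forall>q. r z < of_rat q \<longleftrightarrow> phi z \<in> C q) \<and> k (r z) = z" if "z \<in> space M - Z" for z
      using that Z(2) by blast
    have same: "r x < of_rat q \<longleftrightarrow> r y < of_rat q" for q
      using good[OF xy(1)] good[OF xy(2)] xy(3) by metis
    have "r x = r y"
    proof (rule ccontr)
      assume "r x \<noteq> r y"
      then consider "r x < r y" | "r y < r x" by linarith
      then show False
      proof cases
        case 1
        then obtain q where "r x < of_rat q" "of_rat q < r y" using of_rat_dense by blast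
        then show False using same[of q] by linarith
      next
        case 2
        then obtain q where "r y < of_rat q" "of_rat q < r x" using of_rat_dense by blast
        then show False using same[of q] by linarith
      qed
    qed
    then show "x = y" using good[OF xy(1)] good[OF xy(2)] by metis
  qed
  then show ?thesis using Z(1) unfolding ae_injective_def by blast
qed

lemma odometer_infinite: "infinite (odometer_space G)"
proof
  assume fin: "finite (odometer_space G)"
  obtain Z where Z: "Z \<in> null_sets M" "inj_on phi (space M - Z)"
    using phi_ae_injective unfolding ae_injective_def by blast
  have "finite (phi ` (space M - Z))"
    by (rule finite_subset[OF _ fin]) (use phi_in_space in blast)
  then have "finite (space M - Z)" using Z(2) by (rule finite_imageD)
  then show False using infinite_if_almost_full[OF Z(1)] by simp
qed

definition image_measure :: "(nat \<Rightarrow> (int ^ 'd) set) measure" where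
  "image_measure = distr M (odometer_borel G) phi"

lemma sets_image_measure: "sets image_measure = sets (odometer_borel G)"
  by (simp add: image_measure_def)

lemma measurable_phi': "phi \<in> M \<rightarrow>\<^sub>M image_measure"
  using measurable_phi measurable_cong_sets[OF refl sets_image_measure] by blast

lemma distr_phi: "distr M image_measure phi = image_measure"
  unfolding image_measure_def by (rule distr_cong) simp_all

lemma haar_image_measure: "odometer_haar G image_measure"
proof (rule odometer_haar_if_shift_invariant[OF G sets_image_measure])
  have "emeasure image_measure (space image_measure) = emeasure M (phi -` space (odometer_borel G) \<inter> space M)"
    unfolding image_measure_def using emeasure_distr[OF measurable_phi sets.top] by simp
  also have "phi -` space (odometer_borel G) \<inter> space M = space M"
    using measurable_space[OF measurable_phi] by blast
  finally show "emeasure image_measure (space image_measure) = 1"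
    by (simp add: zd_action_total_mass[OF action])
  fix v
  have sm: "odometer_shift v \<in> image_measure \<rightarrow>\<^sub>M image_measure"
    using measurable_odometer_shift[OF G] measurable_cong_sets[OF sets_image_measure sets_image_measure] by blast
  have "distr image_measure image_measure (odometer_shift v) =
      distr (distr M image_measure phi) image_measure (odometer_shift v)" by (simp only: distr_phi)
  also have "\<dots> = distr M image_measure (odometer_shift v \<circ> phi)"
    by (rule distr_distr[OF sm measurable_phi'])
  also have "\<dots> = distr M image_measure (phi \<circ> T v)"
  proof (rule distr_cong_AE)
    show "AE x in M. (odometer_shift v \<circ> phi) x = (phi \<circ> T v) x"
      using phi_equivariant[of v] by eventually_elim simp
    show "odometer_shift v \<circ> phi \<in> M \<rightarrow>\<^sub>M image_measure" by (rule measurable_comp[OF measurable_phi' sm])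
    show "phi \<circ> T v \<in> M \<rightarrow>\<^sub>M image_measure" by (rule measurable_comp[OF T_measurable measurable_phi'])
  qed simp_all
  also have "\<dots> = distr (distr M M (T v)) image_measure phi"
    by (rule distr_distr[OF measurable_phi' T_measurable, symmetric])
  also have "\<dots> = image_measure" by (simp only: T_distr distr_phi)
  finally show "distr image_measure image_measure (odometer_shift v) = image_measure" .
qed

lemma conjugate_to_constructed_odometer: "conjugate_to_infinite_odometer M T"
proof -
  have "factor_map M T image_measure odometer_shift phi"
    unfolding factor_map_def using measurable_phi' distr_phi phi_equivariant by blast
  then have "conjugate M T image_measure odometer_shift"
    unfolding conjugate_def using phi_ae_injective by blast
  then show ?thesis
    unfolding conjugate_to_infinite_odometer_def using G odometer_infinite haar_image_measure by blast
qed

end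

context stacking_towers
begin

lemma descendants_traced_subgroup:
  assumes sub: "subgroup H Zd" "subgroup K Zd" "K \<subseteq> H" and tr: "descendants_traced H l \<epsilon>"
  shows "descendants_traced K l \<epsilon>"
proof -
  obtain N where N: "\<And>m. m \<ge> N \<Longrightarrow> m \<ge> l \<Longrightarrow> \<exists>D \<subseteq> rcosets\<^bsub>Zd\<^esub> H.
      real (card (sym_diff (desc l m) {i \<in> F m. H #>\<^bsub>Zd\<^esub> i \<in> D})) / real (card (desc l m)) < \<epsilon>"
    using tr unfolding descendants_traced_def by blast
  show ?thesis
    unfolding descendants_traced_def
  proof (intro exI[of _ N] allI impI)
    fix m assume "m \<ge> N" "m \<ge> l"
    then obtain D where D: "real (card (sym_diff (desc l m) {i \<in> F m. H #>\<^bsub>Zd\<^esub> i \<in> D})) / real (card (desc l m)) < \<epsilon>"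
      using N by blast
    let ?D = "{c \<in> rcosets\<^bsub>Zd\<^esub> K. quotient_map H c \<in> D}"
    have eq: "{i \<in> F m. K #>\<^bsub>Zd\<^esub> i \<in> ?D} = {i \<in> F m. H #>\<^bsub>Zd\<^esub> i \<in> D}"
      by (simp add: quotient_map_coset[OF sub] Zd_coset_in_rcosets)
    have "?D \<subseteq> rcosets\<^bsub>Zd\<^esub> K" by blast
    then show "\<exists>D \<subseteq> rcosets\<^bsub>Zd\<^esub> K.
      real (card (sym_diff (desc l m) {i \<in> F m. K #>\<^bsub>Zd\<^esub> i \<in> D})) / real (card (desc l m)) < \<epsilon>"
      by (rule exI[of _ ?D, OF conjI]) (unfold eq, rule D)
  qed
qed

text \<open>If the two minorities together are not everything, some descendant \<open>g\<close> lies in both majority cosets, and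
the intersection of these two cosets is the coset of \<open>g\<close> modulo the intersection.\<close>

lemma descendants_concentrate_Int:
  assumes "descendants_concentrate H" "descendants_concentrate K"
    and sub: "subgroup H Zd" "subgroup K Zd"
  shows "descendants_concentrate (H \<inter> K)"
  unfolding descendants_concentrate_def
proof (intro allI impI)
  fix \<eta> :: real assume "\<eta> > 0"
  define \<eta>' where "\<eta>' = min (\<eta>/2) (1/2)"
  have \<eta>': "\<eta>' > 0" "\<eta>' \<le> 1/2" "2 * \<eta>' \<le> \<eta>" using \<open>\<eta> > 0\<close> by (auto simp: \<eta>'_def)
  obtain N1 where N1: "\<And>m n. m \<ge> N1 \<Longrightarrow> n > m \<Longrightarrow>
      \<exists>g. real (card {i \<in> desc m n. i \<notin> H #>\<^bsub>Zd\<^esub> g}) / real (card (desc m n)) < \<eta>'"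
    using assms(1) \<eta>'(1) unfolding descendants_concentrate_def by blast
  obtain N2 where N2: "\<And>m n. m \<ge> N2 \<Longrightarrow> n > m \<Longrightarrow>
      \<exists>g. real (card {i \<in> desc m n. i \<notin> K #>\<^bsub>Zd\<^esub> g}) / real (card (desc m n)) < \<eta>'"
    using assms(2) \<eta>'(1) unfolding descendants_concentrate_def by blast
  show "\<exists>N. \<forall>m\<ge>N. \<forall>n>m. \<exists>g.
      real (card {i \<in> desc m n. i \<notin> (H \<inter> K) #>\<^bsub>Zd\<^esub> g}) / real (card (desc m n)) < \<eta>"
  proof (intro exI[of _ "max N1 N2"] allI impI)
    fix m n assume mn: "m \<ge> max N1 N2" "n > m"
    let ?c = "real (card (desc m n))"
    have c: "?c > 0" using card_desc_pos[of m n] mn by simp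
    obtain g1 where "real (card {i \<in> desc m n. i \<notin> H #>\<^bsub>Zd\<^esub> g1}) / ?c < \<eta>'"
      using N1[of m n] mn by auto
    then have g1: "real (card {i \<in> desc m n. i \<notin> H #>\<^bsub>Zd\<^esub> g1}) < \<eta>' * ?c" using c by (simp add: divide_less_eq)
    obtain g2 where "real (card {i \<in> desc m n. i \<notin> K #>\<^bsub>Zd\<^esub> g2}) / ?c < \<eta>'"
      using N2[of m n] mn by auto
    then have g2: "real (card {i \<in> desc m n. i \<notin> K #>\<^bsub>Zd\<^esub> g2}) < \<eta>' * ?c" using c by (simp add: divide_less_eq)
    let ?U = "{i \<in> desc m n. i \<notin> H #>\<^bsub>Zd\<^esub> g1} \<union> {i \<in> desc m n. i \<notin> K #>\<^bsub>Zd\<^esub> g2}"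
    have "card ?U \<le> card {i \<in> desc m n. i \<notin> H #>\<^bsub>Zd\<^esub> g1} + card {i \<in> desc m n. i \<notin> K #>\<^bsub>Zd\<^esub> g2}"
      by (rule card_Un_le)
    then have U: "real (card ?U) < 2 * \<eta>' * ?c" using g1 g2 by linarith
    also have "\<dots> \<le> 1 * ?c" using \<eta>' by (intro mult_right_mono) auto
    finally have lt: "card ?U < card (desc m n)" by simp
    have finU: "finite ?U" using finite_desc[of m n] by simp
    have "\<not> desc m n \<subseteq> ?U" using card_mono[OF finU, of "desc m n"] lt by linarith
    \<comment> \<open>An element in both majority classes names the common coset.\<close>
    then obtain g where "g \<in> desc m n" "g \<notin> ?U" by blast
    then have g: "g - g1 \<in> H" "g - g2 \<in> K" by (auto simp: mem_Zd_coset_iff)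
    have eq: "H #>\<^bsub>Zd\<^esub> g = H #>\<^bsub>Zd\<^esub> g1" "K #>\<^bsub>Zd\<^esub> g = K #>\<^bsub>Zd\<^esub> g2"
      using g by (simp_all add: Zd_coset_eq_iff sub)
    have "(H \<inter> K) #>\<^bsub>Zd\<^esub> g = (H #>\<^bsub>Zd\<^esub> g) \<inter> (K #>\<^bsub>Zd\<^esub> g)"
      by (simp add: set_eq_iff mem_Zd_coset_iff)
    then have "{i \<in> desc m n. i \<notin> (H \<inter> K) #>\<^bsub>Zd\<^esub> g} = ?U" unfolding eq by blast
    moreover have "2 * \<eta>' * ?c \<le> \<eta> * ?c" using \<eta>' by (intro mult_right_mono) auto
    ultimately have "real (card {i \<in> desc m n. i \<notin> (H \<inter> K) #>\<^bsub>Zd\<^esub> g}) < \<eta> * ?c" using U by simp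
    then show "\<exists>g. real (card {i \<in> desc m n. i \<notin> (H \<inter> K) #>\<^bsub>Zd\<^esub> g}) / ?c < \<eta>"
      using c by (intro exI[of _ g]) (simp add: divide_less_eq)
  qed
qed

lemma descendants_concentrate_INT_atMost:
  assumes "\<And>k::nat. descendants_concentrate (H k)" "\<And>k. finite_index_subgroup (H k)"
  shows "descendants_concentrate (\<Inter>k\<le>j. H k)"
proof (induction j)
  case 0
  show ?case using assms(1)[of 0] by simp
next
  case (Suc j)
  have "(\<Inter>k\<le>Suc j. H k) = H (Suc j) \<inter> (\<Inter>k\<le>j. H k)" by (simp add: atMost_Suc)
  moreover have "descendants_concentrate (H (Suc j) \<inter> (\<Inter>k\<le>j. H k))"
    using finite_index_subgroup_INT_atMost[of H j, OF assms(2)] assms(2)[of "Suc j"]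
    by (intro descendants_concentrate_Int assms(1) Suc) (simp_all add: finite_index_subgroup_def)
  ultimately show ?case by (simp only:)
qed

text \<open>The subgroups \<open>H k\<close> serve the pairs \<open>(l, 1/(q+1))\<close> coded by \<open>k\<close>, and \<open>G j\<close> is the intersection of the
first ones. Each tower \<open>m (Suc k)\<close> is chosen late, depending on the shape of tower \<open>m k\<close>, to make the
boundary terms small.\<close>

lemma odometer_if_descendants_condition:
  assumes cond: "\<And>l \<epsilon>. \<epsilon> > 0 \<Longrightarrow>
    \<exists>G. finite_index_subgroup G \<and> descendants_traced G l \<epsilon> \<and> descendants_concentrate G"
  shows "conjugate_to_infinite_odometer M T"
proof -
  have "\<forall>k. \<exists>G. finite_index_subgroup G \<and>
      descendants_traced G (fst (prod_decode k)) (1 / (real (snd (prod_decode k)) + 1)) \<and>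
      descendants_concentrate G"
    by (intro allI cond) simp
  from choice[OF this] obtain H where H: "\<forall>k. finite_index_subgroup (H k) \<and>
      descendants_traced (H k) (fst (prod_decode k)) (1 / (real (snd (prod_decode k)) + 1)) \<and>
      descendants_concentrate (H k)"
    by (rule exE)
  have H1: "finite_index_subgroup (H k)" and H2: "descendants_concentrate (H k)"
    and H3: "descendants_traced (H k) (fst (prod_decode k)) (1 / (real (snd (prod_decode k)) + 1))" for k
    using spec[OF H, of k] by simp_all
  define G where "G = (\<lambda>j. \<Inter>k\<le>j. H k)"
  have G1: "finite_index_subgroup (G j)" for j
    unfolding G_def by (rule finite_index_subgroup_INT_atMost[OF H1])
  have G2: "descendants_concentrate (G j)" for j
    unfolding G_def by (rule descendants_concentrate_INT_atMost[OF H2 H1])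
  have GH: "G j \<subseteq> H j" for j by (auto simp: G_def)
  have odo: "odometer_data G"
    unfolding odometer_data_def
  proof (intro conjI allI G1)
    show "decseq G" unfolding G_def by (rule decseq_SucI) (auto simp: atMost_Suc)
  qed
  \<comment> \<open>Condition (a) for a subgroup implies it for every smaller one.\<close>
  have tr: "\<exists>j. descendants_traced (G j) l \<epsilon>" if e: "\<epsilon> > 0" for l \<epsilon>
  proof -
    obtain q where q: "1 / (real q + 1) < \<epsilon>"
      using reals_Archimedean[OF e] by (auto simp: inverse_eq_divide add.commute)
    let ?k = "prod_encode (l, q)"
    have "descendants_traced (G ?k) l (1 / (real q + 1))"
      using descendants_traced_subgroup[OF _ _ GH H3, of ?k] H1[of ?k] G1[of ?k]
      by (simp add: finite_index_subgroup_def)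
    then have "descendants_traced (G ?k) l \<epsilon>"
      unfolding descendants_traced_def using q by (meson less_trans)
    then show ?thesis by blast
  qed
  let ?P = "\<lambda>k m. (\<forall>n>m. \<exists>g. real (card {i \<in> desc m n. i \<notin> G k #>\<^bsub>Zd\<^esub> g}) / real (card (desc m n)) < (1/2)^k)
      \<and> measure M (err m) \<le> (1/2)^k"
  let ?Q = "\<lambda>k m m'. m < m' \<and> (\<Sum>i\<in>F m. card (boundary m' i) * measure M (B m')) \<le> (1/2)^k"
  have P: "\<forall>\<^sub>F m in sequentially. ?P k m" for k
  proof (rule eventually_conj)
    have "(1/2)^k > (0::real)" by simp
    with G2[of k] show "\<forall>\<^sub>F m in sequentially. \<forall>n>m. \<exists>g.
        real (card {i \<in> desc m n. i \<notin> G k #>\<^bsub>Zd\<^esub> g}) / real (card (desc m n)) < (1/2)^k"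
      unfolding descendants_concentrate_def eventually_sequentially by blast
    have "\<forall>\<^sub>F m in sequentially. measure M (err m) < (1/2)^k"
      by (rule order_tendstoD(2)[OF err_tendsto_0]) simp
    then show "\<forall>\<^sub>F m in sequentially. measure M (err m) \<le> (1/2)^k" by eventually_elim simp
  qed
  have Q: "\<forall>\<^sub>F m' in sequentially. ?Q k m m'" for k m
  proof (rule eventually_conj)
    show "\<forall>\<^sub>F m' in sequentially. m < m'" by (rule eventually_gt_at_top)
    have "(\<lambda>m'. \<Sum>i\<in>F m. card (boundary m' i) * measure M (B m')) \<longlonglongrightarrow> (\<Sum>i\<in>F m. 0)"
      by (intro tendsto_sum boundary_mass_tendsto_0)
    then have "(\<lambda>m'. \<Sum>i\<in>F m. card (boundary m' i) * measure M (B m')) \<longlonglongrightarrow> 0" by simp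
    then have "\<forall>\<^sub>F m' in sequentially. (\<Sum>i\<in>F m. card (boundary m' i) * measure M (B m')) < (1/2)^k"
      by (rule order_tendstoD(2)) simp
    then show "\<forall>\<^sub>F m' in sequentially. (\<Sum>i\<in>F m. card (boundary m' i) * measure M (B m')) \<le> (1/2)^k"
      by eventually_elim simp
  qed
  have "\<exists>m. \<forall>k. ?P k (m k) \<and> ?Q k (m k) (m (Suc k))"
  proof (rule dependent_nat_choice)
    show "\<exists>m. ?P 0 m" by (rule eventually_happens'[OF sequentially_bot P])
    fix m k
    show "\<exists>m'. ?P (Suc k) m' \<and> ?Q k m m'"
      by (rule eventually_happens'[OF sequentially_bot eventually_conj[OF P[of "Suc k"] Q[where k = k and m = m]]])
  qed
  then obtain m where m: "\<forall>k. ?P k (m k) \<and> ?Q k (m k) (m (Suc k))" by (rule exE)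
  have "\<forall>k. \<exists>g. real (card {i \<in> desc (m k) (m (Suc k)). i \<notin> G k #>\<^bsub>Zd\<^esub> g})
      / real (card (desc (m k) (m (Suc k)))) < (1/2)^k"
    using m by blast
  from choice[OF this] obtain g where g: "\<forall>k. real (card {i \<in> desc (m k) (m (Suc k)). i \<notin> G k #>\<^bsub>Zd\<^esub> g k})
      / real (card (desc (m k) (m (Suc k)))) < (1/2)^k"
    by (rule exE)
  define h where "h = (\<lambda>k. \<Sum>i<k. g i)"
  have "odometer_construction M T F B G m h"
  proof unfold_locales
    show "odometer_data G" by (rule odo)
    show "strict_mono m" using m by (auto simp: strict_mono_Suc_iff)
    show "measure M (err (m k)) \<le> (1/2)^k" for k using m by blast
    show "(\<Sum>i\<in>F (m k). card (boundary (m (Suc k)) i) * measure M (B (m (Suc k)))) \<le> (1/2)^k" for k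
      using m by blast
    show "real (card {i \<in> desc (m k) (m (Suc k)). i - (h (Suc k) - h k) \<notin> G k})
        \<le> (1/2)^k * real (card (desc (m k) (m (Suc k))))" for k
    proof -
      have "m k \<le> m (Suc k)" using m by (simp add: less_imp_le)
      moreover have "h (Suc k) - h k = g k" by (simp add: h_def)
      ultimately show ?thesis
        using spec[OF g, of k] card_desc_pos[of "m k" "m (Suc k)"]
        by (simp add: mem_Zd_coset_iff divide_less_eq)
    qed
    show "\<exists>j. descendants_traced (G j) l \<epsilon>" if "\<epsilon> > 0" for l \<epsilon> by (rule tr[OF that])
  qed
  then show ?thesis by (rule odometer_construction.conjugate_to_constructed_odometer)
qed

end

theorem theorem5p2:
  fixes M :: "'a measure"
    and T :: "int ^ 'd \<Rightarrow> 'a \<Rightarrow> 'a"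
    and F :: "nat \<Rightarrow> (int ^ 'd) set"
    and B :: "nat \<Rightarrow> 'a set"
  assumes "zd_action M T"
    and "folner_rank_one M T"
    and "folner_sequence F"
    and "\<And>n. 0 \<in> F n"
    and "rank_one_towers M T F B"
    and "stacking M T F B"
  shows "conjugate_to_infinite_odometer M T \<longleftrightarrow>
    (\<forall>l. \<forall>\<epsilon>::real. \<epsilon> > 0 \<longrightarrow>
      (\<exists>G. finite_index_subgroup G \<and>
        (\<exists>N\<^sub>a. \<forall>m\<ge>N\<^sub>a. m \<ge> l \<longrightarrow>
          (\<exists>D \<subseteq> rcosets\<^bsub>Zd\<^esub> G.
             real (card (sym_diff (descendants T F B l m) {i \<in> F m. G #>\<^bsub>Zd\<^esub> i \<in> D}))
               / real (card (descendants T F B l m)) < \<epsilon>)) \<and>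
        (\<forall>\<eta>::real. \<eta> > 0 \<longrightarrow>
          (\<exists>N\<^sub>b. \<forall>m\<ge>N\<^sub>b. \<forall>n>m.
            (\<exists>g. real (card {i \<in> descendants T F B m n. i \<notin> G #>\<^bsub>Zd\<^esub> g})
                   / real (card (descendants T F B m n)) < \<eta>)))))"
proof -
  interpret stacking_towers M T F B by (rule stacking_towers.intro[OF assms(1,3-6)])
  show ?thesis
    unfolding descendants_traced_def[symmetric] descendants_concentrate_def[symmetric]
    using descendants_condition_if_odometer odometer_if_descendants_condition by blast
qed

end
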